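(* Let $D\subset\mathbb{C}^2$ be an open polydisc centred at the origin, let $R^k_{ij}$ ($k\in\{1,2,3\}$, $i,j\in\{1,2\}$) be differential operators with holomorphic coefficients on $D$ having properties (1)–(3) listed in the context, and let $\mathcal{M}=\operatorname{coker}\phi$ be the associated left $\mathcal{D}$-module on $D$ defined in the context. Then the characteristic variety $V$ of $\mathcal{M}$ is included in $$\bigcap_{j=1}^{3}P_j^{-1}(0)=N(S)\cup\{(p,q,0,0)\}$$ (these sets being taken over $D$), and: 1. The $\mathcal{D}$-module $\mathcal{M}$ is holonomic. 2. The vector $(z,z^2)$ defines a holomorphic solution of $\mathcal{M}$ on every simply connected open subset of $D\setminus\Delta^{-1}(0)$.
   Context: Coordinates on $\mathbb{C}^2$ are $(p,q)$, and $(p,q,\xi_1,\xi_2)$ on $T^*\mathbb{C}^2$, with $\xi_1$ dual to $p$ and $\xi_2$ dual to $q$. The function $z=z(p,q)$ denotes a local holomorphic branch of the solution of $z^3=pz+q$, $\Delta=4p^3-27q^2$, and $S=\Delta^{-1}(0)$ is the cusp. The co-normal of $S$ is the closure of the co-normal of its regular part: $N(S)=\{(3z^2,-2z^3,z\lambda,\lambda):(z,\lambda)\in\mathbb{C}^2\}$. Define $$P_1=\tfrac{p}{3}\xi_2^2-\xi_1^2,\quad P_2=\tfrac{q}{2}\xi_2^3+\xi_1^3,\quad P_3=(4p^3-27q^2)\xi_1^2,$$ with degrees in $(\xi_1,\xi_2)$: $m_1=2$, $m_2=3$, $m_3=2$. The operators $R^k_{ij}$ satisfy, for $k=1,2,3$: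 (1) for $i\ne j$, $R^k_{ij}$ has order at most $m_k-1$; (2) $R^k_{ii}$ has order $m_k$ and principal symbol $P_k$; (3) $R^k_{11}z+R^k_{12}z^2=0$ and $R^k_{21}z+R^k_{22}z^2=0$. (On a suitable polydisc $D$ such operators exist.) $\mathcal{D}$ is the sheaf of holomorphic differential operators on $D$. The left $\mathcal{D}$-module morphism $\phi:\mathcal{D}^6\to\mathcal{D}^2$ is $$\phi\big((Q^k_\ell)_{k\in\{1,2,3\},\,\ell\in\{1,2\}}\big)=\sum_{k,\ell}\big(Q^k_\ell R^k_{\ell 1},\,Q^k_\ell R^k_{\ell 2}\big),$$ and $\mathcal{M}=\mathcal{D}^2/\phi(\mathcal{D}^6)$. A coherent $\mathcal{D}$-module is holonomic if its characteristic variety is Lagrangian. That $(z,z^2)$ defines a holomorphic solution of $\mathcal{M}$ on an open set $U$ means that, for a holomorphic branch $z$ on $U$, the map $(A,B)\mapsto A\,z+B\,z^2$ induces a well-defined $\mathcal{D}$-linear morphism from $\mathcal{M}|_U$ to the sheaf of holomorphic functions on $U$. *)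

theory Defs
  imports "HOL-Analysis.Analysis" "HOL-Library.Function_Algebras"
begin

section \<open>Several complex variables\<close>

definition holo :: "(complex^'n) set \<Rightarrow> (complex^'n \<Rightarrow> complex) \<Rightarrow> bool" where
  "holo U f \<longleftrightarrow> (\<forall>x\<in>U. \<exists>L. (f has_derivative L) (at x) \<and> (\<forall>c v. L (c *s v) = c * L v))"

definition pdiff :: "'n \<Rightarrow> (complex^'n \<Rightarrow> complex) \<Rightarrow> complex^'n \<Rightarrow> complex" where
  "pdiff i f x = deriv (\<lambda>t. f (x + t *s axis i 1)) 0"

definition common_zeros ::
    "(complex^'n) set \<Rightarrow> nat \<Rightarrow> (nat \<Rightarrow> complex^'n \<Rightarrow> complex) \<Rightarrow> (complex^'n) set" where
  "common_zeros U k f = {y\<in>U. \<forall>i<k. f i y = 0}"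

definition analytic_subset :: "(complex^'n) set \<Rightarrow> (complex^'n) set \<Rightarrow> bool" where
  "analytic_subset X V \<longleftrightarrow> V \<subseteq> X \<and>
     (\<forall>x\<in>X. \<exists>U k f. open U \<and> x \<in> U \<and> U \<subseteq> X \<and> (\<forall>i<k. holo U (f i)) \<and>
        V \<inter> U = common_zeros U k f)"

text \<open>\<open>regular_at V x T\<close>: near \<open>x \<in> V\<close> the set \<open>V\<close> is a complex submanifold, cut out by holomorphic
  equations whose differentials at \<open>x\<close> are linearly independent over the complex numbers, and \<open>T\<close>
  is its tangent space at \<open>x\<close>.\<close>

definition regular_at :: "(complex^'n) set \<Rightarrow> complex^'n \<Rightarrow> (complex^'n) set \<Rightarrow> bool" where
  "regular_at V x T \<longleftrightarrow> x \<in> V \<and>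
     (\<exists>U k f. open U \<and> x \<in> U \<and> (\<forall>i<k. holo U (f i)) \<and> V \<inter> U = common_zeros U k f \<and>
        (\<forall>c. (\<forall>v. (\<Sum>i<k. c i * frechet_derivative (f i) (at x) v) = 0) \<longrightarrow> (\<forall>i<k. c i = 0)) \<and>
        T = {v. \<forall>i<k. frechet_derivative (f i) (at x) v = 0})"

section \<open>The cotangent bundle\<close>

text \<open>Points of the cotangent bundle are \<open>(p, q, \<xi>\<^sub>1, \<xi>\<^sub>2)\<close>, with components 1 to 4.\<close>

definition base :: "complex^4 \<Rightarrow> complex^2" where
  "base w = vector [w$1, w$2]"

definition cotangent :: "(complex^2) set \<Rightarrow> (complex^4) set" where
  "cotangent X = {w. base w \<in> X}"

text \<open>The form \<open>d\<xi>\<^sub>1 \<and> dp + d\<xi>\<^sub>2 \<and> dq\<close>.\<close>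

definition symplectic_form :: "complex^4 \<Rightarrow> complex^4 \<Rightarrow> complex" where
  "symplectic_form u v = (u$3 * v$1 - u$1 * v$3) + (u$4 * v$2 - u$2 * v$4)"

text \<open>A Lagrangian variety is an analytic set whose tangent space at every regular point is its own
  symplectic orthogonal. As regular points are dense, this says that it has pure dimension 2 and
  that the symplectic form vanishes on its regular part.\<close>

definition lagrangian :: "(complex^2) set \<Rightarrow> (complex^4) set \<Rightarrow> bool" where
  "lagrangian X V \<longleftrightarrow> analytic_subset (cotangent X) V \<and>
     (\<forall>w T. regular_at V w T \<longrightarrow> T = {v. \<forall>u\<in>T. symplectic_form u v = 0})"

definition conormal :: "(complex^2) set \<Rightarrow> (complex^4) set" where
  "conormal A =
     closure {w. \<exists>T. regular_at A (base w) T \<and> (\<forall>v\<in>T. w$3 * v$1 + w$4 * v$2 = 0)}"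

section \<open>Holomorphic differential operators\<close>

text \<open>\<open>P :: dop\<close> stands for the sum over \<open>(a, b)\<close> of \<open>P (a, b) \<cdot> \<partial>\<^sub>p\<^sup>a \<partial>\<^sub>q\<^sup>b\<close>. Sections of the sheaf of
  differential operators have locally finite order; only the values of the coefficients on the
  open set at hand are relevant. Addition of operators is pointwise addition of functions.\<close>

type_synonym dop = "nat \<times> nat \<Rightarrow> complex^2 \<Rightarrow> complex"

definition diffops :: "(complex^2) set \<Rightarrow> dop set" where
  "diffops U = {P. (\<forall>\<alpha>. holo U (P \<alpha>)) \<and>
     (\<forall>x\<in>U. \<exists>V n. open V \<and> x \<in> V \<and> (\<forall>a b. n < a + b \<longrightarrow> (\<forall>y\<in>V. P (a, b) y = 0)))}"

definition mdiff :: "nat \<times> nat \<Rightarrow> (complex^2 \<Rightarrow> complex) \<Rightarrow> complex^2 \<Rightarrow> complex" where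
  "mdiff \<alpha> f = (pdiff 1 ^^ fst \<alpha>) ((pdiff 2 ^^ snd \<alpha>) f)"

definition dapply :: "dop \<Rightarrow> (complex^2 \<Rightarrow> complex) \<Rightarrow> complex^2 \<Rightarrow> complex" where
  "dapply P f x = (\<Sum>\<alpha> | P \<alpha> x \<noteq> 0. P \<alpha> x * mdiff \<alpha> f x)"

text \<open>Composition of operators. By the Leibniz rule, \<open>\<partial>\<^sub>p\<^sup>a \<partial>\<^sub>q\<^sup>b \<circ> g\<close> is the sum over \<open>k \<le> a\<close> and
  \<open>l \<le> b\<close> of \<open>(a choose k) (b choose l) (\<partial>\<^sub>p\<^sup>a\<^sup>-\<^sup>k \<partial>\<^sub>q\<^sup>b\<^sup>-\<^sup>l g) \<partial>\<^sub>p\<^sup>k \<partial>\<^sub>q\<^sup>l\<close>.\<close>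

definition dmul :: "dop \<Rightarrow> dop \<Rightarrow> dop" where
  "dmul P Q = (\<lambda>(c, d) x. \<Sum>(a, b) | P (a, b) x \<noteq> 0. \<Sum>k\<le>min a c. \<Sum>l\<le>min b d.
     of_nat (a choose k) * of_nat (b choose l) * P (a, b) x
       * mdiff (a - k, b - l) (Q (c - k, d - l)) x)"

text \<open>The order bound is an integer: the operators of order at most \<open>-1\<close> are those equal to 0.\<close>

definition order_le :: "(complex^2) set \<Rightarrow> int \<Rightarrow> dop \<Rightarrow> bool" where
  "order_le U m P \<longleftrightarrow> (\<forall>a b. m < int (a + b) \<longrightarrow> (\<forall>x\<in>U. P (a, b) x = 0))"

definition has_order :: "(complex^2) set \<Rightarrow> nat \<Rightarrow> dop \<Rightarrow> bool" where
  "has_order U m P \<longleftrightarrow> order_le U (int m) P \<and> \<not> order_le U (int m - 1) P"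

text \<open>The symbol of degree \<open>m\<close>, which is the principal symbol when \<open>m\<close> is the order.\<close>

definition symbol :: "nat \<Rightarrow> dop \<Rightarrow> complex^4 \<Rightarrow> complex" where
  "symbol m P w = (\<Sum>b\<le>m. P (m - b, b) (base w) * (w$3) ^ (m - b) * (w$4) ^ b)"

section \<open>Quotients of free modules over the sheaf of differential operators\<close>

text \<open>Elements of a stalk are given by representatives defined near the point.\<close>

definition dstalk :: "complex^2 \<Rightarrow> dop set" where
  "dstalk x = {P. \<exists>U. open U \<and> x \<in> U \<and> P \<in> diffops U}"

definition dstalk_le :: "complex^2 \<Rightarrow> int \<Rightarrow> dop set" where
  "dstalk_le x m = {P. \<exists>U. open U \<and> x \<in> U \<and> P \<in> diffops U \<and> order_le U m P}"

definition germ_eq :: "complex^2 \<Rightarrow> dop \<Rightarrow> dop \<Rightarrow> bool" where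
  "germ_eq x P Q \<longleftrightarrow> (\<exists>U. open U \<and> x \<in> U \<and> (\<forall>\<alpha>. \<forall>y\<in>U. P \<alpha> y = Q \<alpha> y))"

text \<open>The left linear map between free modules given by a matrix acting from the right, and the
  stalks of its image.\<close>

definition free_map :: "'s set \<Rightarrow> ('s \<Rightarrow> 'r \<Rightarrow> dop) \<Rightarrow> ('s \<Rightarrow> dop) \<Rightarrow> 'r \<Rightarrow> dop" where
  "free_map I \<Phi> Q = (\<lambda>j. \<Sum>i\<in>I. dmul (Q i) (\<Phi> i j))"

definition image_stalk :: "'s set \<Rightarrow> ('s \<Rightarrow> 'r \<Rightarrow> dop) \<Rightarrow> complex^2 \<Rightarrow> ('r \<Rightarrow> dop) set" where
  "image_stalk I \<Phi> x = {A. (\<forall>j. A j \<in> dstalk x) \<and>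
     (\<exists>Q. (\<forall>i\<in>I. Q i \<in> dstalk x) \<and> (\<forall>j. germ_eq x (A j) (free_map I \<Phi> Q j)))}"

text \<open>From here on a submodule \<open>N\<close> of a free module, with basis indexed by the finite type \<open>'r\<close>, is
  given by its stalks \<open>N x\<close>, and stands for the quotient sheaf of the free module by \<open>N\<close>. A section
  of the quotient over \<open>W\<close> assigns to each point of \<open>W\<close> an element of the quotient stalk, in a way
  that is locally induced by a section of the free module; it takes the value \<open>{}\<close> outside \<open>W\<close>.\<close>

definition qcoset :: "(complex^2 \<Rightarrow> ('r \<Rightarrow> dop) set) \<Rightarrow> complex^2 \<Rightarrow> ('r \<Rightarrow> dop) \<Rightarrow> ('r \<Rightarrow> dop) set"
  where "qcoset N x A = {B. (\<forall>j. B j \<in> dstalk x) \<and> A - B \<in> N x}"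

definition qclass :: "(complex^2 \<Rightarrow> ('r \<Rightarrow> dop) set) \<Rightarrow> (complex^2) set \<Rightarrow> ('r \<Rightarrow> dop)
    \<Rightarrow> complex^2 \<Rightarrow> ('r \<Rightarrow> dop) set" where
  "qclass N W A = (\<lambda>x. if x \<in> W then qcoset N x A else {})"

definition qsections :: "(complex^2 \<Rightarrow> ('r \<Rightarrow> dop) set) \<Rightarrow> (complex^2) set
    \<Rightarrow> (complex^2 \<Rightarrow> ('r \<Rightarrow> dop) set) set" where
  "qsections N W = {s. (\<forall>x. x \<notin> W \<longrightarrow> s x = {}) \<and>
     (\<forall>x\<in>W. \<exists>V A. open V \<and> x \<in> V \<and> V \<subseteq> W \<and> (\<forall>j. A j \<in> diffops V) \<and>
        (\<forall>y\<in>V. s y = qcoset N y A))}"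

definition qres :: "(complex^2) set \<Rightarrow> (complex^2 \<Rightarrow> ('r \<Rightarrow> dop) set)
    \<Rightarrow> complex^2 \<Rightarrow> ('r \<Rightarrow> dop) set" where
  "qres V s = (\<lambda>x. if x \<in> V then s x else {})"

definition qadd :: "(complex^2 \<Rightarrow> ('r \<Rightarrow> dop) set) \<Rightarrow> (complex^2 \<Rightarrow> ('r \<Rightarrow> dop) set)
    \<Rightarrow> complex^2 \<Rightarrow> ('r \<Rightarrow> dop) set" where
  "qadd s t = (\<lambda>x. {A + B | A B. A \<in> s x \<and> B \<in> t x})"

definition qact :: "(complex^2 \<Rightarrow> ('r \<Rightarrow> dop) set) \<Rightarrow> dop \<Rightarrow> (complex^2 \<Rightarrow> ('r \<Rightarrow> dop) set)
    \<Rightarrow> complex^2 \<Rightarrow> ('r \<Rightarrow> dop) set" where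
  "qact N P s = (\<lambda>x. \<Union>A\<in>s x. qcoset N x (\<lambda>j. dmul P (A j)))"

text \<open>Morphisms of sheaves of left modules over the differential operators on \<open>U\<close>, from the
  quotient restricted to \<open>U\<close> to the sheaf of holomorphic functions; \<open>h W\<close> is the map on sections
  over \<open>W\<close>, whose values only matter on \<open>W\<close>.\<close>

definition solution_morphism :: "(complex^2 \<Rightarrow> ('r \<Rightarrow> dop) set) \<Rightarrow> (complex^2) set
    \<Rightarrow> ((complex^2) set \<Rightarrow> (complex^2 \<Rightarrow> ('r \<Rightarrow> dop) set) \<Rightarrow> complex^2 \<Rightarrow> complex) \<Rightarrow> bool" where
  "solution_morphism N U h \<longleftrightarrow> (\<forall>W. open W \<and> W \<subseteq> U \<longrightarrow>
     (\<forall>s\<in>qsections N W. holo W (h W s)) \<and>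
     (\<forall>s\<in>qsections N W. \<forall>t\<in>qsections N W. \<forall>x\<in>W. h W (qadd s t) x = h W s x + h W t x) \<and>
     (\<forall>P\<in>diffops W. \<forall>s\<in>qsections N W. \<forall>x\<in>W. h W (qact N P s) x = dapply P (h W s) x) \<and>
     (\<forall>V s. open V \<and> V \<subseteq> W \<and> s \<in> qsections N W \<longrightarrow> (\<forall>x\<in>V. h V (qres V s) x = h W s x)))"

definition defines_solution :: "(complex^2 \<Rightarrow> ('r::finite \<Rightarrow> dop) set) \<Rightarrow> (complex^2) set
    \<Rightarrow> ('r \<Rightarrow> complex^2 \<Rightarrow> complex) \<Rightarrow> bool" where
  "defines_solution N U f \<longleftrightarrow> (\<exists>h. solution_morphism N U h \<and>
     (\<forall>W A. open W \<and> W \<subseteq> U \<and> (\<forall>j. A j \<in> diffops W) \<longrightarrow>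
        (\<forall>x\<in>W. h W (qclass N W A) x = (\<Sum>j\<in>UNIV. dapply (A j) (f j) x))))"

text \<open>Since the sheaf of differential operators is coherent, a module over it is coherent if and only
  if it is locally of finite presentation; the latter is used as the definition.\<close>

definition coherent_quotient :: "(complex^2) set \<Rightarrow> (complex^2 \<Rightarrow> ('r::finite \<Rightarrow> dop) set) \<Rightarrow> bool"
  where "coherent_quotient X N \<longleftrightarrow> (\<forall>x\<in>X. \<exists>U s (\<Phi> :: nat \<Rightarrow> 'r \<Rightarrow> dop).
     open U \<and> x \<in> U \<and> U \<subseteq> X \<and> (\<forall>i<s. \<forall>j. \<Phi> i j \<in> diffops U) \<and>
     (\<forall>y\<in>U. N y = image_stalk {..<s} \<Phi> y))"

text \<open>The characteristic variety is the zero set of the annihilator of the graded module associated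
  with a good filtration, and does not depend on the good filtration. The one used here is the image
  of the order filtration of the free module. The annihilator is a homogeneous ideal, and its
  elements of degree \<open>m\<close> are the symbols of operators \<open>P\<close> of order at most \<open>m\<close> which map the
  \<open>k\<close>-th step of the filtration to the step \<open>m + k - 1\<close>, for all \<open>k\<close>.\<close>

definition annihilates_gr :: "(complex^2 \<Rightarrow> ('r \<Rightarrow> dop) set) \<Rightarrow> complex^2 \<Rightarrow> nat \<Rightarrow> dop \<Rightarrow> bool" where
  "annihilates_gr N x m P \<longleftrightarrow> P \<in> dstalk_le x (int m) \<and>
     (\<forall>k A. (\<forall>j. A j \<in> dstalk_le x k) \<longrightarrow>
        (\<exists>B. (\<forall>j. B j \<in> dstalk_le x (int m + k - 1)) \<and> (\<lambda>j. dmul P (A j)) - B \<in> N x))"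

definition characteristic_variety ::
    "(complex^2) set \<Rightarrow> (complex^2 \<Rightarrow> ('r::finite \<Rightarrow> dop) set) \<Rightarrow> (complex^4) set" where
  "characteristic_variety X N =
     {w\<in>cotangent X. \<forall>m P. annihilates_gr N (base w) m P \<longrightarrow> symbol m P w = 0}"

definition holonomic :: "(complex^2) set \<Rightarrow> (complex^2 \<Rightarrow> ('r::finite \<Rightarrow> dop) set) \<Rightarrow> bool" where
  "holonomic X N \<longleftrightarrow> coherent_quotient X N \<and> lagrangian X (characteristic_variety X N)"

section \<open>The cusp and the associated module\<close>

definition polydisc :: "real \<Rightarrow> real \<Rightarrow> (complex^2) set" where
  "polydisc r1 r2 = {x. cmod (x$1) < r1 \<and> cmod (x$2) < r2}"

definition Discr :: "complex^2 \<Rightarrow> complex" where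
  "Discr x = 4 * (x$1)^3 - 27 * (x$2)^2"

definition cusp :: "(complex^2) set" where
  "cusp = {x. Discr x = 0}"

definition branch :: "(complex^2) set \<Rightarrow> (complex^2 \<Rightarrow> complex) \<Rightarrow> bool" where
  "branch U z \<longleftrightarrow> holo U z \<and> (\<forall>x\<in>U. (z x)^3 = x$1 * z x + x$2)"

definition sym_P :: "3 \<Rightarrow> complex^4 \<Rightarrow> complex" where
  "sym_P k w =
     (if k = 1 then w$1 / 3 * (w$4)^2 - (w$3)^2
      else if k = 2 then w$2 / 2 * (w$4)^3 + (w$3)^3
      else (4 * (w$1)^3 - 27 * (w$2)^2) * (w$3)^2)"

definition deg_P :: "3 \<Rightarrow> nat" where
  "deg_P k = (if k = 1 then 2 else if k = 2 then 3 else 2)"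

text \<open>The operators are \<open>R k i j\<close>. The source of the morphism has rank 6, with basis indexed
  by the pairs \<open>(k, l)\<close>.\<close>

definition phi :: "(3 \<Rightarrow> 2 \<Rightarrow> 2 \<Rightarrow> dop) \<Rightarrow> (3 \<times> 2 \<Rightarrow> dop) \<Rightarrow> 2 \<Rightarrow> dop" where
  "phi R Q = (\<lambda>j. \<Sum>(k, l)\<in>UNIV. dmul (Q (k, l)) (R k l j))"

text \<open>The cokernel of \<open>phi R\<close>, given as above by the stalks of the image of \<open>phi R\<close>.\<close>

definition module_M :: "(3 \<Rightarrow> 2 \<Rightarrow> 2 \<Rightarrow> dop) \<Rightarrow> complex^2 \<Rightarrow> (2 \<Rightarrow> dop) set" where
  "module_M R x = {A. (\<forall>j. A j \<in> dstalk x) \<and>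
     (\<exists>Q. (\<forall>i. Q i \<in> dstalk x) \<and> (\<forall>j. germ_eq x (A j) (phi R Q j)))}"

end

theory Submission
  imports Defs "HOL-Complex_Analysis.Cauchy_Integral_Formula"
begin

text \<open>
  The characteristic variety is exactly \<open>V = P\<^sub>1\<^sup>-\<^sup>1(0) \<inter> P\<^sub>2\<^sup>-\<^sup>1(0) \<inter> P\<^sub>3\<^sup>-\<^sup>1(0)\<close>. It is contained in \<open>V\<close>
  because \<open>R k 1 1\<close> annihilates the graded module: the matrix \<open>R k\<close> is, up to lower order, scalar
  with symbol \<open>P\<^sub>k\<close>, and commutators lower the order.

  Conversely, an operator \<open>P\<close> of order \<open>m\<close> whose symbol annihilates the graded module satisfies
  \<open>P z = B\<^sub>1 z + B\<^sub>2 z\<^sup>2\<close> with \<open>B\<^sub>1\<close>, \<open>B\<^sub>2\<close> of order less than \<open>m\<close>, for every branch \<open>z\<close>. With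
  \<open>s = 3 z\<^sup>2 - p\<close>, an \<open>m\<close>-th derivative \<open>\<partial>\<^sub>p\<^sup>a \<partial>\<^sub>q\<^sup>b z\<close> has the leading term
  \<open>c\<^sub>m z\<^sup>a\<^sup>+\<^sup>m\<^sup>-\<^sup>1 / s\<^sup>2\<^sup>m\<^sup>-\<^sup>1\<close> along the cusp, where \<open>c\<^sub>m \<noteq> 0\<close>, while derivatives of \<open>z\<close> and \<open>z\<^sup>2\<close> of lower
  order have poles of lower order; so the symbol of \<open>P\<close> vanishes at \<open>(z, 1)\<close>, which spans the conormal
  direction. For \<open>m = 0\<close> the relation says that \<open>P\<close> vanishes off the cusp. So the zero section and the
  conormal of the cusp are both contained in the characteristic variety, and neither involutivity of
  characteristic varieties nor coherence of the graded module is needed.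

  The Lagrangian property is then checked on \<open>V\<close>, where the implicit function theorem is replaced by
  Brouwer's fixed point theorem. Branches on simply connected open sets are lifts to the threefold
  covering given by the roots of the cubic.
\<close>

section \<open>Holomorphic functions of several variables\<close>

text \<open>The condition \<open>lagrangian\<close> asks every tangent space to equal its own
  symplectic orthogonal, so an inclusion of the characteristic variety in V cannot suffice: a single
  point, for instance, would violate it. Hence the equality is proved, and the real work is the
  lower bound, where the symbols of unknown annihilating operators must be shown to vanish. The pole
  count succeeds by a gap of one: m-th derivatives of z reach order 2m-1 in s, while those of order
  at most m-1 stay within 2m-2. Since p = 3 z^2 - s and q = s z - 2 z^3, fixing z and letting s tend
  to 0 means approaching the cusp along one of its tangent lines, on which z stays a root.
  Multiplication by s^(2m-1) then isolates the symbol at (z, 1), up to a factor z^(m-1), which is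
  why the origin has to be reached by continuity. Since \<open>holo\<close> only asks for a complex
  linear differential at every point, \<open>mdiff\<close> becomes usable only after Cauchy's
  formula has shown that partial derivatives are again holomorphic and commute.\<close>

lemma bounded_linear_vsmult_left: "bounded_linear (\<lambda>t::complex. t *s (v :: complex^'n))"
  by (rule linear_conv_bounded_linear[THEN iffD1], rule linearI)
     (simp_all add: vec_eq_iff algebra_simps)

lemma holoI:
  assumes "\<And>x. x \<in> U \<Longrightarrow> (f has_derivative L x) (at x)"
    and "\<And>x c v. x \<in> U \<Longrightarrow> L x (c *s v) = c * L x v"
  shows "holo U f"
  using assms unfolding holo_def by blast

lemma line_has_field_derivative:
  fixes f :: "complex^'n \<Rightarrow> complex"
  assumes f: "(f has_derivative L) (at (x + t *s v))" and L: "\<And>c v. L (c *s v) = c * L v"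
  shows "((\<lambda>t. f (x + t *s v)) has_field_derivative L v) (at t)"
proof -
  have "((\<lambda>t::complex. x + t *s v) has_derivative (\<lambda>t. t *s v)) (at t)"
    by (auto intro!: derivative_eq_intros bounded_linear.has_derivative[OF bounded_linear_vsmult_left])
  from has_derivative_compose[OF this f]
  show ?thesis
    by (simp add: L has_field_derivative_def mult.commute[of _ "L _"])
qed

lemma pdiff_eqI:
  fixes f :: "complex^'n \<Rightarrow> complex"
  assumes "(f has_derivative L) (at x)" and "\<And>c v. L (c *s v) = c * L v"
  shows "pdiff i f x = L (axis i 1)"
  unfolding pdiff_def
  by (rule DERIV_imp_deriv, rule line_has_field_derivative) (use assms in simp_all)

lemma clinear_sum_axis:
  fixes L :: "complex^'n \<Rightarrow> complex"
  assumes "linear L" and L: "\<And>c v. L (c *s v) = c * L v"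
  shows "L v = (\<Sum>i\<in>UNIV. L (axis i 1) * v $ i)"
proof -
  have "L v = L (\<Sum>i\<in>UNIV. v $ i *s axis i 1)"
    by (simp add: basis_expansion)
  also have "\<dots> = (\<Sum>i\<in>UNIV. L (v $ i *s axis i 1))"
    using assms(1) by (rule linear_sum)
  finally show ?thesis by (simp add: L mult.commute)
qed

text \<open>Names the differential: whatever \<open>L\<close> the definition of \<open>holo\<close>
  provides, its coefficients are the partial derivatives. The closure rules below use this
  form.\<close>

lemma holo_has_derivative:
  fixes f :: "complex^'n \<Rightarrow> complex"
  assumes "holo U f" "x \<in> U"
  shows "(f has_derivative (\<lambda>v. \<Sum>i\<in>UNIV. pdiff i f x * v $ i)) (at x)"
proof -
  obtain L where L: "(f has_derivative L) (at x)" "\<And>c v. L (c *s v) = c * L v"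
    using assms unfolding holo_def by blast
  have "L = (\<lambda>v. \<Sum>i\<in>UNIV. pdiff i f x * v $ i)"
    unfolding pdiff_eqI[OF L]
    using clinear_sum_axis[OF has_derivative_linear[OF L(1)] L(2)] by blast
  with L(1) show ?thesis by simp
qed

lemma clinear_sum_vec_nth:
  "(\<Sum>i\<in>UNIV. a i * (c *s v) $ i) = c * (\<Sum>i\<in>UNIV. a i * v $ i :: complex)"
  by (simp add: sum_distrib_left algebra_simps)

lemma sum_mult_axis: "(\<Sum>i\<in>UNIV. a i * axis j 1 $ i) = (a j :: complex)"
  by (simp add: axis_def if_distrib cong: if_cong)

lemma holo_subset: "holo U f \<Longrightarrow> V \<subseteq> U \<Longrightarrow> holo V f"
  unfolding holo_def by blast

text \<open>Meant for \<open>dapply\<close> and \<open>dmul\<close>, which sum over index sets that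
  vary with the point and agree with a fixed finite sum only near each point.\<close>

lemma holo_locally:
  assumes "\<And>x. x \<in> U \<Longrightarrow> \<exists>V. open V \<and> x \<in> V \<and> (\<exists>g. holo V g \<and> (\<forall>y\<in>V. f y = g y))"
  shows "holo U f"
  unfolding holo_def
proof
  fix x assume "x \<in> U"
  then obtain V g where V: "open V" "x \<in> V" "holo V g" "\<And>y. y \<in> V \<Longrightarrow> f y = g y"
    using assms by meson
  then obtain L where L: "(g has_derivative L) (at x)" "\<And>c v. L (c *s v) = c * L v"
    unfolding holo_def by blast
  have "(f has_derivative L) (at x)"
    by (rule has_derivative_transform_within_open[OF L(1) V(1,2)]) (simp add: V(4))
  then show "\<exists>L. (f has_derivative L) (at x) \<and> (\<forall>c v. L (c *s v) = c * L v)"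
    using L(2) by blast
qed

lemma holo_cong: "open U \<Longrightarrow> (\<And>x. x \<in> U \<Longrightarrow> f x = g x) \<Longrightarrow> holo U g \<Longrightarrow> holo U f"
  by (rule holo_locally) blast

lemma holo_imp_continuous_on: "holo U f \<Longrightarrow> continuous_on U f"
  unfolding holo_def
  by (meson continuous_at_imp_continuous_on has_derivative_continuous)

lemma holo_const [intro, simp]: "holo U (\<lambda>x. c)"
  by (rule holoI[where L = "\<lambda>_ _. 0"]) auto

lemma holo_nth [intro, simp]: "holo U (\<lambda>x. x $ i)"
  by (rule holoI[where L = "\<lambda>_ v. v $ i"])
     (auto intro!: bounded_linear.has_derivative[OF bounded_linear_vec_nth])

lemma holo_add [intro]: "holo U f \<Longrightarrow> holo U g \<Longrightarrow> holo U (\<lambda>x. f x + g x)"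
  by (rule holoI[where L = "\<lambda>x v. (\<Sum>i\<in>UNIV. pdiff i f x * v $ i) + (\<Sum>i\<in>UNIV. pdiff i g x * v $ i)"])
     (rule has_derivative_add[OF holo_has_derivative holo_has_derivative], assumption+,
      simp del: vector_smult_component add: clinear_sum_vec_nth ring_distribs)

lemma holo_mult [intro]: "holo U f \<Longrightarrow> holo U g \<Longrightarrow> holo U (\<lambda>x. f x * g x)"
  by (rule holoI[where L = "\<lambda>x v. f x * (\<Sum>i\<in>UNIV. pdiff i g x * v $ i) + (\<Sum>i\<in>UNIV. pdiff i f x * v $ i) * g x"])
     (rule has_derivative_mult[OF holo_has_derivative holo_has_derivative], assumption+,
      simp del: vector_smult_component add: clinear_sum_vec_nth algebra_simps)

lemma holo_minus [intro]: "holo U f \<Longrightarrow> holo U (\<lambda>x. - f x)"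
  using holo_mult[OF holo_const[of U "-1"], of f] by simp

lemma holo_diff [intro]: "holo U f \<Longrightarrow> holo U g \<Longrightarrow> holo U (\<lambda>x. f x - g x)"
  using holo_add[OF _ holo_minus, of U f g] by simp

lemma holo_power [intro]: "holo U f \<Longrightarrow> holo U (\<lambda>x. f x ^ n)"
  by (induction n) auto

lemma holo_sum [intro]: "(\<And>i. i \<in> I \<Longrightarrow> holo U (f i)) \<Longrightarrow> holo U (\<lambda>x. \<Sum>i\<in>I. f i x)"
  by (induction I rule: infinite_finite_induct) auto

section \<open>Partial derivatives and Cauchy's formula\<close>

lemma pdiff_cong:
  assumes "open U" "x \<in> U" "\<And>y. y \<in> U \<Longrightarrow> f y = g y"
  shows "pdiff i f x = pdiff i g x"
proof -
  have "continuous_on UNIV (\<lambda>t::complex. x + t *s axis i 1)"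
    by (intro continuous_intros bounded_linear.continuous_on[OF bounded_linear_vsmult_left])
  then have "open ((\<lambda>t::complex. x + t *s axis i 1) -` U)"
    using assms(1) by (intro open_vimage) auto
  then have "eventually (\<lambda>t. t \<in> (\<lambda>t::complex. x + t *s axis i 1) -` U) (nhds 0)"
    using assms(2) by (intro eventually_nhds_in_open) auto
  then have "eventually (\<lambda>t. f (x + t *s axis i 1) = g (x + t *s axis i 1)) (nhds 0)"
    by eventually_elim (use assms(3) in auto)
  then show ?thesis
    unfolding pdiff_def by (rule deriv_cong_ev) simp
qed

lemma pdiff_const [simp]: "pdiff i (\<lambda>x. c) = (\<lambda>x. 0)"
  by (simp add: pdiff_def fun_eq_iff)

lemma pdiff_add:
  assumes "holo U f" "holo U g" "x \<in> U"
  shows "pdiff i (\<lambda>x. f x + g x) x = pdiff i f x + pdiff i g x"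
  by (subst pdiff_eqI[OF has_derivative_add[OF holo_has_derivative[OF assms(1,3)] holo_has_derivative[OF assms(2,3)]]])
     (simp_all add: clinear_sum_vec_nth sum_mult_axis ring_distribs mult_ac del: vector_smult_component)

lemma pdiff_mult:
  assumes "holo U f" "holo U g" "x \<in> U"
  shows "pdiff i (\<lambda>x. f x * g x) x = pdiff i f x * g x + f x * pdiff i g x"
  by (subst pdiff_eqI[OF has_derivative_mult[OF holo_has_derivative[OF assms(1,3)] holo_has_derivative[OF assms(2,3)]]])
     (simp_all add: clinear_sum_vec_nth sum_mult_axis ring_distribs mult_ac del: vector_smult_component)

lemma pdiff_sum:
  assumes "\<And>j. j \<in> I \<Longrightarrow> holo U (f j)" "x \<in> U"
  shows "pdiff i (\<lambda>x. \<Sum>j\<in>I. f j x) x = (\<Sum>j\<in>I. pdiff i (f j) x)"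
  using assms(1)
proof (induction I rule: infinite_finite_induct)
  case (insert j F)
  then show ?case
    using pdiff_add[of U "f j" "\<lambda>x. \<Sum>j\<in>F. f j x" x i] assms(2) by (simp add: holo_sum)
qed simp_all

text \<open>The contour is a circle of fixed radius around the origin of the \<open>i\<close>-th coordinate line, so
  that the right-hand side can be differentiated in \<open>x\<close> under the integral.\<close>

lemma pdiff_integral:
  fixes f :: "complex^'n \<Rightarrow> complex"
  assumes "open U" "holo U f" "r > 0" "\<And>t. cmod t \<le> r \<Longrightarrow> x + t *s axis i 1 \<in> U"
  shows "((\<lambda>\<theta>. f (x + rcis r \<theta> *s axis i 1) / rcis r \<theta>)
           has_integral (2 * of_real pi * pdiff i f x)) {0..2*pi}"
proof -
  define g where "g = (\<lambda>t::complex. f (x + t *s axis i 1))"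
  have "(g has_field_derivative (\<Sum>j\<in>UNIV. pdiff j f (x + t *s axis i 1) * axis i 1 $ j)) (at t)"
    if "cmod t \<le> r" for t
    unfolding g_def
    by (rule line_has_field_derivative[OF holo_has_derivative[OF assms(2) assms(4)[OF that]]])
       (rule clinear_sum_vec_nth)
  then have "g field_differentiable (at t)" if "cmod t \<le> r" for t
    using that field_differentiable_def by blast
  then have hol: "g holomorphic_on cball 0 r"
    by (auto simp: holomorphic_on_def intro: field_differentiable_at_within)
  have "((\<lambda>u. g u / (u - 0) ^ Suc 1) has_contour_integral (2 * pi * \<i> / fact 1 * (deriv ^^ 1) g 0)) (circlepath 0 r)"
    using \<open>r > 0\<close> hol
    by (intro Cauchy_has_contour_integral_higher_derivative_circlepath)
       (auto intro: holomorphic_on_imp_continuous_on holomorphic_on_subset[OF hol])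
  then have "((\<lambda>u. g u / u ^ 2) has_contour_integral (2 * pi * \<i> * pdiff i f x)) (part_circlepath 0 r 0 (2*pi))"
    by (simp add: pdiff_def g_def circlepath_def eval_nat_numeral)
  then have "((\<lambda>t. g (rcis r t) / (rcis r t)^2 * (\<i> * of_real r * cis t)) has_integral (2 * pi * \<i> * pdiff i f x)) {0..2*pi}"
    by (subst (asm) has_contour_integral_part_circlepath_iff) (auto simp: rcis_def cis_conv_exp algebra_simps)
  then have "((\<lambda>t. (-\<i>) * (g (rcis r t) / (rcis r t)^2 * (\<i> * of_real r * cis t)))
      has_integral ((-\<i>) * (2 * pi * \<i> * pdiff i f x))) {0..2*pi}"
    by (rule has_integral_mult_right)
  moreover have "(-\<i>) * (g (rcis r t) / (rcis r t)^2 * (\<i> * of_real r * cis t)) = g (rcis r t) / rcis r t" for t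
    using \<open>r > 0\<close> by (simp add: rcis_def power2_eq_square field_simps)
  moreover have "(-\<i>) * (2 * pi * \<i> * pdiff i f x) = 2 * of_real pi * pdiff i f x"
    by simp
  ultimately show ?thesis
    by (simp only: g_def)
qed

lemma continuous_on_circle_shift:
  fixes g :: "complex^'n \<Rightarrow> complex"
  assumes "continuous_on U g" "r > 0" "\<And>x t. x \<in> B \<Longrightarrow> cmod t \<le> r \<Longrightarrow> x + t *s axis i 1 \<in> U"
  shows "continuous_on (B \<times> A) (\<lambda>(x, \<theta>). g (x + rcis r \<theta> *s axis i 1) / rcis r \<theta>)"
proof -
  have r: "continuous_on (B \<times> A) (\<lambda>x. rcis r (snd x))"
    by (auto simp: rcis_def intro!: continuous_intros)
  then have s: "continuous_on (B \<times> A) (\<lambda>x. fst x + rcis r (snd x) *s axis i 1)"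
    by (intro continuous_intros bounded_linear.continuous_on[OF bounded_linear_vsmult_left])
  show ?thesis
    unfolding split_beta
    using assms by (intro continuous_on_divide continuous_on_compose2[OF assms(1) s] r) auto
qed

lemma norm_vsmult_axis: "norm (t *s axis i 1 :: complex^'n) = cmod t"
proof -
  have "t *s axis i 1 = (axis i t :: complex^'n)"
    by (simp add: vec_eq_iff axis_def)
  moreover have "(cmod ((axis i t :: complex^'n) $ j))\<^sup>2 = (if j = i then (cmod t)\<^sup>2 else 0)" for j
    by (simp add: axis_def)
  ultimately show ?thesis by (simp add: norm_vec_def L2_set_def)
qed

lemma ball_shift_mem:
  fixes x :: "complex^'n"
  assumes "cball x0 (2 * e) \<subseteq> U" "x \<in> ball x0 e" "cmod t \<le> e"
  shows "x + t *s axis i 1 \<in> U"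
proof -
  have "dist x0 (x + t *s axis i 1) \<le> dist x0 x + dist x (x + t *s axis i 1)"
    by (rule dist_triangle)
  also have "dist x (x + t *s axis i 1) = cmod t"
    by (simp add: dist_norm norm_vsmult_axis)
  finally have "x + t *s axis i 1 \<in> cball x0 (2 * e)"
    using assms(2,3) by simp
  then show ?thesis using assms(1) by blast
qed

text \<open>The factor 2 leaves room for the base point to move in \<open>ball x0 e\<close> while
  the contour of radius \<open>e\<close> around it stays in \<open>U\<close>.\<close>

lemma ex_double_cball:
  fixes x0 :: "complex^'n"
  assumes "open U" "x0 \<in> U"
  obtains e where "e > 0" "cball x0 (2 * e) \<subseteq> U"
proof -
  obtain d where "d > 0" "cball x0 d \<subseteq> U"
    using assms open_contains_cball by blast
  then show ?thesis using that[of "d / 2"] by simp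
qed

lemma pdiff_eq_integral:
  fixes f :: "complex^'n \<Rightarrow> complex"
  assumes "open U" "holo U f" "e > 0" "cball x0 (2 * e) \<subseteq> U" "x \<in> ball x0 e"
  shows "pdiff i f x = integral (cbox 0 (2*pi)) (\<lambda>\<theta>. f (x + rcis e \<theta> *s axis i 1) / rcis e \<theta>) / (2 * of_real pi)"
  using integral_unique[OF pdiff_integral[OF assms(1-3) ball_shift_mem[OF assms(4,5)]], of i] by simp

text \<open>Cauchy's formula expresses the derivative through values of \<open>f\<close>, which is
  continuous. The result feeds the Leibniz rule for integrals below, which wants a continuous
  derivative of the integrand.\<close>

lemma continuous_on_pdiff:
  fixes f :: "complex^'n \<Rightarrow> complex"
  assumes "open U" "holo U f"
  shows "continuous_on U (pdiff i f)"
proof -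
  have "continuous (at x0) (pdiff i f)" if x0: "x0 \<in> U" for x0
  proof -
    obtain e where e: "e > 0" "cball x0 (2 * e) \<subseteq> U"
      using ex_double_cball[OF assms(1) x0] by blast
    have "continuous_on (ball x0 e) (\<lambda>x. integral (cbox 0 (2*pi)) (\<lambda>\<theta>. f (x + rcis e \<theta> *s axis i 1) / rcis e \<theta>) / (2 * of_real pi))"
      by (intro continuous_intros integral_continuous_on_param
           continuous_on_circle_shift[OF holo_imp_continuous_on[OF assms(2)] e(1)] ball_shift_mem[OF e(2)]) auto
    then have "continuous_on (ball x0 e) (pdiff i f)"
      by (rule continuous_on_eq) (simp add: pdiff_eq_integral[OF assms e])
    then show ?thesis
      using e(1) by (simp add: continuous_on_eq_continuous_at)
  qed
  then show ?thesis by (simp add: continuous_at_imp_continuous_on)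
qed

text \<open>Cauchy's formula differentiated under the integral sign. The derivative is left in
  integral form, because both its complex linearity and the symmetry of second derivatives can be
  read off from it.\<close>

lemma pdiff_has_derivative_integral:
  fixes f :: "complex^'n \<Rightarrow> complex"
  assumes "open U" "holo U f" "e > 0" "cball x0 (2 * e) \<subseteq> U"
  shows "(pdiff i f has_derivative (\<lambda>v. \<Sum>j\<in>UNIV.
            integral (cbox 0 (2*pi)) (\<lambda>\<theta>. pdiff j f (x0 + rcis e \<theta> *s axis i 1) / rcis e \<theta>) / (2 * of_real pi) * v $ j)) (at x0)"
proof -
  \<comment> \<open>\<open>leibniz_rule\<close> takes the derivative as a bounded linear function;
    \<open>B j a\<close> is the map v \<mapsto> a * v $ j in that type.\<close>
  define B where "B = (\<lambda>j (a::complex). blinfun_mult_right a o\<^sub>L Blinfun (\<lambda>v::complex^'n. v $ j))"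
  have B: "blinfun_apply (B j a) v = a * v $ j" for j a v
    by (simp add: B_def bounded_linear_Blinfun_apply bounded_linear_vec_nth)
  have cB: "continuous_on S (\<lambda>x. B j (g x))" if "continuous_on S g" for S j and g :: "'b::topological_space \<Rightarrow> complex"
    unfolding B_def
    by (intro continuous_intros bounded_linear.continuous_on[OF bounded_linear_blinfun_mult_right] that)
  define F where "F = (\<lambda>x \<theta>. f (x + rcis e \<theta> *s axis i 1) / rcis e \<theta>)"
  define F' where "F' = (\<lambda>x \<theta>. \<Sum>j\<in>UNIV. B j (pdiff j f (x + rcis e \<theta> *s axis i 1) / rcis e \<theta>))"
  note mem = ball_shift_mem[OF assms(4)]
  have contF: "continuous_on (ball x0 e \<times> A) (\<lambda>(x, \<theta>). g (x + rcis e \<theta> *s axis i 1) / rcis e \<theta>)"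
    if "continuous_on U g" for A g
    by (rule continuous_on_circle_shift[OF that assms(3) mem])
  have cont1: "continuous_on A (\<lambda>\<theta>. g (x + rcis e \<theta> *s axis i 1) / rcis e \<theta>)"
    if "continuous_on U g" "x \<in> ball x0 e" for A g x
    using continuous_on_compose2[OF contF[OF that(1), of A], where f = "\<lambda>\<theta>. (x, \<theta>)" and s = A] that(2)
    by (force intro: continuous_intros)
  have cd: "continuous_on U (pdiff j f)" for j
    by (rule continuous_on_pdiff[OF assms(1,2)])
  have x0: "x0 \<in> ball x0 e" using assms(3) by simp
  have "((\<lambda>x. integral (cbox 0 (2*pi)) (F x)) has_derivative
      blinfun_apply (integral (cbox 0 (2*pi)) (F' x0))) (at x0 within ball x0 e)"
  proof (rule leibniz_rule)
    fix x \<theta> assume x: "x \<in> ball x0 e"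
    have "((\<lambda>x. f (x + rcis e \<theta> *s axis i 1)) has_derivative (\<lambda>v. \<Sum>j\<in>UNIV. pdiff j f (x + rcis e \<theta> *s axis i 1) * v $ j)) (at x)"
    proof (rule has_derivative_compose[where f = "\<lambda>x. x + rcis e \<theta> *s axis i 1" and f' = "\<lambda>v. v", simplified])
      show "((\<lambda>x. x + rcis e \<theta> *s axis i 1) has_derivative (\<lambda>v. v)) (at x)"
        by (auto intro!: derivative_eq_intros)
      show "(f has_derivative (\<lambda>v. \<Sum>j\<in>UNIV. pdiff j f (x + rcis e \<theta> *s axis i 1) * v $ j)) (at (x + rcis e \<theta> *s axis i 1))"
        using assms(3) by (intro holo_has_derivative[OF assms(2)] mem[OF x]) simp
    qed
    from \<open>((\<lambda>x. f (x + rcis e \<theta> *s axis i 1)) has_derivative _) (at x)\<close>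
    have "((\<lambda>x. f (x + rcis e \<theta> *s axis i 1) * (1 / rcis e \<theta>)) has_derivative
       (\<lambda>v. (\<Sum>j\<in>UNIV. pdiff j f (x + rcis e \<theta> *s axis i 1) * v $ j) * (1 / rcis e \<theta>))) (at x)"
      by (rule has_derivative_mult_left)
    moreover have "(\<lambda>v. (\<Sum>j\<in>UNIV. pdiff j f (x + rcis e \<theta> *s axis i 1) * v $ j) * (1 / rcis e \<theta>)) = blinfun_apply (F' x \<theta>)"
      by (simp add: fun_eq_iff F'_def blinfun.sum_left B sum_divide_distrib)
    ultimately show "((\<lambda>x. F x \<theta>) has_derivative blinfun_apply (F' x \<theta>)) (at x within ball x0 e)"
      by (simp add: F_def has_derivative_at_withinI)
  next
    fix x assume "x \<in> ball x0 e"
    then show "F x integrable_on cbox 0 (2*pi)"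
      unfolding F_def by (intro integrable_continuous cont1 holo_imp_continuous_on[OF assms(2)])
  next
    show "continuous_on (ball x0 e \<times> cbox 0 (2 * pi)) (\<lambda>(x, t). F' x t)"
      unfolding F'_def split_beta
      by (intro continuous_on_sum cB contF[OF cd, unfolded split_beta])
  qed (use x0 in auto)
  moreover have "blinfun_apply (integral (cbox 0 (2*pi)) (F' x0)) = (\<lambda>v. \<Sum>j\<in>UNIV.
            integral (cbox 0 (2*pi)) (\<lambda>\<theta>. pdiff j f (x0 + rcis e \<theta> *s axis i 1) / rcis e \<theta>) * v $ j)"
  proof
    fix v
    have c: "continuous_on (cbox 0 (2*pi)) (F' x0)"
      unfolding F'_def by (intro continuous_intros cB cont1[OF cd x0])
    have "blinfun_apply (integral (cbox 0 (2*pi)) (F' x0)) v = integral (cbox 0 (2*pi)) (\<lambda>\<theta>. blinfun_apply (F' x0 \<theta>) v)"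
      by (rule blinfun_apply_integral) (rule integrable_continuous[OF c])
    also have "\<dots> = integral (cbox 0 (2*pi)) (\<lambda>\<theta>. \<Sum>j\<in>UNIV. (pdiff j f (x0 + rcis e \<theta> *s axis i 1) / rcis e \<theta>) * v $ j)"
      by (simp add: F'_def blinfun.sum_left B)
    also have "\<dots> = (\<Sum>j\<in>UNIV. integral (cbox 0 (2*pi)) (\<lambda>\<theta>. (pdiff j f (x0 + rcis e \<theta> *s axis i 1) / rcis e \<theta>) * v $ j))"
      by (intro integral_sum integrable_continuous continuous_intros cont1[OF cd x0]) auto
    also have "\<dots> = (\<Sum>j\<in>UNIV. integral (cbox 0 (2*pi)) (\<lambda>\<theta>. pdiff j f (x0 + rcis e \<theta> *s axis i 1) / rcis e \<theta>) * v $ j)"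
      by (subst integral_mult_left) (auto intro!: integrable_continuous cont1[OF cd x0])
    finally show "blinfun_apply (integral (cbox 0 (2*pi)) (F' x0)) v = (\<Sum>j\<in>UNIV.
            integral (cbox 0 (2*pi)) (\<lambda>\<theta>. pdiff j f (x0 + rcis e \<theta> *s axis i 1) / rcis e \<theta>) * v $ j)" .
  qed
  ultimately have "((\<lambda>x. integral (cbox 0 (2*pi)) (F x)) has_derivative (\<lambda>v. \<Sum>j\<in>UNIV.
            integral (cbox 0 (2*pi)) (\<lambda>\<theta>. pdiff j f (x0 + rcis e \<theta> *s axis i 1) / rcis e \<theta>) * v $ j)) (at x0)"
    by (simp only: at_within_open[OF x0 open_ball])
  then have "((\<lambda>x. integral (cbox 0 (2*pi)) (F x) * (1 / (2 * of_real pi))) has_derivative (\<lambda>v. (\<Sum>j\<in>UNIV.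
            integral (cbox 0 (2*pi)) (\<lambda>\<theta>. pdiff j f (x0 + rcis e \<theta> *s axis i 1) / rcis e \<theta>) * v $ j) * (1 / (2 * of_real pi)))) (at x0)"
    by (rule has_derivative_mult_left)
  then have "((\<lambda>x. integral (cbox 0 (2*pi)) (F x) / (2 * of_real pi)) has_derivative (\<lambda>v. \<Sum>j\<in>UNIV.
            integral (cbox 0 (2*pi)) (\<lambda>\<theta>. pdiff j f (x0 + rcis e \<theta> *s axis i 1) / rcis e \<theta>) / (2 * of_real pi) * v $ j)) (at x0)"
    by (simp add: sum_divide_distrib)
  then show ?thesis
    by (rule has_derivative_transform_within_open[of _ _ _ UNIV "ball x0 e"])
       (use x0 in \<open>auto simp: F_def pdiff_eq_integral[OF assms]\<close>)
qed

lemma holo_pdiff: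
  fixes f :: "complex^'n \<Rightarrow> complex"
  assumes "open U" "holo U f"
  shows "holo U (pdiff i f)"
  unfolding holo_def
proof
  fix x assume "x \<in> U"
  then obtain e where e: "e > 0" "cball x (2 * e) \<subseteq> U"
    using ex_double_cball[OF assms(1)] by blast
  show "\<exists>L. (pdiff i f has_derivative L) (at x) \<and> (\<forall>c v. L (c *s v) = c * L v)"
    by (rule exI, rule conjI, rule pdiff_has_derivative_integral[OF assms e])
       (simp only: clinear_sum_vec_nth simp_thms)
qed

text \<open>Both sides are the same integral: the derivative in direction \<open>i\<close> of the
  Cauchy integral in direction \<open>j\<close>, and the Cauchy integral in direction
  \<open>j\<close> of \<open>pdiff i f\<close>.\<close>

lemma pdiff_commute:
  fixes f :: "complex^'n \<Rightarrow> complex"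
  assumes "open U" "holo U f" "x \<in> U"
  shows "pdiff i (pdiff j f) x = pdiff j (pdiff i f) x"
proof -
  obtain e where e: "e > 0" "cball x (2 * e) \<subseteq> U"
    using ex_double_cball[OF assms(1,3)] by blast
  have "pdiff i (pdiff j f) x = integral (cbox 0 (2*pi)) (\<lambda>\<theta>. pdiff i f (x + rcis e \<theta> *s axis j 1) / rcis e \<theta>) / (2 * of_real pi)"
    by (subst pdiff_eqI[OF pdiff_has_derivative_integral[OF assms(1,2) e]])
       (simp_all only: clinear_sum_vec_nth sum_mult_axis)
  also have "\<dots> = pdiff j (pdiff i f) x"
    using e(1) by (intro pdiff_eq_integral[OF assms(1) holo_pdiff[OF assms(1,2)] e, symmetric]) simp
  finally show ?thesis .
qed

section \<open>Higher derivatives and the product rule\<close>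

lemma holo_funpow_pdiff: "open U \<Longrightarrow> holo U f \<Longrightarrow> holo U ((pdiff i ^^ n) f)"
  by (induction n) (auto intro: holo_pdiff)

lemma funpow_pdiff_cong:
  assumes "open U" "\<And>y. y \<in> U \<Longrightarrow> f y = g y" "x \<in> U"
  shows "(pdiff i ^^ n) f x = (pdiff i ^^ n) g x"
  using assms(3)
proof (induction n arbitrary: x)
  case (Suc n)
  then show ?case
    using pdiff_cong[OF assms(1) Suc.prems Suc.IH] by simp
qed (use assms in simp)

lemma funpow_pdiff_sum:
  assumes "open U" "\<And>j. j \<in> I \<Longrightarrow> holo U (f j)" "x \<in> U"
  shows "(pdiff i ^^ n) (\<lambda>x. \<Sum>j\<in>I. c j * f j x) x = (\<Sum>j\<in>I. c j * (pdiff i ^^ n) (f j) x)"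
  using assms(3)
proof (induction n arbitrary: x)
  case (Suc n)
  have h: "holo U ((pdiff i ^^ n) (f j))" if "j \<in> I" for j
    using assms(1,2) that by (intro holo_funpow_pdiff)
  have "(pdiff i ^^ Suc n) (\<lambda>x. \<Sum>j\<in>I. c j * f j x) x
      = pdiff i (\<lambda>x. \<Sum>j\<in>I. c j * (pdiff i ^^ n) (f j) x) x"
    using pdiff_cong[OF assms(1) Suc.prems Suc.IH] by simp
  also have "\<dots> = (\<Sum>j\<in>I. pdiff i (\<lambda>x. c j * (pdiff i ^^ n) (f j) x) x)"
    by (rule pdiff_sum[where U = U]) (auto intro: h Suc.prems)
  also have "\<dots> = (\<Sum>j\<in>I. c j * (pdiff i ^^ Suc n) (f j) x)"
    by (intro sum.cong refl, subst pdiff_mult[where U = U]) (auto intro: h Suc.prems)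
  finally show ?case .
qed simp

lemma funpow_pdiff_mult:
  assumes "open U" "holo U f" "holo U g" "x \<in> U"
  shows "(pdiff i ^^ n) (\<lambda>x. f x * g x) x =
    (\<Sum>k\<le>n. of_nat (n choose k) * ((pdiff i ^^ (n - k)) f x * (pdiff i ^^ k) g x))"
  using assms(4)
proof (induction n arbitrary: x)
  case (Suc n)
  define F where "F = (\<lambda>k. (pdiff i ^^ k) f x)"
  define G where "G = (\<lambda>k. (pdiff i ^^ k) g x)"
  have h: "holo U ((pdiff i ^^ k) f)" "holo U ((pdiff i ^^ k) g)" for k
    using assms(1-3) by (auto intro: holo_funpow_pdiff)
  have "(pdiff i ^^ Suc n) (\<lambda>x. f x * g x) x
      = pdiff i (\<lambda>x. \<Sum>k\<le>n. of_nat (n choose k) * ((pdiff i ^^ (n - k)) f x * (pdiff i ^^ k) g x)) x"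
    using pdiff_cong[OF assms(1) Suc.prems Suc.IH] by simp
  also have "\<dots> = (\<Sum>k\<le>n. of_nat (n choose k) * pdiff i (\<lambda>x. (pdiff i ^^ (n - k)) f x * (pdiff i ^^ k) g x) x)"
    by (rule funpow_pdiff_sum[OF assms(1) holo_mult[OF h] Suc.prems, where n = 1, simplified])
  also have "\<dots> = (\<Sum>k\<le>n. of_nat (n choose k) * (F (Suc n - k) * G k + F (n - k) * G (Suc k)))"
    by (intro sum.cong refl) (simp add: pdiff_mult[OF h Suc.prems] F_def G_def Suc_diff_le)
  also have "\<dots> = (\<Sum>k\<le>n. of_nat (n choose k) * (F (Suc n - k) * G k)) + (\<Sum>k\<le>n. of_nat (n choose k) * (F (n - k) * G (Suc k)))"
    by (simp add: ring_distribs sum.distrib)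
  \<comment> \<open>The added summand \<open>k = Suc n\<close> is 0 because
    \<open>n choose Suc n = 0\<close>; with it the sum can be shifted and Pascal's rule
    applied.\<close>
  also have "(\<Sum>k\<le>n. of_nat (n choose k) * (F (Suc n - k) * G k)) = (\<Sum>k\<le>Suc n. of_nat (n choose k) * (F (Suc n - k) * G k))"
    by simp
  also have "\<dots> = F (Suc n) * G 0 + (\<Sum>k\<le>n. of_nat (n choose Suc k) * (F (n - k) * G (Suc k)))"
    by (subst sum.atMost_Suc_shift) simp
  also have "F (Suc n) * G 0 + (\<Sum>k\<le>n. of_nat (n choose Suc k) * (F (n - k) * G (Suc k))) + (\<Sum>k\<le>n. of_nat (n choose k) * (F (n - k) * G (Suc k)))
      = (\<Sum>k\<le>Suc n. of_nat (Suc n choose k) * (F (Suc n - k) * G k))"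
    unfolding sum.atMost_Suc_shift by (simp add: ring_distribs sum.distrib)
  finally show ?case unfolding F_def G_def .
qed simp

lemma mdiff_simps [simp]:
  "mdiff (0, 0) f = f" "mdiff (Suc a, b) f = pdiff 1 (mdiff (a, b) f)"
  "mdiff (0, Suc b) f = pdiff 2 (mdiff (0, b) f)"
  by (simp_all add: mdiff_def)

lemma mdiff_zero_fun [simp]: "mdiff \<alpha> (\<lambda>x. 0) = (\<lambda>x. 0)"
proof -
  have "(pdiff i ^^ n) (\<lambda>x. 0) = (\<lambda>x. 0)" for i :: 2 and n
    by (induction n) auto
  then show ?thesis by (simp add: mdiff_def)
qed

lemma holo_mdiff: "open U \<Longrightarrow> holo U f \<Longrightarrow> holo U (mdiff \<alpha> f)"
  unfolding mdiff_def by (intro holo_funpow_pdiff)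

lemma mdiff_cong:
  assumes "open U" "\<And>y. y \<in> U \<Longrightarrow> f y = g y" "x \<in> U"
  shows "mdiff \<alpha> f x = mdiff \<alpha> g x"
  unfolding mdiff_def
  by (rule funpow_pdiff_cong[OF assms(1) _ assms(3)], rule funpow_pdiff_cong[OF assms(1,2)])

lemma mdiff_sum:
  assumes "open U" "\<And>j. j \<in> I \<Longrightarrow> holo U (f j)" "x \<in> U"
  shows "mdiff \<alpha> (\<lambda>x. \<Sum>j\<in>I. c j * f j x) x = (\<Sum>j\<in>I. c j * mdiff \<alpha> (f j) x)"
proof -
  have "mdiff \<alpha> (\<lambda>x. \<Sum>j\<in>I. c j * f j x) x
      = (pdiff 1 ^^ fst \<alpha>) (\<lambda>x. \<Sum>j\<in>I. c j * (pdiff 2 ^^ snd \<alpha>) (f j) x) x"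
    unfolding mdiff_def
    by (rule funpow_pdiff_cong[OF assms(1) _ assms(3)], rule funpow_pdiff_sum[OF assms(1,2)])
  also have "\<dots> = (\<Sum>j\<in>I. c j * mdiff \<alpha> (f j) x)"
    unfolding mdiff_def
    by (rule funpow_pdiff_sum[OF assms(1) holo_funpow_pdiff[OF assms(1,2)] assms(3)])
  finally show ?thesis .
qed

lemma mdiff_mult:
  assumes "open U" "holo U f" "holo U g" "x \<in> U"
  shows "mdiff (a, b) (\<lambda>x. f x * g x) x = (\<Sum>k\<le>a. \<Sum>l\<le>b.
    of_nat (a choose k) * of_nat (b choose l) * mdiff (a - k, b - l) f x * mdiff (k, l) g x)"
proof -
  have h: "holo U ((pdiff i ^^ k) f)" "holo U ((pdiff i ^^ k) g)" for k i
    using assms(1-3) by (auto intro: holo_funpow_pdiff)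
  have "mdiff (a, b) (\<lambda>x. f x * g x) x
    = (pdiff 1 ^^ a) (\<lambda>x. \<Sum>l\<le>b. of_nat (b choose l) * ((pdiff 2 ^^ (b - l)) f x * (pdiff 2 ^^ l) g x)) x"
    unfolding mdiff_def fst_conv snd_conv
    by (rule funpow_pdiff_cong[OF assms(1) _ assms(4)], rule funpow_pdiff_mult[OF assms(1-3)])
  also have "\<dots> = (\<Sum>l\<le>b. of_nat (b choose l) * (pdiff 1 ^^ a) (\<lambda>x. (pdiff 2 ^^ (b - l)) f x * (pdiff 2 ^^ l) g x) x)"
    using assms(1,4) h by (intro funpow_pdiff_sum[where U = U]) (auto intro: holo_mult)
  also have "\<dots> = (\<Sum>l\<le>b. of_nat (b choose l) * (\<Sum>k\<le>a. of_nat (a choose k) * (mdiff (a - k, b - l) f x * mdiff (k, l) g x)))"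
    by (intro sum.cong refl, subst funpow_pdiff_mult[OF assms(1) h assms(4)]) (simp add: mdiff_def)
  also have "\<dots> = (\<Sum>k\<le>a. \<Sum>l\<le>b. of_nat (a choose k) * of_nat (b choose l) * mdiff (a - k, b - l) f x * mdiff (k, l) g x)"
    unfolding sum_distrib_left by (subst sum.swap) (simp add: mult_ac)
  finally show ?thesis .
qed

text \<open>\<open>mdiff\<close> takes the q-derivatives first. A further one is moved outwards
  through the p-derivatives by symmetry of second derivatives.\<close>

lemma mdiff_Suc_right:
  assumes "open U" "holo U f" "x \<in> U"
  shows "mdiff (a, Suc b) f x = pdiff 2 (mdiff (a, b) f) x"
  using assms(3)
proof (induction a arbitrary: x)
  case (Suc a)
  have "mdiff (Suc a, Suc b) f x = pdiff 1 (pdiff 2 (mdiff (a, b) f)) x"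
    using pdiff_cong[OF assms(1) Suc.prems Suc.IH] by simp
  also have "\<dots> = pdiff 2 (mdiff (Suc a, b) f) x"
    using pdiff_commute[OF assms(1) holo_mdiff[OF assms(1,2)] Suc.prems] by simp
  finally show ?case .
qed simp

lemma mdiff_mdiff:
  assumes "open U" "holo U f" "x \<in> U"
  shows "mdiff (a, b) (mdiff (c, d) f) x = mdiff (a + c, b + d) f x"
  using assms(3)
proof (induction a arbitrary: x)
  case 0
  then show ?case
  proof (induction b arbitrary: x)
    case (Suc b)
    have "mdiff (0, Suc b) (mdiff (c, d) f) x = pdiff 2 (mdiff (c, b + d) f) x"
      using pdiff_cong[OF assms(1) Suc.prems Suc.IH] by simp
    also have "\<dots> = mdiff (c, Suc b + d) f x"
      using mdiff_Suc_right[OF assms(1,2) Suc.prems] by simp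
    finally show ?case by simp
  qed simp
next
  case (Suc a)
  show ?case
    using pdiff_cong[OF assms(1) Suc.prems Suc.IH] by simp
qed

section \<open>Differential operators\<close>

lemma diffops_iff:
  "P \<in> diffops U \<longleftrightarrow> (\<forall>\<alpha>. holo U (P \<alpha>)) \<and>
     (\<forall>x\<in>U. \<exists>V n. open V \<and> x \<in> V \<and> order_le V (int n) P)"
  by (simp only: diffops_def order_le_def of_nat_less_iff mem_Collect_eq)

lemma diffopsI:
  assumes "\<And>\<alpha>. holo U (P \<alpha>)"
    and "\<And>x. x \<in> U \<Longrightarrow> \<exists>V n. open V \<and> x \<in> V \<and> order_le V (int n) P"
  shows "P \<in> diffops U"
  using assms unfolding diffops_iff by blast

lemma diffops_subset: "P \<in> diffops U \<Longrightarrow> V \<subseteq> U \<Longrightarrow> P \<in> diffops V"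
  unfolding diffops_iff using holo_subset by blast

lemma order_le_mono: "order_le U m P \<Longrightarrow> V \<subseteq> U \<Longrightarrow> m \<le> k \<Longrightarrow> order_le V k P"
  unfolding order_le_def
  by (intro allI impI ballI, drule (1) subsetD, drule spec, drule spec, drule mp) auto

lemma diffops_local:
  assumes "open U" "P \<in> diffops U" "x \<in> U"
  obtains V n where "open V" "x \<in> V" "V \<subseteq> U" "order_le V (int n) P" "P \<in> diffops V"
proof -
  obtain V n where V: "open V" "x \<in> V" "order_le V (int n) P"
    using assms(2,3) unfolding diffops_iff by blast
  show ?thesis
    using that[of "V \<inter> U" n] assms V order_le_mono[OF V(3), of "V \<inter> U" "int n"]
      diffops_subset[OF assms(2), of "V \<inter> U"] by auto
qed

lemma diffops_holo: "P \<in> diffops U \<Longrightarrow> holo U (P \<alpha>)"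
  by (simp add: diffops_def del: split_paired_All)

lemma order_leD: "order_le U m P \<Longrightarrow> m < int (a + b) \<Longrightarrow> x \<in> U \<Longrightarrow> P (a, b) x = 0"
  unfolding order_le_def by blast

lemma order_le_diff: "order_le U m P \<Longrightarrow> order_le U m Q \<Longrightarrow> order_le U m (P - Q)"
  by (simp add: order_le_def)

lemma diffops_zero [simp]: "0 \<in> diffops U"
  by (rule diffopsI) (auto simp: order_le_def zero_fun_def intro!: exI[of _ UNIV])

lemma diffops_bin:
  assumes "open U" "P \<in> diffops U" "Q \<in> diffops U"
    and "\<And>\<alpha> x. x \<in> U \<Longrightarrow> T \<alpha> x = P \<alpha> x + c * Q \<alpha> x"
  shows "T \<in> diffops U"
proof (rule diffopsI)
  fix \<alpha>
  show "holo U (T \<alpha>)"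
    by (rule holo_cong[OF assms(1) assms(4)], assumption)
       (intro holo_add holo_mult holo_const diffops_holo assms(2,3))
next
  fix x assume "x \<in> U"
  obtain V n where V: "open V" "x \<in> V" "V \<subseteq> U" "order_le V (int n) P"
    using diffops_local[OF assms(1,2) \<open>x \<in> U\<close>] by metis
  obtain W k where W: "open W" "x \<in> W" "W \<subseteq> U" "order_le W (int k) Q"
    using diffops_local[OF assms(1,3) \<open>x \<in> U\<close>] by metis
  have "order_le (V \<inter> W) (int (max n k)) T"
    using V(3,4) W(4) by (fastforce simp: order_le_def assms(4))
  then show "\<exists>V n. open V \<and> x \<in> V \<and> order_le V (int n) T"
    using V W by (intro exI[of _ "V \<inter> W"] exI[of _ "max n k"]) auto
qed

lemma diffops_diff: "open U \<Longrightarrow> P \<in> diffops U \<Longrightarrow> Q \<in> diffops U \<Longrightarrow> P - Q \<in> diffops U"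
  by (rule diffops_bin[where c = "-1" and P = P and Q = Q]) auto

lemma diffops_add: "open U \<Longrightarrow> P \<in> diffops U \<Longrightarrow> Q \<in> diffops U \<Longrightarrow> P + Q \<in> diffops U"
  by (rule diffops_bin[where c = 1 and P = P and Q = Q]) auto

lemma diffops_sum: "open U \<Longrightarrow> (\<And>i. i \<in> I \<Longrightarrow> P i \<in> diffops U) \<Longrightarrow> sum P I \<in> diffops U"
  by (induction I rule: infinite_finite_induct) (simp_all add: diffops_add)

text \<open>Replaces the index set of \<open>dapply\<close>, which depends on the point, by a box
  valid on all of \<open>V\<close>; only zero coefficients are added. The resulting sum can be
  differentiated. \<open>dmul_box\<close> does the same for composition.\<close>

lemma dapply_box:
  assumes "order_le V (int n) P" "x \<in> V"
  shows "dapply P f x = (\<Sum>a\<le>n. \<Sum>b\<le>n. P (a, b) x * mdiff (a, b) f x)"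
proof -
  have "dapply P f x = (\<Sum>\<alpha>\<in>{..n} \<times> {..n}. P \<alpha> x * mdiff \<alpha> f x)"
    unfolding dapply_def
  proof (intro sum.mono_neutral_left subsetI)
    show "\<alpha> \<in> {..n} \<times> {..n}" if "\<alpha> \<in> {\<alpha>. P \<alpha> x \<noteq> 0}" for \<alpha>
      using order_leD[OF assms(1) _ assms(2), of "fst \<alpha>" "snd \<alpha>"] that by (cases \<alpha>) force
  qed auto
  then show ?thesis by (simp add: sum.cartesian_product)
qed

lemma dmul_box:
  assumes "order_le V (int n) P" "x \<in> V"
  shows "dmul P Q (c, d) x = (\<Sum>a\<le>n. \<Sum>b\<le>n. P (a, b) x * (\<Sum>k\<le>min a c. \<Sum>l\<le>min b d.
     of_nat (a choose k) * of_nat (b choose l) * mdiff (a - k, b - l) (Q (c - k, d - l)) x))"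
proof -
  have "dmul P Q (c, d) x = (\<Sum>(a, b)\<in>{..n} \<times> {..n}. \<Sum>k\<le>min a c. \<Sum>l\<le>min b d.
     of_nat (a choose k) * of_nat (b choose l) * P (a, b) x * mdiff (a - k, b - l) (Q (c - k, d - l)) x)"
    unfolding dmul_def prod.case
  proof (intro sum.mono_neutral_left subsetI)
    show "\<alpha> \<in> {..n} \<times> {..n}" if "\<alpha> \<in> {(a, b). P (a, b) x \<noteq> 0}" for \<alpha>
      using order_leD[OF assms(1) _ assms(2), of "fst \<alpha>" "snd \<alpha>"] that by (cases \<alpha>) force
  qed auto
  then show ?thesis by (simp add: sum.cartesian_product[symmetric] sum_distrib_left mult_ac)
qed

lemma dapply_cong:
  assumes "open U" "\<And>y. y \<in> U \<Longrightarrow> f y = g y" "x \<in> U"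
  shows "dapply P f x = dapply P g x"
  unfolding dapply_def using mdiff_cong[OF assms] by simp

lemma dapply_op_cong: "(\<And>\<alpha>. P \<alpha> x = Q \<alpha> x) \<Longrightarrow> dapply P f x = dapply Q f x"
  by (simp add: dapply_def)

lemma dapply_zero [simp]: "dapply P (\<lambda>x. 0) = (\<lambda>x. 0)"
  by (simp add: dapply_def fun_eq_iff)

lemma dapply_zero_op [simp]: "dapply 0 f x = 0"
  by (simp add: dapply_def)

lemma holo_dapply:
  assumes "open U" "P \<in> diffops U" "holo U f"
  shows "holo U (dapply P f)"
proof (rule holo_locally)
  fix x assume "x \<in> U"
  then obtain V n where V: "open V" "x \<in> V" "V \<subseteq> U" "order_le V (int n) P" "P \<in> diffops V"
    using diffops_local[OF assms(1,2)] by metis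
  have "holo V (\<lambda>x. \<Sum>a\<le>n. \<Sum>b\<le>n. P (a, b) x * mdiff (a, b) f x)"
    by (intro holo_sum holo_mult diffops_holo[OF V(5)] holo_mdiff[OF V(1)] holo_subset[OF assms(3) V(3)])
  then show "\<exists>V. open V \<and> x \<in> V \<and> (\<exists>g. holo V g \<and> (\<forall>y\<in>V. dapply P f y = g y))"
    using V(1,2) dapply_box[OF V(4)] by blast
qed

lemma dapply_bin_op:
  assumes "open U" "P \<in> diffops U" "Q \<in> diffops U" "x \<in> U"
    and "\<And>\<alpha>. T \<alpha> x = P \<alpha> x + c * Q \<alpha> x"
  shows "dapply T f x = dapply P f x + c * dapply Q f x"
proof -
  obtain V n where V: "x \<in> V" "order_le V (int n) P"
    using diffops_local[OF assms(1,2,4)] by metis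
  obtain W k where W: "x \<in> W" "order_le W (int k) Q"
    using diffops_local[OF assms(1,3,4)] by metis
  \<comment> \<open>Applied at \<open>x\<close>, an operator is seen only through its coefficients
    at \<open>x\<close>, so bounds over the singleton are enough and a common one is
    available.\<close>
  have P: "order_le {x} (int (max n k)) P" and Q: "order_le {x} (int (max n k)) Q"
    using order_le_mono[OF V(2), of "{x}"] order_le_mono[OF W(2), of "{x}"] V(1) W(1) by auto
  have T: "order_le {x} (int (max n k)) T"
    unfolding order_le_def
    by (intro allI impI ballI) (simp add: assms(5) order_leD[OF P] order_leD[OF Q])
  have "P (a, b) x * mdiff (a, b) f x + c * (Q (a, b) x * mdiff (a, b) f x) = T (a, b) x * mdiff (a, b) f x" for a b
    by (simp add: assms(5) algebra_simps)
  then show ?thesis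
    by (simp add: dapply_box[OF P] dapply_box[OF Q] dapply_box[OF T] sum_distrib_left flip: sum.distrib)
qed

lemma dapply_add_op:
  "open U \<Longrightarrow> P \<in> diffops U \<Longrightarrow> Q \<in> diffops U \<Longrightarrow> x \<in> U \<Longrightarrow> dapply (P + Q) f x = dapply P f x + dapply Q f x"
  by (subst dapply_bin_op[where c = 1]) auto

lemma dapply_diff_op:
  "open U \<Longrightarrow> P \<in> diffops U \<Longrightarrow> Q \<in> diffops U \<Longrightarrow> x \<in> U \<Longrightarrow> dapply (P - Q) f x = dapply P f x - dapply Q f x"
  by (subst dapply_bin_op[where c = "-1" and P = P and Q = Q]) auto

lemma dapply_sum_op:
  assumes "open U" "x \<in> U" "\<And>i. i \<in> I \<Longrightarrow> P i \<in> diffops U"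
  shows "dapply (sum P I) f x = (\<Sum>i\<in>I. dapply (P i) f x)"
  using assms(3)
proof (induction I rule: infinite_finite_induct)
  case (insert i F)
  have "dapply (sum P (insert i F)) f x = dapply (P i + sum P F) f x"
    by (simp only: sum.insert[OF insert(1,2)])
  also have "\<dots> = dapply (P i) f x + dapply (sum P F) f x"
    by (rule dapply_add_op[OF assms(1) _ _ assms(2)], use insert.prems in simp,
        rule diffops_sum[OF assms(1)], use insert.prems in simp)
  also have "dapply (sum P F) f x = (\<Sum>i\<in>F. dapply (P i) f x)"
    using insert by simp
  finally show ?case
    by (simp only: sum.insert[OF insert(1,2)])
qed simp_all

lemma dapply_sum:
  assumes "open U" "P \<in> diffops U" "\<And>j. j \<in> I \<Longrightarrow> holo U (f j)" "x \<in> U"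
  shows "dapply P (\<lambda>x. \<Sum>j\<in>I. f j x) x = (\<Sum>j\<in>I. dapply P (f j) x)"
proof -
  obtain V n where V: "x \<in> V" "order_le V (int n) P"
    using diffops_local[OF assms(1,2,4)] by metis
  have "mdiff \<alpha> (\<lambda>x. \<Sum>j\<in>I. 1 * f j x) x = (\<Sum>j\<in>I. 1 * mdiff \<alpha> (f j) x)" for \<alpha>
    by (rule mdiff_sum[OF assms(1) assms(3) assms(4)])
  then have "dapply P (\<lambda>x. \<Sum>j\<in>I. f j x) x = (\<Sum>a\<le>n. \<Sum>b\<le>n. \<Sum>j\<in>I. P (a, b) x * mdiff (a, b) (f j) x)"
    by (simp add: dapply_box[OF V(2,1)] sum_distrib_left)
  also have "\<dots> = (\<Sum>j\<in>I. dapply P (f j) x)"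
    unfolding dapply_box[OF V(2,1)] sum.swap[of _ I] by (rule refl)
  finally show ?thesis .
qed


section \<open>Composition of operators\<close>

text \<open>In a composition, \<open>c\<close> counts all derivatives that reach the function:
  \<open>k\<close> of them left over from the outer operator, \<open>c - k\<close> from the inner
  one. The lemma passes from sums ordered by the total to sums over the two independent
  contributions.\<close>

lemma sum_shift_min:
  fixes g :: "nat \<Rightarrow> nat \<Rightarrow> 'a::comm_monoid_add"
  assumes "a \<le> n" "\<And>k c. m < c \<Longrightarrow> g k c = 0"
  shows "(\<Sum>c\<le>n + m. \<Sum>k\<le>min a c. g k (c - k)) = (\<Sum>k\<le>a. \<Sum>c\<le>m. g k c)"
proof -
  have "(\<Sum>c\<le>n + m. \<Sum>k\<le>min a c. g k (c - k)) = (\<Sum>(c, k)\<in>Sigma {..n + m} (\<lambda>c. {..min a c}). g k (c - k))"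
    by (simp add: sum.Sigma)
  also have "\<dots> = (\<Sum>(k, c)\<in>{..a} \<times> {..m}. g k c)"
  proof (rule sum.reindex_bij_witness_not_neutral[where
      S' = "{(c, k). c \<in> {..n + m} \<and> k \<le> min a c \<and> m < c - k}" and T' = "{}" and
      i = "\<lambda>(k, c). (k + c, k)" and j = "\<lambda>(c, k). (k, c - k)"])
    show "finite {(c, k). c \<in> {..n + m} \<and> k \<le> min a c \<and> m < c - k}"
      by (rule finite_subset[of _ "{..n + m} \<times> {..a}"]) auto
  qed (use assms in auto)
  also have "\<dots> = (\<Sum>k\<le>a. \<Sum>c\<le>m. g k c)"
    by (simp add: sum.cartesian_product)
  finally show ?thesis .
qed

text \<open>A derivative of the outer operator that falls on a coefficient of \<open>Q\<close> is
  lost to the order, so no term exceeds \<open>m + k\<close>. The natural number \<open>n\<close>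
  provides the finite box; \<open>m\<close> and \<open>k\<close> are integers and may be
  negative.\<close>

lemma order_le_dmul:
  assumes "open V" "order_le V (int n) P" "order_le V m P" "order_le V k Q"
  shows "order_le V (m + k) (dmul P Q)"
  unfolding order_le_def
proof (intro allI impI ballI)
  fix c d x assume cd: "m + k < int (c + d)" and x: "x \<in> V"
  have "P (a, b) x * mdiff (a - i, b - j) (Q (c - i, d - j)) x = 0"
    if "i \<le> min a c" "j \<le> min b d" for a b i j
  proof (cases "m < int (a + b)")
    case True
    then show ?thesis using order_leD[OF assms(3) _ x] by simp
  next
    case False
    then have "k < int ((c - i) + (d - j))"
      using that cd by linarith
    then have "mdiff (a - i, b - j) (Q (c - i, d - j)) x = mdiff (a - i, b - j) (\<lambda>x. 0) x"
      by (intro mdiff_cong[OF assms(1) _ x] order_leD[OF assms(4)])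
    then show ?thesis by simp
  qed
  then have z: "P (a, b) x * (of_nat (a choose i) * of_nat (b choose j) * mdiff (a - i, b - j) (Q (c - i, d - j)) x) = 0"
    if "i \<le> min a c" "j \<le> min b d" for a b i j
    using that by (metis mult_eq_0_iff)
  show "dmul P Q (c, d) x = 0"
    unfolding dmul_box[OF assms(2) x] sum_distrib_left
    by (intro sum.neutral ballI) (use z in simp)
qed

lemma diffops_dmul:
  assumes "open U" "P \<in> diffops U" "Q \<in> diffops U"
  shows "dmul P Q \<in> diffops U"
proof (rule diffopsI)
  fix \<gamma> :: "nat \<times> nat"
  obtain c d where cd: "\<gamma> = (c, d)" by fastforce
  have "holo U (dmul P Q (c, d))"
  proof (rule holo_locally)
    fix x assume "x \<in> U"
    then obtain V n where V: "open V" "x \<in> V" "V \<subseteq> U" "order_le V (int n) P" "P \<in> diffops V"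
      using diffops_local[OF assms(1,2)] by metis
    have "holo V (\<lambda>x. \<Sum>a\<le>n. \<Sum>b\<le>n. P (a, b) x * (\<Sum>k\<le>min a c. \<Sum>l\<le>min b d.
     of_nat (a choose k) * of_nat (b choose l) * mdiff (a - k, b - l) (Q (c - k, d - l)) x))"
      by (intro holo_sum holo_mult holo_const diffops_holo[OF V(5)] holo_mdiff[OF V(1)]
          diffops_holo[OF diffops_subset[OF assms(3) V(3)]])
    then show "\<exists>V. open V \<and> x \<in> V \<and> (\<exists>g. holo V g \<and> (\<forall>y\<in>V. dmul P Q (c, d) y = g y))"
      using V(1,2) dmul_box[OF V(4)] by blast
  qed
  then show "holo U (dmul P Q \<gamma>)" using cd by simp
next
  fix x assume x: "x \<in> U"
  obtain V n where V: "open V" "x \<in> V" "V \<subseteq> U" "order_le V (int n) P"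
    using diffops_local[OF assms(1,2) x] by metis
  obtain W k where W: "open W" "x \<in> W" "W \<subseteq> U" "order_le W (int k) Q"
    using diffops_local[OF assms(1,3) x] by metis
  have "order_le (V \<inter> W) (int n + int k) (dmul P Q)"
    using V(1,4) W(1,4) by (intro order_le_dmul[of _ n]) (auto elim!: order_le_mono)
  then show "\<exists>V n. open V \<and> x \<in> V \<and> order_le V (int n) (dmul P Q)"
    using V(1,2) W(1,2) by (intro exI[of _ "V \<inter> W"] exI[of _ "n + k"]) auto
qed

text \<open>In the top degree only those Leibniz terms survive in which no derivative falls on a
  coefficient of \<open>Q\<close>. What remains is a convolution, that is, the product of the
  symbols.\<close>

lemma dmul_top:
  assumes "open V" "order_le V (int n) P" "order_le V m P" "order_le V k Q" "x \<in> V" "int (c + d) = m + k"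
  shows "dmul P Q (c, d) x = (\<Sum>a\<le>c. \<Sum>b\<le>d. P (a, b) x * Q (c - a, d - b) x)"
proof -
  \<comment> \<open>The box is enlarged by \<open>c\<close> and \<open>d\<close> so that it contains
    the rectangle to which the sum is finally restricted.\<close>
  define N where "N = n + c + d"
  have PN: "order_le V (int N) P"
    using assms(2) by (rule order_le_mono) (auto simp: N_def)
  have Q0: "mdiff (i, j) (Q (c', d')) x = 0" if "k < int (c' + d')" for i j c' d'
  proof -
    have "mdiff (i, j) (Q (c', d')) x = mdiff (i, j) (\<lambda>x. 0) x"
      using that by (intro mdiff_cong[OF assms(1) _ assms(5)] order_leD[OF assms(4)])
    then show ?thesis by simp
  qed
  have *: "P (a, b) x * (\<Sum>i\<le>min a c. \<Sum>j\<le>min b d. of_nat (a choose i) * of_nat (b choose j) *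
      mdiff (a - i, b - j) (Q (c - i, d - j)) x) = (if a \<le> c \<and> b \<le> d then P (a, b) x * Q (c - a, d - b) x else 0)"
    for a b
  proof (cases "m < int (a + b)")
    case True
    then show ?thesis using order_leD[OF assms(3) _ assms(5)] by simp
  next
    case False
    have z: "mdiff (a - i, b - j) (Q (c - i, d - j)) x = 0"
      if "i \<le> min a c" "j \<le> min b d" "\<not> (i = a \<and> j = b)" for i j
      by (rule Q0) (use that False assms(6) in linarith)
    show ?thesis
    proof (cases "a \<le> c \<and> b \<le> d")
      case True
      have "(\<Sum>i\<le>min a c. \<Sum>j\<le>min b d. of_nat (a choose i) * of_nat (b choose j) *
        mdiff (a - i, b - j) (Q (c - i, d - j)) x)
        = (\<Sum>(i, j)\<in>{..a} \<times> {..b}. of_nat (a choose i) * of_nat (b choose j) *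
        mdiff (a - i, b - j) (Q (c - i, d - j)) x)"
        using True by (simp add: sum.cartesian_product min_def)
      also have "\<dots> = (\<Sum>(i, j)\<in>{(a, b)}. of_nat (a choose i) * of_nat (b choose j) *
        mdiff (a - i, b - j) (Q (c - i, d - j)) x)"
      proof (intro sum.mono_neutral_right ballI)
        fix p assume "p \<in> {..a} \<times> {..b} - {(a, b)}"
        then obtain i j where "p = (i, j)" "i \<le> a" "j \<le> b" "\<not> (i = a \<and> j = b)" by auto
        then show "(case p of (i, j) \<Rightarrow> of_nat (a choose i) * of_nat (b choose j) * mdiff (a - i, b - j) (Q (c - i, d - j)) x) = 0"
          using True by (simp add: z)
      qed auto
      finally show ?thesis using True by simp
    next
      case False
      have "(\<Sum>i\<le>min a c. \<Sum>j\<le>min b d. of_nat (a choose i) * of_nat (b choose j) *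
        mdiff (a - i, b - j) (Q (c - i, d - j)) x) = 0"
        by (intro sum.neutral ballI) (use z False in auto)
      then show ?thesis using False by auto
    qed
  qed
  have "dmul P Q (c, d) x = (\<Sum>(a, b)\<in>{..N} \<times> {..N}. if a \<le> c \<and> b \<le> d then P (a, b) x * Q (c - a, d - b) x else 0)"
    unfolding dmul_box[OF PN assms(5)] * by (simp add: sum.cartesian_product)
  also have "\<dots> = (\<Sum>(a, b)\<in>{..c} \<times> {..d}. P (a, b) x * Q (c - a, d - b) x)"
    by (rule sum.mono_neutral_cong_right) (auto simp: N_def split: if_splits)
  finally show ?thesis by (simp add: sum.cartesian_product)
qed

text \<open>Confirms that \<open>dmul\<close> is composition. Both sides are expanded into the same
  sum over the numbers \<open>k\<close>, \<open>l\<close> of outer derivatives passing on to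
  \<open>f\<close> and the indices \<open>c\<close>, \<open>d\<close> of the inner operator.\<close>

lemma dapply_dmul:
  assumes "open U" "P \<in> diffops U" "Q \<in> diffops U" "holo U f" "x \<in> U"
  shows "dapply (dmul P Q) f x = dapply P (dapply Q f) x"
proof -
  obtain V1 n where V1: "open V1" "x \<in> V1" "V1 \<subseteq> U" "order_le V1 (int n) P"
    using diffops_local[OF assms(1,2,5)] by metis
  obtain V2 m where V2: "open V2" "x \<in> V2" "V2 \<subseteq> U" "order_le V2 (int m) Q"
    using diffops_local[OF assms(1,3,5)] by metis
  define V where "V = V1 \<inter> V2"
  have V: "open V" "x \<in> V" "V \<subseteq> U" "order_le V (int n) P" "order_le V (int m) Q"
    using V1 V2 by (auto simp: V_def elim!: order_le_mono)
  have hf: "holo V (mdiff \<alpha> f)" for \<alpha>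
    using holo_mdiff[OF assms(1,4)] V(3) holo_subset by blast
  have hQ: "holo V (Q \<alpha>)" for \<alpha>
    using diffops_holo[OF assms(3)] V(3) holo_subset by blast
  \<comment> \<open>One Leibniz term: \<open>a - k\<close> and \<open>b - l\<close> derivatives fall
    on the coefficient \<open>(c, d)\<close> of \<open>Q\<close>, the others on
    \<open>f\<close>.\<close>
  define T where "T = (\<lambda>a b k l c d. of_nat (a choose k) * of_nat (b choose l) *
      mdiff (a - k, b - l) (Q (c, d)) x * mdiff (k + c, l + d) f x)"
  have T0: "T a b k l c d = 0" if "m < c \<or> m < d" for a b k l c d
  proof -
    have "mdiff (a - k, b - l) (Q (c, d)) x = mdiff (a - k, b - l) (\<lambda>x. 0) x"
      using that by (intro mdiff_cong[OF V(1) _ V(2)] order_leD[OF V(5)]) auto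
    then show ?thesis by (simp add: T_def)
  qed
  have "mdiff (a, b) (dapply Q f) x = (\<Sum>k\<le>a. \<Sum>c\<le>m. \<Sum>l\<le>b. \<Sum>d\<le>m. T a b k l c d)" for a b
  proof -
    have "mdiff (a, b) (dapply Q f) x = mdiff (a, b) (\<lambda>y. \<Sum>\<gamma>\<in>{..m} \<times> {..m}. 1 * (Q \<gamma> y * mdiff \<gamma> f y)) x"
      by (rule mdiff_cong[OF V(1) _ V(2)]) (simp add: dapply_box[OF V(5)] sum.cartesian_product)
    also have "\<dots> = (\<Sum>\<gamma>\<in>{..m} \<times> {..m}. 1 * mdiff (a, b) (\<lambda>y. Q \<gamma> y * mdiff \<gamma> f y) x)"
      by (rule mdiff_sum[OF V(1) holo_mult[OF hQ hf] V(2)])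
    also have "\<dots> = (\<Sum>c\<le>m. \<Sum>d\<le>m. \<Sum>k\<le>a. \<Sum>l\<le>b. T a b k l c d)"
      by (simp add: sum.cartesian_product' mdiff_mult[OF V(1) hQ hf V(2)] T_def
          mdiff_mdiff[OF V(1) holo_subset[OF assms(4) V(3)] V(2)])
    also have "\<dots> = (\<Sum>k\<le>a. \<Sum>c\<le>m. \<Sum>l\<le>b. \<Sum>d\<le>m. T a b k l c d)"
      by (subst sum.swap[of _ "{..a}" "{..m}"], subst sum.swap[of _ "{..a}" "{..m}"])
         (intro sum.cong refl sum.swap)
    finally show ?thesis .
  qed
  then have R: "dapply P (dapply Q f) x = (\<Sum>a\<le>n. \<Sum>b\<le>n. P (a, b) x * (\<Sum>k\<le>a. \<Sum>c\<le>m. \<Sum>l\<le>b. \<Sum>d\<le>m. T a b k l c d))"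
    by (simp add: dapply_box[OF V(4,2)])
  have ord: "order_le V (int (n + m)) (dmul P Q)"
    using order_le_dmul[OF V(1,4,4,5)] by simp
  have "dapply (dmul P Q) f x = (\<Sum>c\<le>n + m. \<Sum>d\<le>n + m. dmul P Q (c, d) x * mdiff (c, d) f x)"
    by (rule dapply_box[OF ord V(2)])
  also have "\<dots> = (\<Sum>c\<le>n + m. \<Sum>d\<le>n + m. \<Sum>a\<le>n. \<Sum>b\<le>n. P (a, b) x * (\<Sum>k\<le>min a c. \<Sum>l\<le>min b d. T a b k l (c - k) (d - l)))"
    unfolding dmul_box[OF V(4,2)] T_def
    by (intro sum.cong refl) (auto simp: sum_distrib_left sum_distrib_right mult_ac intro!: sum.cong)
  also have "\<dots> = (\<Sum>a\<le>n. \<Sum>b\<le>n. P (a, b) x * (\<Sum>c\<le>n + m. \<Sum>d\<le>n + m. \<Sum>k\<le>min a c. \<Sum>l\<le>min b d. T a b k l (c - k) (d - l)))"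
    unfolding sum_distrib_left sum.swap[of _ "{..n}" "{..n + m}"] by (rule refl)
  also have "\<dots> = (\<Sum>a\<le>n. \<Sum>b\<le>n. P (a, b) x * (\<Sum>k\<le>a. \<Sum>c\<le>m. \<Sum>l\<le>b. \<Sum>d\<le>m. T a b k l c d))"
  proof -
    have "(\<Sum>c\<le>n + m. \<Sum>d\<le>n + m. \<Sum>k\<le>min a c. \<Sum>l\<le>min b d. T a b k l (c - k) (d - l))
        = (\<Sum>k\<le>a. \<Sum>c\<le>m. \<Sum>l\<le>b. \<Sum>d\<le>m. T a b k l c d)" if ab: "a \<le> n" "b \<le> n" for a b
    proof -
      have "(\<Sum>c\<le>n + m. \<Sum>d\<le>n + m. \<Sum>k\<le>min a c. \<Sum>l\<le>min b d. T a b k l (c - k) (d - l))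
        = (\<Sum>c\<le>n + m. \<Sum>k\<le>min a c. \<Sum>d\<le>n + m. \<Sum>l\<le>min b d. T a b k l (c - k) (d - l))"
      by (intro sum.cong refl sum.swap)
    also have "\<dots> = (\<Sum>k\<le>a. \<Sum>c\<le>m. \<Sum>d\<le>n + m. \<Sum>l\<le>min b d. T a b k l c (d - l))"
      using ab T0 by (intro sum_shift_min) auto
    also have "\<dots> = (\<Sum>k\<le>a. \<Sum>c\<le>m. \<Sum>l\<le>b. \<Sum>d\<le>m. T a b k l c d)"
      using ab T0 by (intro sum.cong refl sum_shift_min) auto
    finally show ?thesis .
    qed
    then show ?thesis by simp
  qed
  finally show ?thesis using R by simp
qed

section \<open>Branches of the cubic\<close>

definition cubic_roots :: "complex^2 \<Rightarrow> complex set" where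
  "cubic_roots x = {z. z ^ 3 = x $ 1 * z + x $ 2}"

lemma cubic_factor:
  fixes x :: "complex^2"
  obtains r1 r2 r3 where "\<And>w. w ^ 3 - x $ 1 * w - x $ 2 = (w - r1) * (w - r2) * (w - r3)"
    "r1 + r2 + r3 = 0" "x $ 1 = - (r1 * r2 + r1 * r3 + r2 * r3)" "x $ 2 = r1 * r2 * r3"
proof -
  define a where "a = (\<lambda>n::nat. if n = 0 then - x $ 2 else if n = 1 then - x $ 1 else if n = 3 then 1 else 0)"
  have "\<exists>n\<in>{1..3}. a n \<noteq> 0"
    by (rule bexI[of _ 3]) (simp_all add: a_def)
  then obtain r1 where "(\<Sum>n\<le>3. a n * r1 ^ n) = 0"
    using fundamental_theorem_of_algebra by blast
  then have "(r1 ^ 3 - x $ 1 * r1) - x $ 2 = 0"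
    by (simp add: a_def eval_nat_numeral algebra_simps)
  then have q: "x $ 2 = r1 ^ 3 - x $ 1 * r1"
    by (simp only: right_minus_eq)
  \<comment> \<open>The number under the root is the discriminant of
    \<open>w^2 + r1 w + r1^2 - p\<close>, the quotient of the cubic by
    \<open>w - r1\<close>.\<close>
  define c where "c = csqrt (4 * x $ 1 - 3 * r1\<^sup>2)"
  have c: "c\<^sup>2 = 4 * x $ 1 - 3 * r1\<^sup>2"
    by (simp add: c_def)
  then have p: "x $ 1 = (c\<^sup>2 + 3 * r1\<^sup>2) / 4"
    by simp
  show ?thesis
  proof (rule that[of r1 "(- r1 + c) / 2" "(- r1 - c) / 2"])
    show "w ^ 3 - x $ 1 * w - x $ 2 = (w - r1) * (w - (- r1 + c) / 2) * (w - (- r1 - c) / 2)" for w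
      unfolding q p by (simp add: field_simps power2_eq_square power3_eq_cube)
  qed (unfold q p, simp_all add: field_simps power2_eq_square power3_eq_cube)
qed

lemma cubic_roots_iff: "z \<in> cubic_roots x \<longleftrightarrow> z ^ 3 - x $ 1 * z - x $ 2 = 0"
  unfolding cubic_roots_def mem_Collect_eq diff_diff_eq right_minus_eq by (rule refl)

lemma cubic_roots_factored:
  assumes "\<And>w. w ^ 3 - x $ 1 * w - x $ 2 = (w - r1) * (w - r2) * (w - r3)"
  shows "cubic_roots x = {r1, r2, r3}"
proof -
  have "z \<in> cubic_roots x \<longleftrightarrow> (z - r1) * (z - r2) * (z - r3) = 0" for z
    unfolding assms[symmetric] by (rule cubic_roots_iff)
  then show ?thesis by auto
qed

lemma card_cubic_roots_le: "finite (cubic_roots x)" "card (cubic_roots x) \<le> 3"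
proof -
  obtain r1 r2 r3 where "\<And>w. w ^ 3 - x $ 1 * w - x $ 2 = (w - r1) * (w - r2) * (w - r3)"
    using cubic_factor by metis
  from cubic_roots_factored[OF this] show "finite (cubic_roots x)" "card (cubic_roots x) \<le> 3"
    by (simp_all add: card_insert_if)
qed

lemma Discr_eq_zero_of_double_root:
  assumes "z \<in> cubic_roots x" "3 * z\<^sup>2 = x $ 1"
  shows "Discr x = 0"
proof -
  have "x $ 2 = (x $ 1 * z + x $ 2) - 3 * z\<^sup>2 * z"
    using assms(2) by simp
  also have "\<dots> = z ^ 3 - 3 * z\<^sup>2 * z"
    using assms(1) by (simp add: cubic_roots_def)
  also have "\<dots> = - 2 * z ^ 3"
    by (simp add: power2_eq_square power3_eq_cube)
  finally have "x $ 2 = - 2 * z ^ 3" .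
  then show ?thesis
    by (simp add: Discr_def power2_eq_square power3_eq_cube flip: assms(2))
qed

text \<open>The roots sum to 0, so a coincidence of two of them yields \<open>p = 3 r^2\<close>, a
  double root, which happens only over the cusp.\<close>

lemma card_cubic_roots:
  assumes "x \<notin> cusp"
  shows "card (cubic_roots x) = 3"
proof -
  obtain r1 r2 r3 where r: "\<And>w. w ^ 3 - x $ 1 * w - x $ 2 = (w - r1) * (w - r2) * (w - r3)"
    "r1 + r2 + r3 = 0" "x $ 1 = - (r1 * r2 + r1 * r3 + r2 * r3)"
    using cubic_factor by metis
  have roots: "cubic_roots x = {r1, r2, r3}"
    by (rule cubic_roots_factored[OF r(1)])
  have ne: "3 * z\<^sup>2 \<noteq> x $ 1" if "z \<in> cubic_roots x" for z
    using Discr_eq_zero_of_double_root[OF that] assms by (auto simp: cusp_def)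
  have e: "r3 = - (r1 + r2)" "r2 = - (r1 + r3)" "r1 = - (r2 + r3)"
    using r(2) by (simp_all only: eq_neg_iff_add_eq_0 add_ac)
  have "r1 \<noteq> r2"
  proof
    assume "r1 = r2"
    then have "x $ 1 = 3 * r1\<^sup>2"
      unfolding r(3) e(1) by (simp add: power2_eq_square algebra_simps)
    then show False using ne[of r1] roots by simp
  qed
  moreover have "r1 \<noteq> r3"
  proof
    assume "r1 = r3"
    then have "x $ 1 = 3 * r1\<^sup>2"
      unfolding r(3) e(2) by (simp add: power2_eq_square algebra_simps)
    then show False using ne[of r1] roots by simp
  qed
  moreover have "r2 \<noteq> r3"
  proof
    assume "r2 = r3"
    then have "x $ 1 = 3 * r2\<^sup>2"
      unfolding r(3) e(3) by (simp add: power2_eq_square algebra_simps)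
    then show False using ne[of r2] roots by simp
  qed
  ultimately show ?thesis using roots by simp
qed

section \<open>Dependence of the roots on the coefficients\<close>

text \<open>A monic cubic takes at \<open>w\<close> the product of the differences from
  \<open>w\<close> to its roots; were all three at distance at least \<delta>, the value would have
  modulus at least \<delta>^3. This is the quantitative stability of roots on which the local sheets
  rest.\<close>

lemma cubic_root_near:
  assumes "cmod (w ^ 3 - x $ 1 * w - x $ 2) < \<delta> ^ 3" "\<delta> > 0"
  shows "\<exists>z\<in>cubic_roots x. dist w z < \<delta>"
proof (rule ccontr)
  assume *: "\<not> ?thesis"
  obtain r1 r2 r3 where r: "\<And>w. w ^ 3 - x $ 1 * w - x $ 2 = (w - r1) * (w - r2) * (w - r3)"
    using cubic_factor by metis
  have "\<delta> \<le> cmod (w - r1)" "\<delta> \<le> cmod (w - r2)" "\<delta> \<le> cmod (w - r3)"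
    using * cubic_roots_factored[OF r] by (auto simp: dist_norm not_less)
  then have "\<delta> * \<delta> * \<delta> \<le> cmod (w - r1) * cmod (w - r2) * cmod (w - r3)"
    using assms(2) by (intro mult_mono) auto
  also have "\<dots> = cmod (w ^ 3 - x $ 1 * w - x $ 2)"
    unfolding r by (simp add: norm_mult)
  finally show False using assms(1) by (simp add: power3_eq_cube)
qed

lemma open_cubic_small: "open {x :: complex^2. cmod (w ^ 3 - x $ 1 * w - x $ 2) < \<epsilon>}"
  by (intro open_Collect_less continuous_intros)

lemma closed_cusp: "closed cusp"
  unfolding cusp_def Discr_def by (intro closed_Collect_eq continuous_intros)

text \<open>Discs of radius half the least distance between the roots over \<open>x0\<close> are
  disjoint, and for \<open>x\<close> near \<open>x0\<close> each contains a root over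
  \<open>x\<close>. Choosing one per disc is injective on a set of three elements, so it exhausts
  the at most three roots over \<open>x\<close>. The first conclusion yields local sections, the
  second splits the preimage into sheets.\<close>

lemma cubic_sheets:
  assumes "x0 \<notin> cusp"
  shows "\<exists>\<delta> T. 0 < \<delta> \<and> open T \<and> x0 \<in> T \<and> T \<subseteq> - cusp \<and>
    (\<forall>x r. x \<in> T \<longrightarrow> r \<in> cubic_roots x0 \<longrightarrow> (\<exists>!z. z \<in> cubic_roots x \<and> dist r z < \<delta>)) \<and>
    (\<forall>x z. x \<in> T \<longrightarrow> z \<in> cubic_roots x \<longrightarrow> (\<exists>!r. r \<in> cubic_roots x0 \<and> dist r z < \<delta>))"
proof -
  have fin: "finite (cubic_roots x0)" by (rule card_cubic_roots_le)
  obtain d where d: "d > 0" "\<And>r r'. r \<in> cubic_roots x0 \<Longrightarrow> r' \<in> cubic_roots x0 \<Longrightarrow> r \<noteq> r' \<Longrightarrow> d \<le> dist r r'"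
  proof -
    define S where "S = insert 1 ((\<lambda>(r, r'). dist r r') ` {(r, r'). r \<in> cubic_roots x0 \<and> r' \<in> cubic_roots x0 \<and> r \<noteq> r'})"
    have fS: "finite S"
      unfolding S_def by (intro finite.insertI finite_imageI finite_subset[OF _ finite_cartesian_product[OF fin fin]]) auto
    show ?thesis
    proof (rule that[of "Min S"])
      show "Min S > 0" using fS by (subst Min_gr_iff) (auto simp: S_def)
      show "Min S \<le> dist r r'" if "r \<in> cubic_roots x0" "r' \<in> cubic_roots x0" "r \<noteq> r'" for r r'
        using fS that by (intro Min_le) (auto simp: S_def)
    qed
  qed
  define \<delta> where "\<delta> = d / 2"
  \<comment> \<open>The bound by \<delta>^3 is the hypothesis of \<open>cubic_root_near\<close>, and
    for fixed \<open>r\<close> it is an open condition on \<open>x\<close>.\<close>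
  define T where "T = - cusp \<inter> (\<Inter>r\<in>cubic_roots x0. {x. cmod (r ^ 3 - x $ 1 * r - x $ 2) < \<delta> ^ 3})"
  have \<delta>: "\<delta> > 0" using d(1) by (simp add: \<delta>_def)
  have uniq: "r = r'" if "r \<in> cubic_roots x0" "r' \<in> cubic_roots x0" "dist r z < \<delta>" "dist r' z < \<delta>" for r r' z
  proof (rule ccontr)
    assume "r \<noteq> r'"
    then have "d \<le> dist r r'" by (rule d(2)[OF that(1,2)])
    also have "\<dots> \<le> dist r z + dist r' z" by (rule dist_triangle2)
    also have "\<dots> < d" using that(3,4) unfolding \<delta>_def by simp
    finally show False by simp
  qed
  have ex: "\<exists>z\<in>cubic_roots x. dist r z < \<delta>" if "x \<in> T" "r \<in> cubic_roots x0" for x r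
    using that \<delta> by (intro cubic_root_near) (auto simp: T_def)
  have sur: "\<exists>r\<in>cubic_roots x0. dist r z < \<delta> \<and> (\<forall>z'\<in>cubic_roots x. dist r z' < \<delta> \<longrightarrow> z' = z)"
    if x: "x \<in> T" and z: "z \<in> cubic_roots x" for x z
  proof -
    obtain h where h: "\<And>r. r \<in> cubic_roots x0 \<Longrightarrow> h r \<in> cubic_roots x \<and> dist r (h r) < \<delta>"
    proof -
      have "\<forall>r. \<exists>z. r \<in> cubic_roots x0 \<longrightarrow> z \<in> cubic_roots x \<and> dist r z < \<delta>"
        using ex[OF x] by blast
      then show ?thesis using that by (metis (full_types))
    qed
    have "inj_on h (cubic_roots x0)"
    proof (rule inj_onI)
      fix r r' assume "r \<in> cubic_roots x0" "r' \<in> cubic_roots x0" "h r = h r'"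
      then show "r = r'" using uniq[of r r' "h r"] h[of r] h[of r'] by simp
    qed
    then have "card (h ` cubic_roots x0) = 3"
      using card_cubic_roots[OF assms] by (simp add: card_image)
    moreover have "h ` cubic_roots x0 \<subseteq> cubic_roots x"
      using h by blast
    ultimately have im: "h ` cubic_roots x0 = cubic_roots x"
      using card_cubic_roots_le[of x] by (intro card_seteq) auto
    have "z \<in> h ` cubic_roots x0" unfolding im by (rule z)
    then obtain r where r: "r \<in> cubic_roots x0" "z = h r" by (elim imageE)
    have "z' = z" if "z' \<in> cubic_roots x" "dist r z' < \<delta>" for z'
    proof -
      have "z' \<in> h ` cubic_roots x0" unfolding im by (rule that(1))
      then obtain r' where r': "r' \<in> cubic_roots x0" "z' = h r'" by (elim imageE)
      have "dist r' z' < \<delta>" using h r' by simp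
      then have "r = r'" using uniq[OF r(1) r'(1) that(2)] by simp
      then show ?thesis using r r' by simp
    qed
    then show ?thesis using r h[OF r(1)] by blast
  qed
  show ?thesis
  proof (intro exI[of _ \<delta>] exI[of _ T] conjI allI impI)
    show "open T"
      unfolding T_def using fin closed_cusp by (intro open_Int open_INT ballI open_cubic_small) auto
    show "x0 \<in> T"
      using assms \<delta> by (auto simp: T_def cubic_roots_def)
    show "\<exists>!z. z \<in> cubic_roots x \<and> dist r z < \<delta>" if xr: "x \<in> T" "r \<in> cubic_roots x0" for x r
    proof -
      obtain z where z: "z \<in> cubic_roots x" "dist r z < \<delta>"
        using ex[OF xr] by blast
      obtain r' where r': "r' \<in> cubic_roots x0" "dist r' z < \<delta>"
          "\<And>z'. z' \<in> cubic_roots x \<Longrightarrow> dist r' z' < \<delta> \<Longrightarrow> z' = z"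
        using sur[OF xr(1) z(1)] by blast
      have "r = r'" by (rule uniq[OF xr(2) r'(1) z(2) r'(2)])
      show ?thesis
      proof (rule ex1I[of _ z])
        fix y assume "y \<in> cubic_roots x \<and> dist r y < \<delta>"
        then show "y = z" using r'(3)[of y] by (simp add: \<open>r = r'\<close>)
      qed (use z in simp)
    qed
    show "\<exists>!r. r \<in> cubic_roots x0 \<and> dist r z < \<delta>" if xz: "x \<in> T" "z \<in> cubic_roots x" for x z
    proof -
      obtain r where r: "r \<in> cubic_roots x0" "dist r z < \<delta>"
        using sur[OF xz] by blast
      show ?thesis
      proof (rule ex1I[of _ r])
        fix r' assume "r' \<in> cubic_roots x0 \<and> dist r' z < \<delta>"
        then show "r' = r" using uniq[of r' r z] r by simp
      qed (use r in simp)
    qed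
  qed (use \<delta> in \<open>auto simp: T_def\<close>)
qed

lemma cubic_section_continuous:
  assumes "open T" "\<And>x. x \<in> T \<Longrightarrow> \<exists>!z. z \<in> cubic_roots x \<and> dist r z < \<delta>"
    and g: "\<And>x. x \<in> T \<Longrightarrow> g x \<in> cubic_roots x \<and> dist r (g x) < \<delta>"
  shows "continuous_on T g"
  unfolding continuous_on_eq_continuous_at[OF assms(1)]
proof
  fix x assume x: "x \<in> T"
  show "continuous (at x) g"
    unfolding continuous_at_eps_delta
  proof (intro allI impI)
    fix e :: real assume "e > 0"
    \<comment> \<open>Kept below the distance from \<open>g x\<close> to the rim of the disc around
      \<open>r\<close>, so that a root over \<open>y\<close> found near \<open>g x\<close> still
      lies in that disc and must be \<open>g y\<close>.\<close>
    define \<epsilon> where "\<epsilon> = min e (\<delta> - dist r (g x))"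
    have \<epsilon>: "\<epsilon> > 0" using \<open>e > 0\<close> g[OF x] by (simp add: \<epsilon>_def)
    define W where "W = T \<inter> {y. cmod (g x ^ 3 - y $ 1 * g x - y $ 2) < \<epsilon> ^ 3}"
    have "open W" unfolding W_def using assms(1) by (intro open_Int open_cubic_small)
    moreover have "x \<in> W" using x g[OF x] \<epsilon> by (simp add: W_def cubic_roots_def)
    ultimately obtain d where d: "d > 0" "\<And>y. dist x y < d \<Longrightarrow> y \<in> W"
      by (meson open_contains_ball mem_ball subset_eq)
    have "dist (g y) (g x) < e" if "dist y x < d" for y
    proof -
      have y: "y \<in> W" using d(2) that by (simp add: dist_commute)
      then obtain z where z: "z \<in> cubic_roots y" "dist (g x) z < \<epsilon>"
        using cubic_root_near[of "g x" y \<epsilon>] \<epsilon> by (auto simp: W_def)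
      have "dist r z < \<delta>"
        using z(2) dist_triangle[of r z "g x"] by (simp add: \<epsilon>_def)
      then have "g y = z"
        using z(1) y assms(2)[of y] g[of y] by (auto simp: W_def)
      then show ?thesis using z(2) by (simp add: \<epsilon>_def dist_commute)
    qed
    then show "\<exists>d>0. \<forall>y. dist y x < d \<longrightarrow> dist (g y) (g x) < e"
      using d(1) by blast
  qed
qed

text \<open>\<open>N y\<close> is of size O(|y - x|) and \<open>g y - g x\<close> tends to 0, so
  their product contributes nothing to first order. It turns continuity into differentiability
  twice: for roots of the cubic, and for a parametrization of the cusp at the origin.\<close>

lemma has_derivative_mult_continuous:
  fixes N g :: "'a::real_normed_vector \<Rightarrow> complex"
  assumes N: "(N has_derivative N') (at x)" "N x = 0" and g: "continuous (at x) g"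
  shows "((\<lambda>y. N y * g y) has_derivative (\<lambda>v. N' v * g x)) (at x)"
proof -
  have "((\<lambda>y. N y * (g y - g x)) has_derivative (\<lambda>v. 0)) (at x)"
    unfolding has_derivative_at_alt
  proof (intro conjI allI impI)
    obtain K where K: "K > 0" "\<And>h. norm (N' h) \<le> norm h * K"
      using bounded_linear.pos_bounded[OF has_derivative_bounded_linear[OF N(1)]] by blast
    obtain d where d: "d > 0" "\<And>y. norm (y - x) < d \<Longrightarrow> norm (N y - N x - N' (y - x)) \<le> 1 * norm (y - x)"
      using N(1) unfolding has_derivative_at_alt by (meson zero_less_one)
    fix e :: real assume "e > 0"
    then have "e / (1 + K) > 0" using K(1) by simp
    then obtain d' where d': "d' > 0" "\<And>y. norm (y - x) < d' \<Longrightarrow> norm (g y - g x) < e / (1 + K)"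
      using g unfolding continuous_at_eps_delta dist_norm by blast
    have "norm (N y * (g y - g x)) \<le> e * norm (y - x)" if "norm (y - x) < min d d'" for y
    proof -
      have "norm (N y) \<le> norm (N y - N' (y - x)) + norm (N' (y - x))"
        using norm_triangle_ineq[of "N y - N' (y - x)" "N' (y - x)"] by simp
      also have "\<dots> \<le> (1 + K) * norm (y - x)"
        using d(2)[of y] K(2)[of "y - x"] that N(2) by (simp add: algebra_simps)
      finally have "norm (N y) * norm (g y - g x) \<le> ((1 + K) * norm (y - x)) * (e / (1 + K))"
        using d'(2)[of y] that K(1) by (intro mult_mono) auto
      then show ?thesis using K(1) by (simp add: norm_mult mult.commute)
    qed
    then show "\<exists>d>0. \<forall>y. norm (y - x) < d \<longrightarrow>
        norm (N y * (g y - g x) - N x * (g x - g x) - 0) \<le> e * norm (y - x)"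
      using d(1) d'(1) by (intro exI[of _ "min d d'"]) auto
  qed simp
  from has_derivative_add[OF has_derivative_mult_left[OF N(1), of "g x"] this]
  show ?thesis by (simp add: algebra_simps)
qed

text \<open>Subtracting the cubic equations at \<open>y\<close> and \<open>x\<close> gives
  \<open>(z y - z x) * D y = N y\<close> with \<open>N\<close> affine and \<open>D\<close>
  continuous. At \<open>x\<close> the factor \<open>D\<close> equals 3 z^2 - p, so near a simple
  root one may divide.\<close>

lemma cubic_root_has_derivative:
  assumes "open U" "continuous_on U z" "\<And>x. x \<in> U \<Longrightarrow> z x \<in> cubic_roots x" "x \<in> U" "3 * (z x)\<^sup>2 \<noteq> x $ 1"
  shows "(z has_derivative (\<lambda>v. (z x * v $ 1 + v $ 2) / (3 * (z x)\<^sup>2 - x $ 1))) (at x)"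
proof -
  define N where "N = (\<lambda>y::complex^2. (y $ 1 - x $ 1) * z x + (y $ 2 - x $ 2))"
  define D where "D = (\<lambda>y::complex^2. (z y)\<^sup>2 + z y * z x + (z x)\<^sup>2 - y $ 1)"
  have Dx: "D x = 3 * (z x)\<^sup>2 - x $ 1" by (simp add: D_def power2_eq_square)
  have eq: "(z y - z x) * D y = N y" if "y \<in> U" for y
    using assms(3)[OF that] assms(3)[OF assms(4)]
    by (simp add: cubic_roots_def D_def N_def power2_eq_square power3_eq_cube algebra_simps)
  have cD: "continuous_on U D"
    unfolding D_def by (intro continuous_intros assms(2))
  then have contD: "continuous (at x) D"
    using assms(1,4) continuous_on_eq_continuous_at by blast
  have "open (U \<inter> D -` (- {0}))"
    using cD assms(1) by (intro continuous_open_preimage) auto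
  moreover have "x \<in> U \<inter> D -` (- {0})" using assms(4,5) Dx by simp
  moreover have "((\<lambda>y. z x + N y * inverse (D y)) has_derivative (\<lambda>v. 0 + (v $ 1 * z x + v $ 2) * inverse (D x))) (at x)"
  proof (intro has_derivative_add has_derivative_const has_derivative_mult_continuous)
    show "(N has_derivative (\<lambda>v. v $ 1 * z x + v $ 2)) (at x)"
      unfolding N_def
      by (auto intro!: derivative_eq_intros bounded_linear.has_derivative[OF bounded_linear_vec_nth])
    show "continuous (at x) (\<lambda>y. inverse (D y))"
      using contD assms(5) Dx by (intro continuous_intros) auto
  qed (simp add: N_def)
  moreover have "z x + N y * inverse (D y) = z y" if "y \<in> U \<inter> D -` (- {0})" for y
  proof -
    have "N y * inverse (D y) = z y - z x"
      using that eq[of y] by (simp add: divide_inverse[symmetric] nonzero_divide_eq_eq)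
    then show ?thesis by simp
  qed
  ultimately have "(z has_derivative (\<lambda>v. 0 + (v $ 1 * z x + v $ 2) * inverse (D x))) (at x)"
    by (elim has_derivative_transform_within_open)
  then show ?thesis by (simp add: Dx divide_inverse mult.commute)
qed

lemma branch_iff:
  "branch U z \<longleftrightarrow> holo U z \<and> (\<forall>x\<in>U. z x \<in> cubic_roots x)"
  by (simp add: branch_def cubic_roots_def)

lemma branch_subset: "branch U z \<Longrightarrow> V \<subseteq> U \<Longrightarrow> branch V z"
  unfolding branch_iff using holo_subset by blast

lemma simple_root:
  assumes "x \<notin> cusp" "z \<in> cubic_roots x"
  shows "3 * z\<^sup>2 - x $ 1 \<noteq> 0"
  using Discr_eq_zero_of_double_root[OF assms(2)] assms(1) by (auto simp: cusp_def)

lemma branch_has_derivative: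
  assumes "open U" "U \<subseteq> - cusp" "branch U z" "x \<in> U"
  shows "(z has_derivative (\<lambda>v. (z x * v $ 1 + v $ 2) / (3 * (z x)\<^sup>2 - x $ 1))) (at x)"
  using assms simple_root[of x "z x"]
  by (intro cubic_root_has_derivative[of U]) (auto simp: branch_iff holo_imp_continuous_on)

text \<open>Off the cusp all roots are simple, so a continuous choice of roots is already
  holomorphic. Lifting arguments therefore need to produce continuity only.\<close>

lemma branchI:
  assumes "open U" "U \<subseteq> - cusp" "continuous_on U z" "\<And>x. x \<in> U \<Longrightarrow> z x \<in> cubic_roots x"
  shows "branch U z"
  unfolding branch_iff
proof (intro conjI holoI ballI)
  fix x assume x: "x \<in> U"
  show "(z has_derivative (\<lambda>v. (z x * v $ 1 + v $ 2) / (3 * (z x)\<^sup>2 - x $ 1))) (at x)"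
    using assms x simple_root[of x "z x"] by (intro cubic_root_has_derivative[of U]) auto
qed (use assms in \<open>auto simp: algebra_simps add_divide_distrib\<close>)

section \<open>Local branches and the covering by roots\<close>

lemma local_branch:
  assumes "x0 \<notin> cusp" "z0 \<in> cubic_roots x0"
  obtains T z where "open T" "x0 \<in> T" "T \<subseteq> - cusp" "branch T z" "z x0 = z0"
proof -
  obtain \<delta> T where T: "0 < \<delta>" "open T" "x0 \<in> T" "T \<subseteq> - cusp"
    and u': "\<forall>x r. x \<in> T \<longrightarrow> r \<in> cubic_roots x0 \<longrightarrow> (\<exists>!z. z \<in> cubic_roots x \<and> dist r z < \<delta>)"
    and "\<forall>x z. x \<in> T \<longrightarrow> z \<in> cubic_roots x \<longrightarrow> (\<exists>!r. r \<in> cubic_roots x0 \<and> dist r z < \<delta>)"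
    using cubic_sheets[OF assms(1)] by (elim exE conjE)
  note u = u'[rule_format]
  define g where "g = (\<lambda>x. THE z. z \<in> cubic_roots x \<and> dist z0 z < \<delta>)"
  have g: "g x \<in> cubic_roots x \<and> dist z0 (g x) < \<delta>" if "x \<in> T" for x
    unfolding g_def by (rule theI'[OF u[OF that assms(2)]])
  have "continuous_on T g"
    by (rule cubic_section_continuous[OF T(2) u[OF _ assms(2)] g])
  then have "branch T g"
    using T g by (intro branchI) auto
  moreover have "g x0 = z0"
    using u[OF T(3) assms(2)] g[OF T(3)] assms(2) T(1) by (metis dist_self)
  ultimately show ?thesis using that T by blast
qed

lemma covering_space_cubic:
  "covering_space {(x, z). x \<notin> cusp \<and> z \<in> cubic_roots x} fst (- cusp)"
proof (rule covering_spaceI)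
  let ?E = "{(x, z). x \<notin> cusp \<and> z \<in> cubic_roots x}"
  show "continuous_on ?E fst"
    by (intro continuous_intros)
  have "\<exists>z. z \<in> cubic_roots x" for x
    using cubic_factor[of x] cubic_roots_factored by (metis insertI1)
  then show "fst ` ?E = - cusp"
    by force
  fix x0 assume "x0 \<in> - cusp"
  then have x0: "x0 \<notin> cusp" by simp
  obtain \<delta> T where T: "0 < \<delta>" "open T" "x0 \<in> T" "T \<subseteq> - cusp"
    and u': "\<forall>x r. x \<in> T \<longrightarrow> r \<in> cubic_roots x0 \<longrightarrow> (\<exists>!z. z \<in> cubic_roots x \<and> dist r z < \<delta>)"
    and s': "\<forall>x z. x \<in> T \<longrightarrow> z \<in> cubic_roots x \<longrightarrow> (\<exists>!r. r \<in> cubic_roots x0 \<and> dist r z < \<delta>)"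
    using cubic_sheets[OF x0] by (elim exE conjE)
  note u = u'[rule_format] and s = s'[rule_format]
  \<comment> \<open>The sheet of \<open>r\<close> consists of the roots within \<delta> of
    \<open>r\<close>. The uniqueness statement \<open>u\<close> makes it a graph over
    \<open>T\<close>; \<open>s\<close> makes the sheets disjoint and exhaustive.\<close>
  define S where "S = (\<lambda>r. {(x, z). x \<in> T \<and> z \<in> cubic_roots x \<and> dist r z < \<delta>})"
  show "\<exists>T. x0 \<in> T \<and> openin (top_of_set (- cusp)) T \<and>
         (\<exists>v. \<Union> v = ?E \<inter> fst -` T \<and> (\<forall>u\<in>v. openin (top_of_set ?E) u) \<and>
              pairwise disjnt v \<and> (\<forall>u\<in>v. \<exists>q. homeomorphism u T fst q))"
  proof (intro exI[of _ T] exI[of _ "S ` cubic_roots x0"] conjI ballI)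
    show "x0 \<in> T" by fact
    show "openin (top_of_set (- cusp)) T"
      using T by (simp add: open_subset)
    show "\<Union> (S ` cubic_roots x0) = ?E \<inter> fst -` T"
    proof (intro equalityI subsetI)
      fix w assume "w \<in> \<Union> (S ` cubic_roots x0)"
      then show "w \<in> ?E \<inter> fst -` T"
        using T(4) by (auto simp: S_def)
    next
      fix w assume "w \<in> ?E \<inter> fst -` T"
      then obtain x z where w: "w = (x, z)" "x \<in> T" "z \<in> cubic_roots x" by auto
      then obtain r where "r \<in> cubic_roots x0" "dist r z < \<delta>"
        using s by blast
      then show "w \<in> \<Union> (S ` cubic_roots x0)"
        using w by (auto simp: S_def)
    qed
    show "pairwise disjnt (S ` cubic_roots x0)"
    proof (rule pairwiseI, unfold disjnt_iff, intro allI notI, elim imageE conjE)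
      fix a b w r r' assume *: "a \<noteq> b" "w \<in> a" "w \<in> b" "a = S r" "r \<in> cubic_roots x0" "b = S r'" "r' \<in> cubic_roots x0"
      then obtain x z where "w = (x, z)" "x \<in> T" "z \<in> cubic_roots x" "dist r z < \<delta>" "dist r' z < \<delta>"
        by (auto simp: S_def)
      then have "r = r'"
        using s[of x z] *(5,7) by auto
      then show False using * by simp
    qed
    fix A assume "A \<in> S ` cubic_roots x0"
    then obtain r where r: "r \<in> cubic_roots x0" "A = S r" by blast
    have "A = ?E \<inter> (T \<times> ball r \<delta>)"
      using T(4) by (auto simp: r S_def)
    then show "openin (top_of_set ?E) A"
      using openin_open_Int[OF open_Times[OF T(2) open_ball]] by blast
    define g where "g = (\<lambda>x. THE z. z \<in> cubic_roots x \<and> dist r z < \<delta>)"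
    have g: "g x \<in> cubic_roots x \<and> dist r (g x) < \<delta>" if "x \<in> T" for x
      unfolding g_def by (rule theI'[OF u[OF that r(1)]])
    have gc: "continuous_on T g"
      by (rule cubic_section_continuous[OF T(2) u[OF _ r(1)] g])
    have gu: "z = g x" if "x \<in> T" "z \<in> cubic_roots x" "dist r z < \<delta>" for x z
      using u[OF that(1) r(1)] g[OF that(1)] that by blast
    have "homeomorphism A T fst (\<lambda>x. (x, g x))"
      unfolding homeomorphism_def
    proof (intro conjI)
      show "continuous_on A fst" by (intro continuous_intros)
      show "continuous_on T (\<lambda>x. (x, g x))" by (intro continuous_intros gc)
      show "\<forall>x\<in>A. (fst x, g (fst x)) = x"
        using gu by (auto simp: r(2) S_def)
      show "fst ` A = T"
        using g by (force simp: r(2) S_def)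
      show "(\<lambda>x. (x, g x)) ` T = A"
        using g gu by (auto simp: r(2) S_def)
    qed simp
    then show "\<exists>q. homeomorphism A T fst q" by blast
  qed
qed

lemma ex_branch:
  assumes "open U" "simply_connected U" "U \<subseteq> - cusp"
  shows "\<exists>z. branch U z"
proof -
  obtain g where g: "continuous_on U g" "g \<in> U \<rightarrow> {(x, z). x \<notin> cusp \<and> z \<in> cubic_roots x}" "\<And>y. y \<in> U \<Longrightarrow> fst (g y) = y"
    using covering_space_lift[OF covering_space_cubic assms(2) open_imp_locally_path_connected[OF assms(1)], of "\<lambda>x. x"]
      assms(3) by (auto simp: continuous_on_id)
  have "branch U (\<lambda>x. snd (g x))"
  proof (rule branchI[OF assms(1,3)])
    show "continuous_on U (\<lambda>x. snd (g x))"
      by (intro continuous_intros g(1))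
    show "snd (g x) \<in> cubic_roots x" if "x \<in> U" for x
      using g(2,3) that by (auto simp: Pi_iff split_beta)
  qed
  then show ?thesis by blast
qed

section \<open>Poles of the derivatives of a branch along the cusp\<close>

lemma vector_2_axis: "(vector [a, b] :: complex^2) = a *s axis 1 1 + b *s axis 2 1"
  by (simp add: vec_eq_iff forall_2 axis_def)

lemma has_derivative_vector_2:
  assumes "(f has_derivative f') F" "(g has_derivative g') F"
  shows "((\<lambda>x. vector [f x, g x] :: complex^2) has_derivative (\<lambda>v. vector [f' v, g' v])) F"
  unfolding vector_2_axis
  by (intro has_derivative_add bounded_linear.has_derivative[OF bounded_linear_vsmult_left] assms)

lemma tendsto_vector_2:
  assumes "(f \<longlongrightarrow> a) F" "(g \<longlongrightarrow> b) F"
  shows "((\<lambda>x. vector [f x, g x] :: complex^2) \<longlongrightarrow> vector [a, b]) F"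
  unfolding vector_2_axis
  by (intro tendsto_add bounded_linear.tendsto[OF bounded_linear_vsmult_left] assms)

text \<open>On the surface of roots, \<open>z\<close> and \<open>s = 3 z\<^sup>2 - p\<close> are global coordinates, and \<open>s\<close> vanishes to
  first order on the ramification locus.\<close>

definition root_chart :: "(complex^2 \<Rightarrow> complex) \<Rightarrow> complex^2 \<Rightarrow> complex^2" where
  "root_chart z y = vector [z y, 3 * (z y)\<^sup>2 - y $ 1]"

text \<open>\<open>F\<close> has the branch as an argument because branches exist only locally. The
  point is that one entire \<open>G\<close> serves all branches and open sets: its values at s = 0
  are the leading coefficients of the pole along the cusp.\<close>

definition polar_form :: "nat \<Rightarrow> (complex^2 \<Rightarrow> complex) \<Rightarrow>
    ((complex^2 \<Rightarrow> complex) \<Rightarrow> complex^2 \<Rightarrow> complex) \<Rightarrow> bool" where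
  "polar_form n G F \<longleftrightarrow> holo UNIV G \<and>
     (\<forall>W z y. open W \<longrightarrow> W \<subseteq> - cusp \<longrightarrow> branch W z \<longrightarrow> y \<in> W \<longrightarrow>
        F z y = G (root_chart z y) / (3 * (z y)\<^sup>2 - y $ 1) ^ n)"

lemma polar_formD:
  "polar_form n G F \<Longrightarrow> open W \<Longrightarrow> W \<subseteq> - cusp \<Longrightarrow> branch W z \<Longrightarrow> y \<in> W \<Longrightarrow>
    F z y = G (root_chart z y) / (3 * (z y)\<^sup>2 - y $ 1) ^ n"
  unfolding polar_form_def by blast

lemma polar_form_holo: "polar_form n G F \<Longrightarrow> holo UNIV G"
  unfolding polar_form_def by blast

text \<open>The quotient rule with the derivatives of the chart: z has partial derivatives z/s and
  1/s, and s has (6 z^2 - s)/s and 6 z/s. The pole order rises by two, once from differentiating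
  s^(-n) and once from these denominators.\<close>

lemma pdiff_polar_quotient:
  assumes G: "holo UNIV G" and W: "open W" "W \<subseteq> - cusp" "branch W z" "y \<in> W"
  defines "s \<equiv> 3 * (z y)\<^sup>2 - y $ 1" and "w \<equiv> root_chart z y"
  shows "pdiff 1 (\<lambda>y. G (root_chart z y) / (3 * (z y)\<^sup>2 - y $ 1) ^ n) y =
      (s * (z y * pdiff 1 G w + (6 * (z y)\<^sup>2 - s) * pdiff 2 G w) - of_nat n * (6 * (z y)\<^sup>2 - s) * G w) / s ^ (n + 2)"
    and "pdiff 2 (\<lambda>y. G (root_chart z y) / (3 * (z y)\<^sup>2 - y $ 1) ^ n) y =
      (s * (pdiff 1 G w + 6 * z y * pdiff 2 G w) - of_nat n * (6 * z y) * G w) / s ^ (n + 2)"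
proof -
  have "y \<notin> cusp" "z y \<in> cubic_roots y"
    using W by (auto simp: branch_iff)
  then have s: "s \<noteq> 0"
    unfolding s_def by (rule simple_root)
  define dz where "dz = (\<lambda>v::complex^2. (z y * v $ 1 + v $ 2) / s)"
  have dz: "(z has_derivative dz) (at y)"
    using branch_has_derivative[OF W] by (simp add: dz_def s_def)
  have ds: "((\<lambda>y. 3 * (z y)\<^sup>2 - y $ 1) has_derivative (\<lambda>v. 6 * z y * dz v - v $ 1)) (at y)"
    by (auto intro!: derivative_eq_intros dz bounded_linear.has_derivative[OF bounded_linear_vec_nth])
  have dchart: "(root_chart z has_derivative (\<lambda>v. vector [dz v, 6 * z y * dz v - v $ 1])) (at y)"
    using has_derivative_vector_2[OF dz ds] by (simp add: root_chart_def[abs_def])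
  have "((\<lambda>y. G (root_chart z y)) has_derivative
      (\<lambda>v. \<Sum>j\<in>UNIV. pdiff j G w * (vector [dz v, 6 * z y * dz v - v $ 1] :: complex^2) $ j)) (at y)"
    by (rule has_derivative_compose[OF dchart]) (simp add: w_def holo_has_derivative[OF G])
  then have dG: "((\<lambda>y. G (root_chart z y)) has_derivative
      (\<lambda>v. pdiff 1 G w * dz v + pdiff 2 G w * (6 * z y * dz v - v $ 1))) (at y)"
    by (simp add: sum_2)
  have dp: "((\<lambda>y. (3 * (z y)\<^sup>2 - y $ 1) ^ n) has_derivative
      (\<lambda>v. of_nat n * (6 * z y * dz v - v $ 1) * s ^ (n - 1))) (at y)"
    using has_derivative_power[OF ds, of n] by (simp add: s_def)
  define L where "L = (\<lambda>v. ((pdiff 1 G w * dz v + pdiff 2 G w * (6 * z y * dz v - v $ 1)) * s ^ n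
      - G w * (of_nat n * (6 * z y * dz v - v $ 1) * s ^ (n - 1))) / (s ^ n * s ^ n))"
  have "((\<lambda>y. G (root_chart z y) / (3 * (z y)\<^sup>2 - y $ 1) ^ n) has_derivative L) (at y)"
    using has_derivative_divide'[OF dG dp] s unfolding L_def s_def w_def by simp
  moreover have "L (c *s v) = c * L v" for c v
    unfolding L_def dz_def by (simp add: add_divide_distrib diff_divide_distrib algebra_simps)
  ultimately have eq: "pdiff i (\<lambda>y. G (root_chart z y) / (3 * (z y)\<^sup>2 - y $ 1) ^ n) y = L (axis i 1)" for i
    by (rule pdiff_eqI)
  show "pdiff 1 (\<lambda>y. G (root_chart z y) / (3 * (z y)\<^sup>2 - y $ 1) ^ n) y =
      (s * (z y * pdiff 1 G w + (6 * (z y)\<^sup>2 - s) * pdiff 2 G w) - of_nat n * (6 * (z y)\<^sup>2 - s) * G w) / s ^ (n + 2)"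
    unfolding eq L_def dz_def using s
    by (cases n) (simp_all add: axis_def divide_simps power2_eq_square, simp_all add: algebra_simps)
  show "pdiff 2 (\<lambda>y. G (root_chart z y) / (3 * (z y)\<^sup>2 - y $ 1) ^ n) y =
      (s * (pdiff 1 G w + 6 * z y * pdiff 2 G w) - of_nat n * (6 * z y) * G w) / s ^ (n + 2)"
    unfolding eq L_def dz_def using s
    by (cases n) (simp_all add: axis_def divide_simps power2_eq_square, simp_all add: algebra_simps)
qed

text \<open>At s = 0 every term with a factor s disappears and only the derivative of s^(-n) is
  left; it multiplies the leading coefficient by -6 n z^2 or -6 n z.\<close>

lemma polar_form_pdiff:
  assumes F: "polar_form n G F"
  shows "\<exists>G'. polar_form (n + 2) G' (\<lambda>z. pdiff 1 (F z)) \<and>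
      (\<forall>t. G' (vector [t, 0]) = - 6 * of_nat n * t\<^sup>2 * G (vector [t, 0]))"
    and "\<exists>G'. polar_form (n + 2) G' (\<lambda>z. pdiff 2 (F z)) \<and>
      (\<forall>t. G' (vector [t, 0]) = - 6 * of_nat n * t * G (vector [t, 0]))"
proof -
  note G = polar_form_holo[OF F]
  note hG = holo_pdiff[OF open_UNIV G]
  have pd: "pdiff i (F z) y = pdiff i (\<lambda>y. G (root_chart z y) / (3 * (z y)\<^sup>2 - y $ 1) ^ n) y"
    if "open W" "W \<subseteq> - cusp" "branch W z" "y \<in> W" for i W z y
    by (rule pdiff_cong[OF that(1,4)]) (rule polar_formD[OF F that(1-3)])
  have ch: "root_chart z y $ 1 = z y" "root_chart z y $ 2 = 3 * (z y)\<^sup>2 - y $ 1" for z y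
    by (simp_all add: root_chart_def)
  define G1 where "G1 = (\<lambda>w::complex^2. w $ 2 * (w $ 1 * pdiff 1 G w + (6 * (w $ 1)\<^sup>2 - w $ 2) * pdiff 2 G w)
      - of_nat n * (6 * (w $ 1)\<^sup>2 - w $ 2) * G w)"
  define G2 where "G2 = (\<lambda>w::complex^2. w $ 2 * (pdiff 1 G w + 6 * w $ 1 * pdiff 2 G w) - of_nat n * (6 * w $ 1) * G w)"
  have "polar_form (n + 2) G1 (\<lambda>z. pdiff 1 (F z))"
    unfolding polar_form_def
  proof (intro conjI allI impI)
    show "holo UNIV G1"
      unfolding G1_def by (intro holo_diff holo_add holo_mult holo_const holo_nth holo_power hG G)
    fix W z y assume W: "open W" "W \<subseteq> - cusp" "branch W z" "y \<in> W"
    show "pdiff 1 (F z) y = G1 (root_chart z y) / (3 * (z y)\<^sup>2 - y $ 1) ^ (n + 2)"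
      unfolding pd[OF W] pdiff_polar_quotient(1)[OF G W] G1_def ch by (rule refl)
  qed
  moreover have "G1 (vector [t, 0]) = - 6 * of_nat n * t\<^sup>2 * G (vector [t, 0])" for t
    by (simp add: G1_def)
  ultimately show "\<exists>G'. polar_form (n + 2) G' (\<lambda>z. pdiff 1 (F z)) \<and>
      (\<forall>t. G' (vector [t, 0]) = - 6 * of_nat n * t\<^sup>2 * G (vector [t, 0]))"
    by blast
  have "polar_form (n + 2) G2 (\<lambda>z. pdiff 2 (F z))"
    unfolding polar_form_def
  proof (intro conjI allI impI)
    show "holo UNIV G2"
      unfolding G2_def by (intro holo_diff holo_add holo_mult holo_const holo_nth holo_power hG G)
    fix W z y assume W: "open W" "W \<subseteq> - cusp" "branch W z" "y \<in> W"
    show "pdiff 2 (F z) y = G2 (root_chart z y) / (3 * (z y)\<^sup>2 - y $ 1) ^ (n + 2)"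
      unfolding pd[OF W] pdiff_polar_quotient(2)[OF G W] G2_def ch by (rule refl)
  qed
  moreover have "G2 (vector [t, 0]) = - 6 * of_nat n * t * G (vector [t, 0])" for t
    by (simp add: G2_def)
  ultimately show "\<exists>G'. polar_form (n + 2) G' (\<lambda>z. pdiff 2 (F z)) \<and>
      (\<forall>t. G' (vector [t, 0]) = - 6 * of_nat n * t * G (vector [t, 0]))"
    by blast
qed

text \<open>A crude bound, two orders of pole for each derivative. It suffices for derivatives of
  order at most m - 1, since 2 (m - 1) < 2 m - 1.\<close>

lemma polar_form_mdiff:
  assumes "polar_form 0 G F"
  shows "\<exists>G'. polar_form (2 * (a + b)) G' (\<lambda>z. mdiff (a, b) (F z))"
proof (induction a)
  case 0
  show ?case
  proof (induction b)
    case 0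
    then show ?case using assms by auto
  next
    case (Suc b)
    then obtain G' where "polar_form (2 * (0 + b)) G' (\<lambda>z. mdiff (0, b) (F z))" by blast
    from polar_form_pdiff(2)[OF this] show ?case by (auto simp: add.commute)
  qed
next
  case (Suc a)
  then obtain G' where "polar_form (2 * (a + b)) G' (\<lambda>z. mdiff (a, b) (F z))" by blast
  from polar_form_pdiff(1)[OF this] show ?case by (auto simp: algebra_simps)
qed

lemma polar_form_root: "polar_form 0 (\<lambda>w. w $ 1) (\<lambda>z. z)"
  by (simp add: polar_form_def root_chart_def)

lemma polar_form_root_square: "polar_form 0 (\<lambda>w. (w $ 1)\<^sup>2) (\<lambda>z y. (z y)\<^sup>2)"
  by (simp add: polar_form_def root_chart_def holo_power)

text \<open>The general rule would give pole order 2 here. The true order 1 starts the sharp count 2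
  m - 1.\<close>

lemma polar_form_pdiff_root:
  "polar_form 1 (\<lambda>w. w $ 1) (\<lambda>z. pdiff 1 z)" "polar_form 1 (\<lambda>w. 1) (\<lambda>z. pdiff 2 z)"
proof -
  have "pdiff i z y = (z y * axis i 1 $ 1 + axis i 1 $ 2) / (3 * (z y)\<^sup>2 - y $ 1)"
    if "open W" "W \<subseteq> - cusp" "branch W z" "y \<in> W" for i W z y
    by (rule pdiff_eqI[OF branch_has_derivative[OF that]]) (simp add: add_divide_distrib algebra_simps)
  then show "polar_form 1 (\<lambda>w. w $ 1) (\<lambda>z. pdiff 1 z)" "polar_form 1 (\<lambda>w. 1) (\<lambda>z. pdiff 2 z)"
    unfolding polar_form_def by (auto simp: root_chart_def axis_def)
qed

text \<open>The leading coefficient of the pole of an \<open>m\<close>-th derivative of \<open>z\<close>, up to powers of \<open>z\<close>.\<close>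

definition polar_const :: "nat \<Rightarrow> complex" where
  "polar_const m = (\<Prod>i\<in>{1..<m}. - 6 * of_nat (2 * i - 1))"

lemma polar_const_nonzero: "polar_const m \<noteq> 0"
proof
  have e: "- 6 * of_nat k = (0 :: complex) \<longleftrightarrow> k = 0" for k :: nat
    by simp
  assume "polar_const m = 0"
  then obtain i where "i \<in> {1..<m}" "2 * i - 1 = 0"
    unfolding polar_const_def prod_zero_iff[OF finite_atLeastLessThan] e by (elim bexE)
  then show False by simp
qed

lemma polar_const_Suc: "m \<ge> 1 \<Longrightarrow> polar_const (Suc m) = - 6 * of_nat (2 * m - 1) * polar_const m"
  by (simp add: polar_const_def prod.atLeastLessThan_Suc)

lemma polar_const_1: "polar_const (Suc 0) = 1"
  by (simp add: polar_const_def)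

text \<open>From pole order 1 onwards, each further derivative contributes a factor -6 (2 i - 1),
  collected in \<open>polar_const\<close>, and one z, with a second z for a p-derivative. The first
  derivative contributes z or 1, which accounts for \<open>t ^ a * t ^ (a + b - 1)\<close>.\<close>

lemma polar_form_mdiff_root:
  assumes "a + b \<ge> 1"
  shows "\<exists>G. polar_form (2 * (a + b) - 1) G (\<lambda>z. mdiff (a, b) z) \<and>
    (\<forall>t. G (vector [t, 0]) = polar_const (a + b) * t ^ a * t ^ (a + b - 1))"
  using assms
proof (induction a)
  case 0
  then show ?case
  proof (induction b)
    case (Suc b)
    show ?case
    proof (cases "b = 0")
      case True
      then show ?thesis using polar_form_pdiff_root(2) by (auto simp: polar_const_1)
    next
      case False
      then obtain G where G: "polar_form (2 * b - 1) G (\<lambda>z. mdiff (0, b) z)"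
        "\<And>t. G (vector [t, 0]) = polar_const b * t ^ (b - 1)"
        using Suc.IH by auto
      from polar_form_pdiff(2)[OF G(1)] obtain G' where
        G': "polar_form (2 * b - 1 + 2) G' (\<lambda>z. pdiff 2 (mdiff (0, b) z))"
        "\<And>t. G' (vector [t, 0]) = - 6 * of_nat (2 * b - 1) * t * G (vector [t, 0])"
        by blast
      have "polar_form (2 * (0 + Suc b) - 1) G' (\<lambda>z. mdiff (0, Suc b) z)"
        using G'(1) False by (simp add: eval_nat_numeral Suc_diff_le)
      moreover have "G' (vector [t, 0]) = polar_const (0 + Suc b) * t ^ 0 * t ^ (0 + Suc b - 1)" for t
        using False by (cases b) (simp_all add: G'(2) G(2) polar_const_Suc)
      ultimately show ?thesis by blast
    qed
  qed simp
next
  case (Suc a)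
  show ?case
  proof (cases "a + b = 0")
    case True
    then show ?thesis using polar_form_pdiff_root(1) by (auto simp: polar_const_1)
  next
    case False
    define m where "m = a + b"
    have m: "m \<noteq> 0" using False by (simp add: m_def)
    obtain G where G: "polar_form (2 * m - 1) G (\<lambda>z. mdiff (a, b) z)"
      "\<And>t. G (vector [t, 0]) = polar_const m * t ^ a * t ^ (m - 1)"
      using Suc.IH False by (auto simp: m_def)
    from polar_form_pdiff(1)[OF G(1)] obtain G' where
      G': "polar_form (2 * m - 1 + 2) G' (\<lambda>z. pdiff 1 (mdiff (a, b) z))"
      "\<And>t. G' (vector [t, 0]) = - 6 * of_nat (2 * m - 1) * t\<^sup>2 * G (vector [t, 0])"
      by blast
    have "2 * m - 1 + 2 = 2 * (Suc a + b) - 1"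
      using m by (simp add: m_def)
    then have "polar_form (2 * (Suc a + b) - 1) G' (\<lambda>z. mdiff (Suc a, b) z)"
      using G'(1) by simp
    moreover have "G' (vector [t, 0]) = polar_const (Suc a + b) * t ^ Suc a * t ^ (Suc a + b - 1)" for t
    proof -
      obtain k where k: "m = Suc k" using m not0_implies_Suc by blast
      have "G' (vector [t, 0]) = (- 6 * of_nat (2 * m - 1) * polar_const m) * t ^ Suc a * t ^ Suc k"
        unfolding G' G by (simp add: k power2_eq_square)
      also have "- 6 * of_nat (2 * m - 1) * polar_const m = polar_const (Suc m)"
        using m by (subst polar_const_Suc) auto
      finally show ?thesis by (simp add: k[symmetric] m_def)
    qed
    ultimately show ?thesis by blast
  qed
qed


section \<open>Approach to the cusp along its tangent lines\<close>

text \<open>The line of all \<open>(p, q)\<close> that have \<open>z0\<close> as a root, with s = 3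
  z0^2 - p as its parameter \<open>t\<close>. It meets the cusp at \<open>t = 0\<close>, and z
  \<mapsto> \<open>root_curve z 0\<close> parametrizes the cusp.\<close>

definition root_curve :: "complex \<Rightarrow> complex \<Rightarrow> complex^2" where
  "root_curve z0 t = vector [3 * z0\<^sup>2 - t, t * z0 - 2 * z0 ^ 3]"

lemma root_curve_root: "z0 \<in> cubic_roots (root_curve z0 t)"
  by (simp add: cubic_roots_def root_curve_def algebra_simps power2_eq_square power3_eq_cube)

lemma root_curve_fst: "root_curve z0 t $ 1 = 3 * z0\<^sup>2 - t"
  by (simp add: root_curve_def)

lemma Discr_root_curve: "Discr (root_curve z0 t) = t\<^sup>2 * (9 * z0\<^sup>2 - 4 * t)"
  by (simp add: Discr_def root_curve_def power2_eq_square power3_eq_cube algebra_simps)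

lemma tendsto_root_curve: "(root_curve z0 \<longlongrightarrow> root_curve z0 0) (at 0)"
  unfolding root_curve_def by (intro tendsto_vector_2 tendsto_intros)

lemma eventually_root_curve_off_cusp:
  assumes "z0 \<noteq> 0"
  shows "eventually (\<lambda>t. root_curve z0 t \<notin> cusp) (at 0)"
proof -
  have "((\<lambda>t. 9 * z0\<^sup>2 - 4 * t) \<longlongrightarrow> 9 * z0\<^sup>2 - 4 * 0) (at 0)"
    by (intro tendsto_intros)
  then have "eventually (\<lambda>t. 9 * z0\<^sup>2 - 4 * t \<noteq> 0) (at 0)"
    by (rule tendsto_imp_eventually_ne) (use assms in simp)
  moreover have "eventually (\<lambda>t::complex. t \<noteq> 0) (at 0)"
    by (simp add: eventually_at_filter)
  ultimately show ?thesis
    by eventually_elim (simp add: cusp_def Discr_root_curve)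
qed

definition branch_through :: "(complex^2 \<Rightarrow> complex) \<Rightarrow> complex^2 \<Rightarrow> complex \<Rightarrow> bool" where
  "branch_through z y z0 \<longleftrightarrow> (\<exists>W. open W \<and> W \<subseteq> - cusp \<and> branch W z \<and> y \<in> W \<and> z y = z0)"

text \<open>The branches \<open>\<zeta> t\<close> are chosen separately for each \<open>t\<close>. A
  \<open>polar_form\<close> evaluates each at its own point of the line, where the chart has
  coordinates \<open>z0\<close> and \<open>t\<close>.\<close>

lemma ex_branch_along_root_curve:
  assumes "z0 \<noteq> 0"
  shows "\<exists>\<zeta>. eventually (\<lambda>t. branch_through (\<zeta> t) (root_curve z0 t) z0) (at 0)"
proof -
  have "\<exists>z. branch_through z (root_curve z0 t) z0" if t: "root_curve z0 t \<notin> cusp" for t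
  proof -
    obtain T z where "open T" "root_curve z0 t \<in> T" "T \<subseteq> - cusp" "branch T z" "z (root_curve z0 t) = z0"
      using local_branch[OF t root_curve_root] by blast
    then show ?thesis unfolding branch_through_def by blast
  qed
  then obtain \<zeta> where "\<And>t. root_curve z0 t \<notin> cusp \<Longrightarrow> branch_through (\<zeta> t) (root_curve z0 t) z0"
    by metis
  then have "eventually (\<lambda>t. branch_through (\<zeta> t) (root_curve z0 t) z0) (at 0)"
    by (rule eventually_mono[OF eventually_root_curve_off_cusp[OF assms]])
  then show ?thesis by (rule exI[of _ \<zeta>])
qed

text \<open>The factor \<open>0 ^ (N - n)\<close> is 1 for \<open>n = N\<close> and 0 otherwise:
  multiplication by \<open>t ^ N\<close> extracts the leading coefficient of a pole of order
  \<open>N\<close> and removes lower ones.\<close>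

lemma polar_term_tendsto:
  assumes F: "polar_form n G F" and nN: "n \<le> N"
    and q: "((\<lambda>t. q (root_curve z0 t)) \<longlongrightarrow> q0) (at 0)"
    and \<zeta>: "eventually (\<lambda>t. branch_through (\<zeta> t) (root_curve z0 t) z0) (at 0)"
  shows "((\<lambda>t. t ^ N * (q (root_curve z0 t) * F (\<zeta> t) (root_curve z0 t))) \<longlongrightarrow>
    0 ^ (N - n) * (q0 * G (vector [z0, 0]))) (at 0)"
proof -
  have "continuous_on UNIV G"
    by (rule holo_imp_continuous_on[OF polar_form_holo[OF F]])
  then have "((\<lambda>t. G (vector [z0, t])) \<longlongrightarrow> G (vector [z0, 0])) (at 0)"
    by (intro isCont_tendsto_compose[of _ G] tendsto_vector_2 tendsto_intros)
       (simp add: continuous_on_eq_continuous_at)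
  then have "((\<lambda>t. t ^ (N - n) * (q (root_curve z0 t) * G (vector [z0, t]))) \<longlongrightarrow>
      0 ^ (N - n) * (q0 * G (vector [z0, 0]))) (at 0)"
    by (intro tendsto_intros q)
  moreover have "eventually (\<lambda>t. t ^ (N - n) * (q (root_curve z0 t) * G (vector [z0, t]))
      = t ^ N * (q (root_curve z0 t) * F (\<zeta> t) (root_curve z0 t))) (at 0)"
  proof -
    have "eventually (\<lambda>t::complex. t \<noteq> 0) (at 0)"
      by (simp add: eventually_at_filter)
    with \<zeta> show ?thesis
    proof eventually_elim
      case (elim t)
      then obtain W where W: "open W" "W \<subseteq> - cusp" "branch W (\<zeta> t)" "root_curve z0 t \<in> W"
        and z: "\<zeta> t (root_curve z0 t) = z0"
        unfolding branch_through_def by blast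
      have "t ^ N = t ^ (N - n) * t ^ n"
        using nN by (simp flip: power_add)
      then show ?case
        using polar_formD[OF F W] elim(2) by (simp add: root_chart_def z root_curve_fst)
    qed
  qed
  ultimately show ?thesis
    by (rule Lim_transform_eventually)
qed

text \<open>The square box of \<open>dapply_box\<close> also contains indices with
  \<open>a + b > m\<close>. Their coefficients vanish on \<open>U\<close>, so the limit has to be
  known for the remaining ones.\<close>

lemma dapply_tendsto_root_curve:
  assumes U: "open U" "root_curve z0 0 \<in> U" and Q: "Q \<in> diffops U" "order_le U (int m) Q"
    and lim: "\<And>a b. a + b \<le> m \<Longrightarrow> ((\<lambda>t. t ^ N * (Q (a, b) (root_curve z0 t) *
       mdiff (a, b) (F t) (root_curve z0 t))) \<longlongrightarrow> l a b) (at 0)"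
  shows "((\<lambda>t. t ^ N * dapply Q (F t) (root_curve z0 t)) \<longlongrightarrow>
      (\<Sum>a\<le>m. \<Sum>b\<le>m. if a + b \<le> m then l a b else 0)) (at 0)"
proof -
  have evU: "eventually (\<lambda>t. root_curve z0 t \<in> U) (at 0)"
    using tendsto_root_curve U by (rule topological_tendstoD)
  have "((\<lambda>t. t ^ N * (Q (a, b) (root_curve z0 t) * mdiff (a, b) (F t) (root_curve z0 t)))
      \<longlongrightarrow> (if a + b \<le> m then l a b else 0)) (at 0)" for a b
  proof (cases "a + b \<le> m")
    case False
    then have "eventually (\<lambda>t. 0 = t ^ N * (Q (a, b) (root_curve z0 t) * mdiff (a, b) (F t) (root_curve z0 t))) (at 0)"
      by (intro eventually_mono[OF evU]) (simp add: order_leD[OF Q(2)])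
    with False show ?thesis
      by (simp add: Lim_transform_eventually[OF tendsto_const])
  qed (simp add: lim)
  then have "((\<lambda>t. \<Sum>a\<le>m. \<Sum>b\<le>m. t ^ N * (Q (a, b) (root_curve z0 t) * mdiff (a, b) (F t) (root_curve z0 t)))
      \<longlongrightarrow> (\<Sum>a\<le>m. \<Sum>b\<le>m. if a + b \<le> m then l a b else 0)) (at 0)"
    by (intro tendsto_sum)
  moreover have "eventually (\<lambda>t. (\<Sum>a\<le>m. \<Sum>b\<le>m. t ^ N * (Q (a, b) (root_curve z0 t) * mdiff (a, b) (F t) (root_curve z0 t)))
      = t ^ N * dapply Q (F t) (root_curve z0 t)) (at 0)"
    by (rule eventually_mono[OF evU]) (simp add: dapply_box[OF Q(2)] sum_distrib_left)
  ultimately show ?thesis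
    by (rule Lim_transform_eventually)
qed

lemma coeff_tendsto_root_curve:
  assumes "open U" "root_curve z0 0 \<in> U" "Q \<in> diffops U"
  shows "((\<lambda>t. Q \<alpha> (root_curve z0 t)) \<longlongrightarrow> Q \<alpha> (root_curve z0 0)) (at 0)"
proof (rule isCont_tendsto_compose[OF _ tendsto_root_curve])
  have "continuous_on U (Q \<alpha>)"
    by (rule holo_imp_continuous_on[OF diffops_holo[OF assms(3)]])
  then show "isCont (Q \<alpha>) (root_curve z0 0)"
    using assms(1,2) continuous_on_eq_continuous_at by blast
qed

lemma dapply_low_order_tendsto:
  assumes U: "open U" "root_curve z0 0 \<in> U" and Q: "Q \<in> diffops U" "order_le U (int m - 1) Q"
    and m: "m \<ge> 1" and F: "polar_form 0 G F"
    and \<zeta>: "eventually (\<lambda>t. branch_through (\<zeta> t) (root_curve z0 t) z0) (at 0)"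
  shows "((\<lambda>t. t ^ (2 * m - 1) * dapply Q (F (\<zeta> t)) (root_curve z0 t)) \<longlongrightarrow> 0) (at 0)"
proof -
  have Q': "order_le U (int (m - 1)) Q"
    using Q(2) m by (simp add: of_nat_diff)
  have "((\<lambda>t. t ^ (2 * m - 1) * (Q (a, b) (root_curve z0 t) * mdiff (a, b) (F (\<zeta> t)) (root_curve z0 t))) \<longlongrightarrow> 0) (at 0)"
    if ab: "a + b \<le> m - 1" for a b
  proof -
    obtain G' where G': "polar_form (2 * (a + b)) G' (\<lambda>z. mdiff (a, b) (F z))"
      using polar_form_mdiff[OF F] by blast
    have less: "2 * (a + b) < 2 * m - 1" using ab m by arith
    have "(0 :: complex) ^ (2 * m - 1 - 2 * (a + b)) = 0"
      using less by (intro zero_power) simp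
    with polar_term_tendsto[OF G' less_imp_le[OF less] coeff_tendsto_root_curve[OF U Q(1)] \<zeta>]
    show ?thesis by (simp only: mult_zero_left)
  qed
  from dapply_tendsto_root_curve[OF U Q(1) Q', where F = "\<lambda>t. F (\<zeta> t)" and l = "\<lambda>_ _. 0", OF this]
  show ?thesis by simp
qed

text \<open>Derivatives of order less than \<open>m\<close> have poles too weak to count. Those of
  order \<open>m\<close> share the factor \<open>polar_const m * z0 ^ (m - 1)\<close>, and their
  remaining powers of \<open>z0\<close> assemble the symbol at \<open>(z0, 1)\<close>.\<close>

lemma dapply_root_tendsto:
  assumes U: "open U" "root_curve z0 0 \<in> U" and Q: "Q \<in> diffops U" "order_le U (int m) Q"
    and m: "m \<ge> 1"
    and \<zeta>: "eventually (\<lambda>t. branch_through (\<zeta> t) (root_curve z0 t) z0) (at 0)"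
  shows "((\<lambda>t. t ^ (2 * m - 1) * dapply Q (\<zeta> t) (root_curve z0 t)) \<longlongrightarrow>
     polar_const m * z0 ^ (m - 1) * (\<Sum>b\<le>m. Q (m - b, b) (root_curve z0 0) * z0 ^ (m - b))) (at 0)"
proof -
  define l where "l = (\<lambda>a b. if a + b = m then Q (a, b) (root_curve z0 0) * (polar_const m * z0 ^ a * z0 ^ (m - 1)) else 0)"
  have "((\<lambda>t. t ^ (2 * m - 1) * (Q (a, b) (root_curve z0 t) * mdiff (a, b) (\<zeta> t) (root_curve z0 t))) \<longlongrightarrow> l a b) (at 0)"
    if ab: "a + b \<le> m" for a b
  proof (cases "a + b = m")
    case True
    then obtain G where "polar_form (2 * m - 1) G (\<lambda>z. mdiff (a, b) z)"
      "\<And>t. G (vector [t, 0]) = polar_const m * t ^ a * t ^ (m - 1)"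
      using polar_form_mdiff_root[of a b] m by auto
    from polar_term_tendsto[OF this(1) order_refl coeff_tendsto_root_curve[OF U Q(1)] \<zeta>] this(2)
    show ?thesis using True by (simp add: l_def)
  next
    case False
    obtain G' where G': "polar_form (2 * (a + b)) G' (\<lambda>z. mdiff (a, b) z)"
      using polar_form_mdiff[OF polar_form_root] by blast
    have less: "2 * (a + b) < 2 * m - 1" using ab False by arith
    have "(0 :: complex) ^ (2 * m - 1 - 2 * (a + b)) = 0"
      using less by (intro zero_power) simp
    with polar_term_tendsto[OF G' less_imp_le[OF less] coeff_tendsto_root_curve[OF U Q(1)] \<zeta>]
    show ?thesis using False by (simp only: mult_zero_left l_def if_False)
  qed
  from dapply_tendsto_root_curve[OF U Q, where F = \<zeta> and l = l, OF this]
  have "((\<lambda>t. t ^ (2 * m - 1) * dapply Q (\<zeta> t) (root_curve z0 t)) \<longlongrightarrow>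
      (\<Sum>a\<le>m. \<Sum>b\<le>m. if a + b \<le> m then l a b else 0)) (at 0)" .
  also have "(\<Sum>a\<le>m. \<Sum>b\<le>m. if a + b \<le> m then l a b else 0) = (\<Sum>b\<le>m. \<Sum>a\<le>m. if a = m - b then l a b else 0)"
    by (subst sum.swap) (intro sum.cong refl, auto simp: l_def)
  also have "\<dots> = (\<Sum>b\<le>m. l (m - b) b)"
    by (intro sum.cong refl) simp
  also have "\<dots> = polar_const m * z0 ^ (m - 1) * (\<Sum>b\<le>m. Q (m - b, b) (root_curve z0 0) * z0 ^ (m - b))"
    unfolding sum_distrib_left by (intro sum.cong refl) (simp add: l_def mult_ac)
  finally show ?thesis .
qed

text \<open>An equation \<open>P z = B\<^sub>1 z + B\<^sub>2 z\<^sup>2\<close> with \<open>B\<^sub>1\<close>, \<open>B\<^sub>2\<close> of lower order forces the symbol of \<open>P\<close> to vanish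
  at the conormal of the cusp: \<open>m\<close>-th derivatives of \<open>z\<close> have a pole of order \<open>2 m - 1\<close> in \<open>s\<close>.\<close>

lemma symbol_vanishes_on_conormal:
  assumes U: "open U" "root_curve z0 0 \<in> U" and z0: "z0 \<noteq> 0" and m: "m \<ge> 1"
    and P: "P \<in> diffops U" "order_le U (int m) P"
    and B1: "B1 \<in> diffops U" "order_le U (int m - 1) B1"
    and B2: "B2 \<in> diffops U" "order_le U (int m - 1) B2"
    and rel: "\<And>W z y. open W \<Longrightarrow> W \<subseteq> U \<Longrightarrow> W \<subseteq> - cusp \<Longrightarrow> branch W z \<Longrightarrow> y \<in> W \<Longrightarrow>
       dapply P z y = dapply B1 z y + dapply B2 (\<lambda>y. (z y)\<^sup>2) y"
  shows "(\<Sum>b\<le>m. P (m - b, b) (root_curve z0 0) * z0 ^ (m - b)) = 0"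
proof -
  obtain \<zeta> where \<zeta>: "eventually (\<lambda>t. branch_through (\<zeta> t) (root_curve z0 t) z0) (at 0)"
    using ex_branch_along_root_curve[OF z0] by blast
  let ?N = "2 * m - 1" and ?y = "root_curve z0"
  define c where "c = polar_const m * z0 ^ (m - 1) * (\<Sum>b\<le>m. P (m - b, b) (root_curve z0 0) * z0 ^ (m - b))"
  have "((\<lambda>t. t ^ ?N * dapply P (\<zeta> t) (?y t) - t ^ ?N * dapply B1 (\<zeta> t) (?y t)
      - t ^ ?N * dapply B2 (\<lambda>y. (\<zeta> t y)\<^sup>2) (?y t)) \<longlongrightarrow> c - 0 - 0) (at 0)"
    unfolding c_def
    by (intro tendsto_diff dapply_root_tendsto[OF U P m \<zeta>] dapply_low_order_tendsto[OF U B1 m polar_form_root \<zeta>]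
        dapply_low_order_tendsto[OF U B2 m polar_form_root_square \<zeta>])
  moreover have "eventually (\<lambda>t. t ^ ?N * dapply P (\<zeta> t) (?y t) - t ^ ?N * dapply B1 (\<zeta> t) (?y t)
      - t ^ ?N * dapply B2 (\<lambda>y. (\<zeta> t y)\<^sup>2) (?y t) = 0) (at 0)"
  proof -
    have "eventually (\<lambda>t. ?y t \<in> U) (at 0)"
      using tendsto_root_curve U by (rule topological_tendstoD)
    with \<zeta> show ?thesis
    proof eventually_elim
      case (elim t)
      then obtain W where W: "open W" "W \<subseteq> - cusp" "branch W (\<zeta> t)" "?y t \<in> W"
        unfolding branch_through_def by blast
      have "dapply P (\<zeta> t) (?y t) = dapply B1 (\<zeta> t) (?y t) + dapply B2 (\<lambda>y. (\<zeta> t y)\<^sup>2) (?y t)"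
        using W elim(2) U(1) by (intro rel[of "W \<inter> U"]) (auto intro: branch_subset)
      then show ?case by (simp add: algebra_simps)
    qed
  qed
  ultimately have "((\<lambda>t::complex. 0 :: complex) \<longlongrightarrow> c - 0 - 0) (at 0)"
    by (rule Lim_transform_eventually)
  then have "c = 0" by (simp add: tendsto_const_iff)
  then show ?thesis
    using z0 polar_const_nonzero[of m] by (simp add: c_def)
qed

text \<open>Without derivatives there are no poles to compare, but the operator is then
  multiplication by a function. Off the cusp one of the three distinct roots is non-zero, which
  forces that function to vanish; points of the cusp are limits of such points.\<close>

lemma order_zero_vanishes:
  assumes U: "open U" "x0 \<in> U" and P: "P \<in> diffops U" "order_le U 0 P"
    and rel: "\<And>W z y. open W \<Longrightarrow> W \<subseteq> U \<Longrightarrow> W \<subseteq> - cusp \<Longrightarrow> branch W z \<Longrightarrow> y \<in> W \<Longrightarrow> dapply P z y = 0"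
  shows "P (0, 0) x0 = 0"
proof -
  have zero: "P (0, 0) y = 0" if y: "y \<in> U" "y \<notin> cusp" for y
  proof -
    have "\<not> cubic_roots y \<subseteq> {0}"
    proof
      assume "cubic_roots y \<subseteq> {0}"
      then have "card (cubic_roots y) \<le> 1" using card_mono[of "{0}" "cubic_roots y"] by simp
      then show False using card_cubic_roots[OF y(2)] by simp
    qed
    then obtain r where r: "r \<in> cubic_roots y" "r \<noteq> 0" by blast
    obtain T z where T: "open T" "y \<in> T" "T \<subseteq> - cusp" "branch T z" "z y = r"
      using local_branch[OF y(2) r(1)] by blast
    have "dapply P z y = 0"
      using T y(1) U(1) by (intro rel[of "T \<inter> U"]) (auto intro: branch_subset)
    moreover have "dapply P z y = P (0, 0) y * z y"
      using dapply_box[of U 0 P y z] P(2) y(1) by (simp add: atMost_0)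
    ultimately show ?thesis using r(2) T(5) by simp
  qed
  \<comment> \<open>Along this line in the q-direction \<open>Discr\<close> is a non-constant
    quadratic polynomial in \<open>t\<close>, so small \<open>t \<noteq> 0\<close> lead off the
    cusp.\<close>
  define y where "y = (\<lambda>t. vector [x0 $ 1, x0 $ 2 + t] :: complex^2)"
  have x0: "vector [x0 $ 1, x0 $ 2 + 0] = x0"
    unfolding vec_eq_iff forall_2 by simp
  have "(y \<longlongrightarrow> vector [x0 $ 1, x0 $ 2 + 0]) (at 0)"
    unfolding y_def by (intro tendsto_vector_2 tendsto_intros)
  then have lim: "(y \<longlongrightarrow> x0) (at 0)"
    unfolding x0 .
  have D: "Discr (y t) = Discr x0 - 27 * t * (2 * x0 $ 2 + t)" for t
    by (simp add: Discr_def y_def power2_eq_square algebra_simps)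
  have "eventually (\<lambda>t. Discr (y t) \<noteq> 0) (at 0)"
  proof (cases "Discr x0 = 0")
    case False
    have "((\<lambda>t. Discr x0 - 27 * t * (2 * x0 $ 2 + t)) \<longlongrightarrow> Discr x0 - 27 * 0 * (2 * x0 $ 2 + 0)) (at 0)"
      by (intro tendsto_intros)
    then show ?thesis
      unfolding D by (rule tendsto_imp_eventually_ne) (use False in simp)
  next
    case True
    have "eventually (\<lambda>t::complex. t \<notin> {0, - 2 * x0 $ 2}) (at 0)"
    proof (cases "x0 $ 2 = 0")
      case True
      then show ?thesis by (simp add: eventually_at_filter)
    next
      case False
      have "((\<lambda>t::complex. t) \<longlongrightarrow> 0) (at 0)" by (rule tendsto_ident_at)
      then have "eventually (\<lambda>t::complex. t \<noteq> - 2 * x0 $ 2) (at 0)"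
        by (rule tendsto_imp_eventually_ne) (use False in simp)
      moreover have "eventually (\<lambda>t::complex. t \<noteq> 0) (at 0)"
        by (simp add: eventually_at_filter)
      ultimately show ?thesis by eventually_elim simp
    qed
    then show ?thesis
      by eventually_elim (auto simp: D True add_eq_0_iff)
  qed
  moreover have "eventually (\<lambda>t. y t \<in> U) (at 0)"
    using lim U by (rule topological_tendstoD)
  ultimately have ev: "eventually (\<lambda>t. P (0, 0) (y t) = 0) (at 0)"
    by eventually_elim (simp add: zero cusp_def)
  have "((\<lambda>t. P (0, 0) (y t)) \<longlongrightarrow> P (0, 0) x0) (at 0)"
  proof (rule isCont_tendsto_compose[OF _ lim])
    show "isCont (P (0, 0)) x0"
      using holo_imp_continuous_on[OF diffops_holo[OF P(1)]] U continuous_on_eq_continuous_at by blast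
  qed
  from Lim_transform_eventually[OF this ev] show ?thesis
    by (simp add: tendsto_const_iff)
qed

section \<open>The module and its characteristic variety\<close>

abbreviation (input) root_pair :: "(complex^2 \<Rightarrow> complex) \<Rightarrow> 2 \<Rightarrow> complex^2 \<Rightarrow> complex" where
  "root_pair z \<equiv> (\<lambda>j. if j = 1 then z else (\<lambda>y. (z y)\<^sup>2))"

text \<open>The map (A, B) \<mapsto> A z + B z^2 before passage to the quotient. It serves twice: it
  induces the solution, and near the cusp it detects the symbols of annihilating operators.\<close>

definition pairing :: "(2 \<Rightarrow> dop) \<Rightarrow> (complex^2 \<Rightarrow> complex) \<Rightarrow> complex^2 \<Rightarrow> complex" where
  "pairing A z y = (\<Sum>j\<in>UNIV. dapply (A j) (root_pair z j) y)"

lemma holo_root_pair: "branch U z \<Longrightarrow> holo U (root_pair z j)"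
  by (simp add: branch_def holo_power)

lemma holo_pairing: "open U \<Longrightarrow> (\<And>j. A j \<in> diffops U) \<Longrightarrow> branch U z \<Longrightarrow> holo U (pairing A z)"
  unfolding pairing_def[abs_def] by (intro holo_sum holo_dapply holo_root_pair)

lemma pairing_add:
  assumes "open U" "\<And>j. A j \<in> diffops U" "\<And>j. B j \<in> diffops U" "y \<in> U"
  shows "pairing (A + B) z y = pairing A z y + pairing B z y"
proof -
  have "dapply ((A + B) j) f y = dapply (A j) f y + dapply (B j) f y" for j f
    unfolding plus_fun_def[of A B] by (rule dapply_add_op[OF assms(1-3) assms(4)])
  then show ?thesis by (simp add: pairing_def sum.distrib del: plus_fun_apply)
qed

lemma pairing_diff:
  assumes "open U" "\<And>j. A j \<in> diffops U" "\<And>j. B j \<in> diffops U" "y \<in> U"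
  shows "pairing (A - B) z y = pairing A z y - pairing B z y"
proof -
  have "dapply ((A - B) j) f y = dapply (A j) f y - dapply (B j) f y" for j f
    unfolding fun_diff_def[of A B] by (rule dapply_diff_op[OF assms(1-3) assms(4)])
  then show ?thesis by (simp add: pairing_def sum_subtractf del: minus_apply)
qed

lemma pairing_dmul:
  assumes "open U" "P \<in> diffops U" "\<And>j. A j \<in> diffops U" "branch U z" "y \<in> U"
  shows "pairing (\<lambda>j. dmul P (A j)) z y = dapply P (pairing A z) y"
proof -
  have "pairing (\<lambda>j. dmul P (A j)) z y = (\<Sum>j\<in>UNIV. dapply P (dapply (A j) (root_pair z j)) y)"
    unfolding pairing_def
    by (intro sum.cong refl dapply_dmul[OF assms(1,2)] assms(3,5) holo_root_pair[OF assms(4)])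
  also have "\<dots> = dapply P (\<lambda>y. \<Sum>j\<in>UNIV. dapply (A j) (root_pair z j) y) y"
    by (rule dapply_sum[OF assms(1,2) _ assms(5), symmetric])
       (intro holo_dapply assms(1,3) holo_root_pair[OF assms(4)])
  finally show ?thesis by (simp only: pairing_def[abs_def])
qed

section \<open>Representatives of stalks on common neighbourhoods\<close>

lemma dstalkI: "open U \<Longrightarrow> x \<in> U \<Longrightarrow> P \<in> diffops U \<Longrightarrow> P \<in> dstalk x"
  unfolding dstalk_def by blast

lemma dstalk_leI:
  "open U \<Longrightarrow> x \<in> U \<Longrightarrow> P \<in> diffops U \<Longrightarrow> order_le U m P \<Longrightarrow> P \<in> dstalk_le x m"
  unfolding dstalk_le_def by blast

lemma dstalk_common:
  fixes A :: "'i::finite \<Rightarrow> dop"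
  assumes "\<forall>i. A i \<in> dstalk x"
  shows "\<exists>U. open U \<and> x \<in> U \<and> (\<forall>i. A i \<in> diffops U)"
proof -
  have "\<forall>i. \<exists>U. open U \<and> x \<in> U \<and> A i \<in> diffops U"
    using assms unfolding dstalk_def by blast
  then obtain U where U: "\<And>i. open (U i)" "\<And>i. x \<in> U i" "\<And>i. A i \<in> diffops (U i)"
    by metis
  show ?thesis
  proof (intro exI[of _ "\<Inter>i. U i"] conjI allI)
    show "open (\<Inter>i. U i)" using U(1) by (intro open_INT) auto
    show "A i \<in> diffops (\<Inter>i. U i)" for i
      by (rule diffops_subset[OF U(3)]) blast
  qed (use U(2) in auto)
qed

lemma dstalk_le_common:
  fixes A :: "'i::finite \<Rightarrow> dop"
  assumes "\<forall>i. A i \<in> dstalk_le x k"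
  shows "\<exists>U. open U \<and> x \<in> U \<and> (\<forall>i. A i \<in> diffops U) \<and> (\<forall>i. order_le U k (A i))"
proof -
  have "\<forall>i. \<exists>U. open U \<and> x \<in> U \<and> A i \<in> diffops U \<and> order_le U k (A i)"
    using assms unfolding dstalk_le_def by blast
  then obtain U where U: "\<And>i. open (U i)" "\<And>i. x \<in> U i" "\<And>i. A i \<in> diffops (U i)" "\<And>i. order_le (U i) k (A i)"
    by metis
  show ?thesis
  proof (intro exI[of _ "\<Inter>i. U i"] conjI allI)
    show "open (\<Inter>i. U i)" using U(1) by (intro open_INT) auto
    show "A i \<in> diffops (\<Inter>i. U i)" for i
      by (rule diffops_subset[OF U(3)]) blast
    show "order_le (\<Inter>i. U i) k (A i)" for i
      by (rule order_le_mono[OF U(4) _ order_refl]) blast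
  qed (use U(2) in auto)
qed

lemma germ_eq_common:
  fixes A :: "'i::finite \<Rightarrow> dop"
  assumes "\<forall>i. germ_eq x (A i) (B i)"
  shows "\<exists>U. open U \<and> x \<in> U \<and> (\<forall>i \<alpha>. \<forall>y\<in>U. A i \<alpha> y = B i \<alpha> y)"
proof -
  have "\<forall>i. \<exists>U. open U \<and> x \<in> U \<and> (\<forall>\<alpha>. \<forall>y\<in>U. A i \<alpha> y = B i \<alpha> y)"
    using assms unfolding germ_eq_def by blast
  then obtain U where U: "\<And>i. open (U i)" "\<And>i. x \<in> U i" "\<And>i. \<forall>\<alpha>. \<forall>y\<in>U i. A i \<alpha> y = B i \<alpha> y"
    by metis
  show ?thesis
  proof (intro exI[of _ "\<Inter>i. U i"] conjI allI)
    show "open (\<Inter>i. U i)" using U(1) by (intro open_INT) auto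
  qed (use U(2,3) in auto)
qed

lemma germ_eq_refl: "germ_eq x P P"
  unfolding germ_eq_def by blast

lemma dmul_zero_left [simp]: "dmul 0 Q = 0"
  by (rule ext) (simp add: dmul_def split_beta zero_fun_def)

lemma phi_eq_sum: "phi R Q j = (\<Sum>i\<in>UNIV. dmul (Q i) (R (fst i) (snd i) j))"
  by (simp add: phi_def split_beta)

text \<open>With \<open>\<xi>\<^sub>1 = 1\<close> the symbol is a polynomial in
  \<open>\<xi>\<^sub>2\<close>, and a polynomial function determines its coefficients.\<close>

lemma coeff_eq_of_symbol_eq:
  assumes "\<And>w. base w = x \<Longrightarrow> symbol m P w = symbol m Q w" "a + b = m"
  shows "P (a, b) x = Q (a, b) x"
proof -
  have "(\<Sum>b\<le>m. P (m - b, b) x * t ^ b) = (\<Sum>b\<le>m. Q (m - b, b) x * t ^ b)" for t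
  proof -
    define w :: "complex^4" where "w = (\<chi> i. if i = 1 then x $ 1 else if i = 2 then x $ 2 else if i = 3 then 1 else t)"
    have w: "w $ 1 = x $ 1" "w $ 2 = x $ 2" "w $ 3 = 1" "w $ 4 = t"
      by (simp_all add: w_def)
    have b: "base w = x"
      unfolding vec_eq_iff forall_2 base_def by (simp add: w)
    show ?thesis
      using assms(1)[OF b] by (simp add: symbol_def b w)
  qed
  then have "\<forall>b\<le>m. P (m - b, b) x = Q (m - b, b) x"
    using polyfun_eq_coeffs[where n = m and c = "\<lambda>b. P (m - b, b) x" and d = "\<lambda>b. Q (m - b, b) x"] by blast
  then show ?thesis using assms(2) by (metis add_diff_cancel_right' le_add2)
qed

lemma sum_flip_atMost: "(\<Sum>i\<le>n. f i) = (\<Sum>i\<le>n. f (n - i))" for n :: nat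
  by (rule sum.reindex_bij_witness[of _ "\<lambda>i. n - i" "\<lambda>i. n - i"]) auto

lemma sum_flip_atMost2: "(\<Sum>a\<le>c. \<Sum>b\<le>d. F a b) = (\<Sum>a\<le>c. \<Sum>b\<le>d. F (c - a) (d - b))" for c d :: nat
proof -
  have "(\<Sum>a\<le>c. \<Sum>b\<le>d. F a b) = (\<Sum>a\<le>c. \<Sum>b\<le>d. F (c - a) b)"
    by (rule sum_flip_atMost)
  also have "\<dots> = (\<Sum>a\<le>c. \<Sum>b\<le>d. F (c - a) (d - b))"
    by (rule sum.cong[OF refl sum_flip_atMost])
  finally show ?thesis .
qed

section \<open>Upper bound for the characteristic variety\<close>

locale cusp_system =
  fixes D :: "(complex^2) set" and R :: "3 \<Rightarrow> 2 \<Rightarrow> 2 \<Rightarrow> dop"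
  assumes open_D: "open D"
    and R_diffops: "\<And>k i j. R k i j \<in> diffops D"
    and R_off_diagonal: "\<And>k i j. i \<noteq> j \<Longrightarrow> order_le D (int (deg_P k) - 1) (R k i j)"
    and R_diagonal: "\<And>k i. order_le D (int (deg_P k)) (R k i i)"
    and R_symbol: "\<And>k i w. w \<in> cotangent D \<Longrightarrow> symbol (deg_P k) (R k i i) w = sym_P k w"
    and R_solution: "\<And>k i W z x. \<lbrakk>open W; W \<subseteq> D; branch W z; x \<in> W\<rbrakk> \<Longrightarrow>
           dapply (R k i 1) z x + dapply (R k i 2) (\<lambda>y. (z y)^2) x = 0"
begin

lemma R_order: "order_le D (int (deg_P k)) (R k i j)"
proof (cases "i = j")
  case True
  then show ?thesis using R_diagonal by simp
next
  case False
  show ?thesis by (rule order_le_mono[OF R_off_diagonal[OF False]]) simp_all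
qed

lemma phi_diffops:
  assumes "open U" "U \<subseteq> D" "\<And>i. Q i \<in> diffops U"
  shows "phi R Q j \<in> diffops U"
  unfolding phi_eq_sum
  by (intro diffops_sum diffops_dmul assms(1,3) diffops_subset[OF R_diffops assms(2)])

text \<open>Property (3) says that every row of each matrix \<open>R k\<close> pairs to 0 with (z,
  z^2), and the pairing is linear over the differential operators.\<close>

lemma pairing_phi:
  assumes W: "open W" "W \<subseteq> D" "\<And>i. Q i \<in> diffops W" "branch W z" "y \<in> W"
  shows "pairing (phi R Q) z y = 0"
proof -
  note RW = diffops_subset[OF R_diffops W(2)]
  have "pairing (phi R Q) z y = (\<Sum>j\<in>UNIV. \<Sum>i\<in>UNIV. dapply (dmul (Q i) (R (fst i) (snd i) j)) (root_pair z j) y)"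
    unfolding pairing_def phi_eq_sum
    by (intro sum.cong refl dapply_sum_op[OF W(1,5)] diffops_dmul W(1,3) RW)
  also have "\<dots> = (\<Sum>i\<in>UNIV. pairing (\<lambda>j. dmul (Q i) (R (fst i) (snd i) j)) z y)"
    unfolding pairing_def by (rule sum.swap)
  also have "\<dots> = (\<Sum>i\<in>UNIV. dapply (Q i) (pairing (R (fst i) (snd i)) z) y)"
    by (intro sum.cong refl pairing_dmul[OF W(1)] W RW)
  also have "\<dots> = (\<Sum>i\<in>(UNIV :: (3 \<times> 2) set). 0)"
  proof (intro sum.cong refl)
    fix i
    have "pairing (R (fst i) (snd i)) z y' = 0" if "y' \<in> W" for y'
      using R_solution[OF W(1,2,4) that, of "fst i" "snd i"] by (simp add: pairing_def sum_2)
    then have "dapply (Q i) (pairing (R (fst i) (snd i)) z) y = dapply (Q i) (\<lambda>y. 0) y"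
      by (rule dapply_cong[OF W(1) _ W(5)])
    then show "dapply (Q i) (pairing (R (fst i) (snd i)) z) y = 0" by simp
  qed
  finally show ?thesis by simp
qed

text \<open>Spreads the stalk relation over a neighbourhood and to all branches on its open subsets.
  This matters for \<open>x\<close> on the cusp, since the branches to which it is applied live near
  \<open>x\<close> but off the cusp.\<close>

lemma pairing_module:
  assumes "A \<in> module_M R x" "x \<in> D"
  shows "\<exists>U. open U \<and> x \<in> U \<and> U \<subseteq> D \<and> (\<forall>j. A j \<in> diffops U) \<and>
    (\<forall>W z y. open W \<longrightarrow> W \<subseteq> U \<longrightarrow> branch W z \<longrightarrow> y \<in> W \<longrightarrow> pairing A z y = 0)"
proof -
  obtain Q where A: "\<forall>j. A j \<in> dstalk x" and Q: "\<forall>i. Q i \<in> dstalk x" "\<forall>j. germ_eq x (A j) (phi R Q j)"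
    using assms(1) unfolding module_M_def by blast
  obtain U1 where U1: "open U1" "x \<in> U1" "\<And>j. A j \<in> diffops U1"
    using dstalk_common[OF A] by blast
  obtain U2 where U2: "open U2" "x \<in> U2" "\<And>i. Q i \<in> diffops U2"
    using dstalk_common[OF Q(1)] by blast
  obtain U3 where U3: "open U3" "x \<in> U3" "\<And>j \<alpha> y. y \<in> U3 \<Longrightarrow> A j \<alpha> y = phi R Q j \<alpha> y"
    using germ_eq_common[OF Q(2)] by blast
  define U where "U = D \<inter> U1 \<inter> U2 \<inter> U3"
  show ?thesis
  proof (intro exI[of _ U] conjI allI impI)
    show "open U" unfolding U_def by (intro open_Int open_D U1(1) U2(1) U3(1))
    show "x \<in> U" unfolding U_def using assms(2) U1(2) U2(2) U3(2) by blast
    show "U \<subseteq> D" unfolding U_def by blast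
    show "A j \<in> diffops U" for j
      by (rule diffops_subset[OF U1(3)]) (auto simp: U_def)
    fix W z y assume W: "open W" "W \<subseteq> U" "branch W z" "y \<in> W"
    have "W \<subseteq> U2" "W \<subseteq> D" "y \<in> U3" using W(2,4) by (auto simp: U_def)
    have "pairing A z y = pairing (phi R Q) z y"
      unfolding pairing_def by (intro sum.cong refl dapply_op_cong U3(3) \<open>y \<in> U3\<close>)
    also have "\<dots> = 0"
      by (rule pairing_phi[OF W(1) \<open>W \<subseteq> D\<close> diffops_subset[OF U2(3) \<open>W \<subseteq> U2\<close>] W(3,4)])
    finally show "pairing A z y = 0" .
  qed
qed

text \<open>In degree \<open>deg_P k\<close> the coefficients are those of the common symbol, above
  it they are 0. So in a top-degree convolution all diagonal entries may be replaced by
  \<open>R k 1 1\<close>.\<close>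

lemma R_diagonal_coeff:
  assumes "x \<in> D" "deg_P k \<le> a + b"
  shows "R k i i (a, b) x = R k 1 1 (a, b) x"
proof (cases "a + b = deg_P k")
  case True
  have "symbol (deg_P k) (R k i i) w = symbol (deg_P k) (R k 1 1) w" if "base w = x" for w
  proof -
    have "w \<in> cotangent D" using that assms(1) by (simp add: cotangent_def)
    then show ?thesis by (simp only: R_symbol)
  qed
  then show ?thesis
    by (rule coeff_eq_of_symbol_eq[OF _ True])
next
  case False
  then have less: "int (deg_P k) < int (a + b)" using assms(2) by simp
  show ?thesis
    unfolding order_leD[OF R_diagonal less assms(1)] by (rule refl)
qed

lemma annihilates_gr_R:
  assumes x: "x \<in> D"
  shows "annihilates_gr (module_M R) x (deg_P k) (R k 1 1)"
  unfolding annihilates_gr_def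
proof (intro conjI allI impI)
  define m where "m = deg_P k"
  show "R k 1 1 \<in> dstalk_le x (int (deg_P k))"
    by (rule dstalk_leI[OF open_D x R_diffops R_diagonal])
  fix \<kappa> :: int and A :: "2 \<Rightarrow> dop" assume A: "\<forall>j. A j \<in> dstalk_le x \<kappa>"
  obtain U0 where U0: "open U0" "x \<in> U0" "\<And>j. A j \<in> diffops U0" "\<And>j. order_le U0 \<kappa> (A j)"
    using dstalk_le_common[OF A] by blast
  define U where "U = U0 \<inter> D"
  have U: "open U" "x \<in> U" "U \<subseteq> D" "\<And>j. A j \<in> diffops U" "\<And>j. order_le U \<kappa> (A j)"
    unfolding U_def using U0(1,2) open_D x
    by (auto intro!: diffops_subset[OF U0(3)] order_le_mono[OF U0(4)])
  have RU: "R k i j \<in> diffops U" "order_le U (int m) (R k i j)" for i j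
    unfolding m_def by (rule diffops_subset[OF R_diffops U(3)], rule order_le_mono[OF R_order U(3) order_refl])
  \<comment> \<open>With \<open>A\<close> placed in the \<open>k\<close>-th block,
    \<open>phi R Q\<close> is the row vector \<open>A\<close> times the matrix \<open>R k\<close>,
    an element of the image to be compared with \<open>R k 1 1\<close> acting on
    \<open>A\<close>.\<close>
  define Q :: "3 \<times> 2 \<Rightarrow> dop" where "Q = (\<lambda>i. if fst i = k then A (snd i) else 0)"
  have QU: "Q i \<in> diffops U" for i
    by (simp add: Q_def U(4))
  have phi: "phi R Q j = dmul (A 1) (R k 1 j) + dmul (A 2) (R k 2 j)" for j
  proof -
    have "phi R Q j = (\<Sum>i\<in>(\<lambda>l. (k, l)) ` UNIV. dmul (Q i) (R (fst i) (snd i) j))"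
      unfolding phi_eq_sum
      by (rule sum.mono_neutral_right) (auto simp: Q_def image_iff)
    also have "\<dots> = (\<Sum>l\<in>UNIV. dmul (A l) (R k l j))"
      by (subst sum.reindex) (auto simp: inj_on_def Q_def)
    finally show ?thesis by (simp only: sum_2)
  qed
  define B where "B = (\<lambda>j. dmul (R k 1 1) (A j) - phi R Q j)"
  show "\<exists>B. (\<forall>j. B j \<in> dstalk_le x (int (deg_P k) + \<kappa> - 1)) \<and> (\<lambda>j. dmul (R k 1 1) (A j)) - B \<in> module_M R x"
  proof (intro exI[of _ B] conjI allI)
    have "(\<lambda>j. dmul (R k 1 1) (A j)) - B = phi R Q"
      by (simp add: B_def fun_eq_iff)
    moreover have "phi R Q \<in> module_M R x"
      unfolding module_M_def mem_Collect_eq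
      by (intro conjI exI[of _ Q] allI germ_eq_refl dstalkI[OF U(1,2)] phi_diffops[OF U(1,3)] QU)
    ultimately show "(\<lambda>j. dmul (R k 1 1) (A j)) - B \<in> module_M R x" by simp
    fix j
    have BU: "B j \<in> diffops U"
      unfolding B_def by (intro diffops_diff U(1) diffops_dmul RU U(4) phi_diffops U(3) QU)
    \<comment> \<open>\<kappa> is an integer and possibly negative, whereas expanding a product
      needs a natural bound for the order; it is taken from local finiteness.\<close>
    obtain V n where V: "open V" "x \<in> V" "V \<subseteq> U" "order_le V (int n) (A 1)"
      using diffops_local[OF U(1) U(4)[of 1] U(2)] by metis
    obtain V' n' where V': "open V'" "x \<in> V'" "V' \<subseteq> U" "order_le V' (int n') (A 2)"
      using diffops_local[OF U(1) U(4)[of 2] U(2)] by metis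
    define T where "T = V \<inter> V'"
    define N where "N = max n n'"
    have T: "open T" "x \<in> T" "T \<subseteq> U"
      using V V' by (auto simp: T_def)
    have TN: "order_le T (int N) (A i)" for i
    proof -
      have "order_le T (int N) (A 1)"
        by (rule order_le_mono[OF V(4)]) (auto simp: T_def N_def)
      moreover have "order_le T (int N) (A 2)"
        by (rule order_le_mono[OF V'(4)]) (auto simp: T_def N_def)
      ultimately show ?thesis using exhaust_2[of i] by blast
    qed
    note AT = order_le_mono[OF U(5) T(3) order_refl]
    note RT = order_le_mono[OF RU(2) T(3) order_refl]
    have off: "order_le T (\<kappa> + (int m - 1)) (dmul (A i) (R k i j))" if "i \<noteq> j" for i
    proof (rule order_le_dmul[OF T(1) TN AT])
      have "T \<subseteq> D" using T(3) U(3) by blast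
      then show "order_le T (int m - 1) (R k i j)"
        unfolding m_def by (rule order_le_mono[OF R_off_diagonal[OF that] _ order_refl])
    qed
    have diag: "order_le T (int m + \<kappa> - 1) (dmul (R k 1 1) (A j) - dmul (A j) (R k j j))"
      unfolding order_le_def
    proof (intro allI impI ballI)
      fix c d y assume cd: "int m + \<kappa> - 1 < int (c + d)" and y: "y \<in> T"
      have yD: "y \<in> D" using y T(3) U(3) by blast
      show "(dmul (R k 1 1) (A j) - dmul (A j) (R k j j)) (c, d) y = 0"
      proof (cases "int (c + d) = int m + \<kappa>")
        case True
        have "dmul (A j) (R k j j) (c, d) y = (\<Sum>a\<le>c. \<Sum>b\<le>d. A j (a, b) y * R k j j (c - a, d - b) y)"
          by (rule dmul_top[OF T(1) TN AT RT y]) (use True in simp)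
        also have "\<dots> = (\<Sum>a\<le>c. \<Sum>b\<le>d. A j (a, b) y * R k 1 1 (c - a, d - b) y)"
        proof (intro sum.cong refl)
          fix a b assume ab: "a \<in> {..c}" "b \<in> {..d}"
          show "A j (a, b) y * R k j j (c - a, d - b) y = A j (a, b) y * R k 1 1 (c - a, d - b) y"
          \<comment> \<open>If the index of \<open>R\<close> has degree below
            \<open>deg_P k\<close>, the index of \<open>A j\<close> has degree above \<kappa>, since
            the total is \<open>m + \<kappa>\<close>, and the summand vanishes.\<close>
          proof (cases "deg_P k \<le> (c - a) + (d - b)")
            case False
            then have "\<kappa> < int (a + b)" using ab True by (simp add: m_def)
            then show ?thesis using order_leD[OF AT _ y] by simp
          next
            case True
            then show ?thesis by (simp only: R_diagonal_coeff[OF yD, of _ _ _ j])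
          qed
        qed
        \<comment> \<open>Reversing both indices exchanges the factors of the convolution: symbols
          commute, so the difference of the two products drops by one order.\<close>
        also have "\<dots> = (\<Sum>a\<le>c. \<Sum>b\<le>d. R k 1 1 (a, b) y * A j (c - a, d - b) y)"
        proof -
          have "(\<Sum>a\<le>c. \<Sum>b\<le>d. A j (a, b) y * R k 1 1 (c - a, d - b) y)
              = (\<Sum>a\<le>c. \<Sum>b\<le>d. A j (c - a, d - b) y * R k 1 1 (c - (c - a), d - (d - b)) y)"
            by (rule sum_flip_atMost2)
          also have "\<dots> = (\<Sum>a\<le>c. \<Sum>b\<le>d. R k 1 1 (a, b) y * A j (c - a, d - b) y)"
            by (intro sum.cong refl) simp
          finally show ?thesis .
        qed
        also have "\<dots> = dmul (R k 1 1) (A j) (c, d) y"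
          by (rule dmul_top[OF T(1) RT RT AT y True, symmetric])
        finally show ?thesis by simp
      next
        case False
        then have "int m + \<kappa> < int (c + d)" "\<kappa> + int m < int (c + d)" using cd by linarith+
        then show ?thesis
          using order_leD[OF order_le_dmul[OF T(1) RT RT AT] _ y] order_leD[OF order_le_dmul[OF T(1) TN AT RT] _ y] by simp
      qed
    qed
    have "order_le T (int m + \<kappa> - 1) (B j)"
    proof (cases "j = 1")
      case True
      have e: "B j = (dmul (R k 1 1) (A j) - dmul (A j) (R k j j)) - dmul (A 2) (R k 2 j)"
        unfolding B_def phi True by (simp only: diff_diff_eq)
      show ?thesis
        unfolding e by (rule order_le_diff[OF diag]) (use off[of 2] True in \<open>simp add: algebra_simps\<close>)
    next
      case False
      then have j: "j = 2" using exhaust_2 by blast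
      have e: "B j = (dmul (R k 1 1) (A j) - dmul (A j) (R k j j)) - dmul (A 1) (R k 1 j)"
        unfolding B_def phi j by (simp only: diff_diff_eq add.commute)
      show ?thesis
        unfolding e by (rule order_le_diff[OF diag]) (use off[of 1] j in \<open>simp add: algebra_simps\<close>)
    qed
    then show "B j \<in> dstalk_le x (int (deg_P k) + \<kappa> - 1)"
      unfolding m_def by (rule dstalk_leI[OF T(1,2) diffops_subset[OF BU T(3)]])
  qed
qed

lemma characteristic_variety_subset:
  "characteristic_variety D (module_M R) \<subseteq> {w \<in> cotangent D. \<forall>k. sym_P k w = 0}"
proof
  fix w assume w: "w \<in> characteristic_variety D (module_M R)"
  then have "w \<in> cotangent D" by (simp add: characteristic_variety_def)
  moreover have "sym_P k w = 0" for k
  proof -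
    have "annihilates_gr (module_M R) (base w) (deg_P k) (R k 1 1)"
      using \<open>w \<in> cotangent D\<close> by (intro annihilates_gr_R) (simp add: cotangent_def)
    then have "symbol (deg_P k) (R k 1 1) w = 0"
      using w unfolding characteristic_variety_def by blast
    then show ?thesis using R_symbol[OF \<open>w \<in> cotangent D\<close>] by simp
  qed
  ultimately show "w \<in> {w \<in> cotangent D. \<forall>k. sym_P k w = 0}" by blast
qed

end

section \<open>Lower bound for the characteristic variety\<close>

definition unit_op :: dop where
  "unit_op = (\<lambda>\<alpha> y. if \<alpha> = (0, 0) then 1 else 0)"

lemma dapply_unit_op: "dapply unit_op f y = f y"
proof -
  have "{\<alpha>. unit_op \<alpha> y \<noteq> 0} = {(0, 0)}"
    by (auto simp: unit_op_def split: if_splits)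
  then show ?thesis
    by (simp add: dapply_def unit_op_def)
qed

lemma order_le_unit_op: "order_le U 0 unit_op"
  by (simp add: order_le_def unit_op_def)

lemma order_le_zero: "order_le U m 0"
  by (simp add: order_le_def zero_fun_def)

lemma unit_op_diffops: "unit_op \<in> diffops U"
proof (rule diffopsI)
  show "holo U (unit_op \<alpha>)" for \<alpha>
    by (cases "\<alpha> = (0, 0)") (simp_all add: unit_op_def)
  show "\<exists>V n. open V \<and> x \<in> V \<and> order_le V (int n) unit_op" for x
    using order_le_unit_op[of UNIV] by (intro exI[of _ UNIV] exI[of _ 0]) simp
qed

lemma base_nth: "base w $ 1 = w $ 1" "base w $ 2 = w $ 2"
  by (simp_all add: base_def)

lemma base_eq_iff: "base w = x \<longleftrightarrow> w $ 1 = x $ 1 \<and> w $ 2 = x $ 2"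
  by (simp add: vec_eq_iff forall_2 base_nth)

lemma base_eq_root_curve_iff: "base w = root_curve z 0 \<longleftrightarrow> w $ 1 = 3 * z\<^sup>2 \<and> w $ 2 = - 2 * z ^ 3"
  by (simp add: base_eq_iff root_curve_def)

lemma sym_P_simps:
  "sym_P 1 w = w $ 1 / 3 * (w $ 4)\<^sup>2 - (w $ 3)\<^sup>2"
  "sym_P 2 w = w $ 2 / 2 * (w $ 4) ^ 3 + (w $ 3) ^ 3"
  "sym_P 3 w = (4 * (w $ 1) ^ 3 - 27 * (w $ 2)\<^sup>2) * (w $ 3)\<^sup>2"
  by (simp_all add: sym_P_def)

text \<open>Where \<open>\<xi>\<^sub>2\<close> is non-zero, the parameter of the conormal is the
  ratio z = \<open>\<xi>\<^sub>1 / \<xi>\<^sub>2\<close>, and \<open>P\<^sub>1\<close>,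
  \<open>P\<^sub>2\<close> give p = 3 z^2 and q = -2 z^3. Where \<open>\<xi>\<^sub>2\<close> is 0,
  \<open>P\<^sub>1\<close> forces \<open>\<xi>\<^sub>1 = 0\<close>.\<close>

lemma sym_P_zero_iff:
  "(\<forall>k. sym_P k w = 0) \<longleftrightarrow>
     w $ 3 = 0 \<and> w $ 4 = 0 \<or> (\<exists>z l. base w = root_curve z 0 \<and> w $ 3 = z * l \<and> w $ 4 = l)"
proof
  assume "\<forall>k. sym_P k w = 0"
  then have P: "w $ 1 / 3 * (w $ 4)\<^sup>2 - (w $ 3)\<^sup>2 = 0" "w $ 2 / 2 * (w $ 4) ^ 3 + (w $ 3) ^ 3 = 0"
    using sym_P_simps by metis+
  show "w $ 3 = 0 \<and> w $ 4 = 0 \<or> (\<exists>z l. base w = root_curve z 0 \<and> w $ 3 = z * l \<and> w $ 4 = l)"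
  proof (cases "w $ 4 = 0")
    case True
    then show ?thesis using P(1) by simp
  next
    case False
    define z where "z = w $ 3 / w $ 4"
    have z: "w $ 3 = z * w $ 4" using False by (simp add: z_def)
    have "(w $ 1 - 3 * z\<^sup>2) * (w $ 4)\<^sup>2 = 0"
      using P(1) unfolding z by (simp add: field_simps)
    then have "w $ 1 = 3 * z\<^sup>2" using False by simp
    moreover have "(w $ 2 + 2 * z ^ 3) * (w $ 4) ^ 3 = 0"
      using P(2) unfolding z by (simp add: field_simps)
    then have "w $ 2 = - 2 * z ^ 3" using False by (simp add: eq_neg_iff_add_eq_0)
    ultimately have "base w = root_curve z 0"
      unfolding base_eq_root_curve_iff by simp
    then show ?thesis using z by blast
  qed
next
  assume "w $ 3 = 0 \<and> w $ 4 = 0 \<or> (\<exists>z l. base w = root_curve z 0 \<and> w $ 3 = z * l \<and> w $ 4 = l)"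
  then show "\<forall>k. sym_P k w = 0"
  proof (elim disjE exE)
    assume "w $ 3 = 0 \<and> w $ 4 = 0"
    then show ?thesis by (simp add: forall_3 sym_P_simps)
  next
    fix z l assume "base w = root_curve z 0 \<and> w $ 3 = z * l \<and> w $ 4 = l"
    then have "w $ 1 = 3 * z\<^sup>2" "w $ 2 = - 2 * z ^ 3" "w $ 3 = z * l" "w $ 4 = l"
      by (simp_all add: base_eq_root_curve_iff)
    then show ?thesis
      unfolding forall_3 sym_P_simps by (simp add: power2_eq_square power3_eq_cube)
  qed
qed

text \<open>Homogeneity moves the covector (z l, l) to (z, 1), the form in which the pole argument
  delivers the symbol.\<close>

lemma symbol_on_conormal:
  assumes "base w = x" "w $ 3 = z * l" "w $ 4 = l"
  shows "symbol m P w = l ^ m * (\<Sum>b\<le>m. P (m - b, b) x * z ^ (m - b))"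
proof -
  have "symbol m P w = (\<Sum>b\<le>m. P (m - b, b) x * (z * l) ^ (m - b) * l ^ b)"
    by (simp add: symbol_def assms)
  also have "\<dots> = (\<Sum>b\<le>m. l ^ m * (P (m - b, b) x * z ^ (m - b)))"
  proof (rule sum.cong[OF refl])
    fix b assume "b \<in> {..m}"
    then have "l ^ m = l ^ (m - b) * l ^ b" by (simp flip: power_add)
    then show "P (m - b, b) x * (z * l) ^ (m - b) * l ^ b = l ^ m * (P (m - b, b) x * z ^ (m - b))"
      by (simp add: power_mult_distrib mult_ac)
  qed
  finally show ?thesis by (simp add: sum_distrib_left)
qed

lemma symbol_on_zero_section:
  assumes "w $ 3 = 0" "w $ 4 = 0" "m \<ge> 1"
  shows "symbol m P w = 0"
  using symbol_on_conormal[OF refl, of w 0 0 m P] assms by simp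

context cusp_system
begin

text \<open>The operator is tested on the generator (1, 0), which has order 0 and pairs with a
  branch to z itself. Its image under \<open>P\<close> is some \<open>B\<close> of order at most
  \<open>m - 1\<close> plus an element of \<open>module_M R x\<close>, and the latter pairs to
  0.\<close>

lemma annihilates_relation:
  assumes ann: "annihilates_gr (module_M R) x m P" and x: "x \<in> D"
  shows "\<exists>U B. open U \<and> x \<in> U \<and> U \<subseteq> D \<and> P \<in> diffops U \<and> order_le U (int m) P \<and>
    (\<forall>j. B j \<in> diffops U) \<and> (\<forall>j. order_le U (int m - 1) (B j)) \<and>
    (\<forall>W z y. open W \<longrightarrow> W \<subseteq> U \<longrightarrow> branch W z \<longrightarrow> y \<in> W \<longrightarrow>
       dapply P z y = dapply (B (1::2)) z y + dapply (B 2) (\<lambda>y. (z y)\<^sup>2) y)"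
proof -
  define A :: "2 \<Rightarrow> dop" where "A = (\<lambda>j. if j = 1 then unit_op else 0)"
  have Ad: "A j \<in> diffops U" for j U
    by (simp add: A_def unit_op_diffops)
  have "A j \<in> dstalk_le x 0" for j
    by (rule dstalk_leI[OF open_UNIV UNIV_I Ad]) (simp add: A_def order_le_unit_op order_le_zero)
  then have "\<exists>B. (\<forall>j. B j \<in> dstalk_le x (int m + 0 - 1)) \<and> (\<lambda>j. dmul P (A j)) - B \<in> module_M R x"
    using ann unfolding annihilates_gr_def by blast
  then obtain B where B: "\<forall>j. B j \<in> dstalk_le x (int m - 1)" "(\<lambda>j. dmul P (A j)) - B \<in> module_M R x"
    by auto
  obtain U1 where U1: "open U1" "x \<in> U1" "U1 \<subseteq> D"
    and zero: "\<And>W z y. open W \<Longrightarrow> W \<subseteq> U1 \<Longrightarrow> branch W z \<Longrightarrow> y \<in> W \<Longrightarrow> pairing ((\<lambda>j. dmul P (A j)) - B) z y = 0"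
    using pairing_module[OF B(2) x] by blast
  obtain U2 where U2: "open U2" "x \<in> U2" "\<And>j. B j \<in> diffops U2" "\<And>j. order_le U2 (int m - 1) (B j)"
    using dstalk_le_common[OF B(1)] by blast
  obtain U3 where U3: "open U3" "x \<in> U3" "P \<in> diffops U3" "order_le U3 (int m) P"
    using ann unfolding annihilates_gr_def dstalk_le_def by blast
  define U where "U = U1 \<inter> U2 \<inter> U3"
  have sub: "U \<subseteq> U1" "U \<subseteq> U2" "U \<subseteq> U3" by (auto simp: U_def)
  show ?thesis
  proof (intro exI[of _ U] exI[of _ B] conjI allI impI)
    show "open U" unfolding U_def by (intro open_Int U1(1) U2(1) U3(1))
    show "x \<in> U" unfolding U_def using U1(2) U2(2) U3(2) by blast
    show "U \<subseteq> D" using sub(1) U1(3) by blast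
    show "P \<in> diffops U" by (rule diffops_subset[OF U3(3) sub(3)])
    show "order_le U (int m) P" by (rule order_le_mono[OF U3(4) sub(3) order_refl])
    show "B j \<in> diffops U" for j by (rule diffops_subset[OF U2(3) sub(2)])
    show "order_le U (int m - 1) (B j)" for j by (rule order_le_mono[OF U2(4) sub(2) order_refl])
    fix W z y assume W: "open W" "W \<subseteq> U" "branch W z" "y \<in> W"
    have W1: "W \<subseteq> U1" and W2: "W \<subseteq> U2" and W3: "W \<subseteq> U3" using W(2) sub by blast+
    note PW = diffops_subset[OF U3(3) W3] and BW = diffops_subset[OF U2(3) W2]
    have pA: "pairing A z = z"
      by (rule ext) (simp add: pairing_def sum_2 A_def dapply_unit_op)
    have "0 = pairing ((\<lambda>j. dmul P (A j)) - B) z y"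
      using zero[OF W(1) W1 W(3,4)] by simp
    also have "\<dots> = pairing (\<lambda>j. dmul P (A j)) z y - pairing B z y"
      by (rule pairing_diff[OF W(1) diffops_dmul[OF W(1) PW Ad] BW W(4)])
    also have "pairing (\<lambda>j. dmul P (A j)) z y = dapply P (pairing A z) y"
      by (rule pairing_dmul[OF W(1) PW Ad W(3,4)])
    finally show "dapply P z y = dapply (B 1) z y + dapply (B 2) (\<lambda>y. (z y)\<^sup>2) y"
      unfolding pA by (simp add: pairing_def sum_2)
  qed
qed

lemma annihilator_order_zero:
  assumes "annihilates_gr (module_M R) x 0 P" "x \<in> D"
  shows "P (0, 0) x = 0"
proof -
  obtain U B where U: "open U" "x \<in> U" "P \<in> diffops U" "order_le U (int 0) P"
    and B: "\<forall>j. order_le U (int 0 - 1) (B (j::2))"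
    and rel: "\<forall>W z y. open W \<longrightarrow> W \<subseteq> U \<longrightarrow> branch W z \<longrightarrow> y \<in> W \<longrightarrow>
       dapply P z y = dapply (B 1) z y + dapply (B 2) (\<lambda>y. (z y)\<^sup>2) y"
    using annihilates_relation[OF assms] by (elim exE conjE)
  \<comment> \<open>For \<open>m = 0\<close> the bound is -1, so \<open>B\<close> is the zero
    operator and the relation reads P z = 0.\<close>
  have "B j \<alpha> y = 0" if "y \<in> U" for j \<alpha> y
    using order_leD[OF B[rule_format, of j] _ that, of "fst \<alpha>" "snd \<alpha>"] by simp
  then have zero: "dapply (B j) f y = 0" if "y \<in> U" for j f y
    using that by (simp add: dapply_def)
  show ?thesis
  proof (rule order_zero_vanishes[OF U(1-3)])
    show "order_le U 0 P" using U(4) by simp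
    fix W z y assume W: "open W" "W \<subseteq> U" "branch W z" "y \<in> W"
    then have "y \<in> U" by blast
    then show "dapply P z y = 0"
      using rel[rule_format, OF W] zero by simp
  qed
qed

lemma annihilator_on_conormal:
  assumes ann: "annihilates_gr (module_M R) (root_curve z0 0) m P" and x: "root_curve z0 0 \<in> D" and m: "m \<ge> 1"
  shows "(\<Sum>b\<le>m. P (m - b, b) (root_curve z0 0) * z0 ^ (m - b)) = 0"
proof -
  obtain U B where U: "open U" "root_curve z0 0 \<in> U" "P \<in> diffops U" "order_le U (int m) P"
    and B: "\<forall>j. B j \<in> diffops U" "\<forall>j. order_le U (int m - 1) (B (j::2))"
    and rel: "\<forall>W z y. open W \<longrightarrow> W \<subseteq> U \<longrightarrow> branch W z \<longrightarrow> y \<in> W \<longrightarrow>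
       dapply P z y = dapply (B 1) z y + dapply (B 2) (\<lambda>y. (z y)\<^sup>2) y"
    using annihilates_relation[OF ann x] by (elim exE conjE)
  define F where "F = (\<lambda>z. \<Sum>b\<le>m. P (m - b, b) (root_curve z 0) * z ^ (m - b))"
  have F0: "F z = 0" if "z \<noteq> 0" "root_curve z 0 \<in> U" for z
    unfolding F_def
    by (rule symbol_vanishes_on_conormal[OF U(1) that(2,1) m U(3,4) B(1)[rule_format] B(2)[rule_format]
          B(1)[rule_format] B(2)[rule_format]]) (rule rel[rule_format])
  show ?thesis
  proof (cases "z0 = 0")
    case False
    then show ?thesis using F0 U(2) by (simp add: F_def)
  next
    case True
    \<comment> \<open>\<open>F0\<close> covers the smooth points of the cusp only; the singular
      point is reached as their limit, by continuity of the coefficients of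
      \<open>P\<close>.\<close>
    have lim: "((\<lambda>z. root_curve z 0) \<longlongrightarrow> root_curve 0 0) (at 0)"
      unfolding root_curve_def by (intro tendsto_vector_2 tendsto_intros)
    have "eventually (\<lambda>z. root_curve z 0 \<in> U) (at 0)"
      using lim U(1) U(2)[unfolded True] by (rule topological_tendstoD)
    moreover have "eventually (\<lambda>z::complex. z \<noteq> 0) (at 0)"
      by (simp add: eventually_at_filter)
    ultimately have ev: "eventually (\<lambda>z. F z = 0) (at 0)"
      by eventually_elim (rule F0)
    have "((\<lambda>z. P \<alpha> (root_curve z 0)) \<longlongrightarrow> P \<alpha> (root_curve 0 0)) (at 0)" for \<alpha>
    proof (rule isCont_tendsto_compose[OF _ lim])
      have "continuous_on U (P \<alpha>)"
        by (rule holo_imp_continuous_on[OF diffops_holo[OF U(3)]])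
      then show "isCont (P \<alpha>) (root_curve 0 0)"
        using U(1) U(2)[unfolded True] continuous_on_eq_continuous_at by blast
    qed
    then have "(F \<longlongrightarrow> F 0) (at 0)"
      unfolding F_def by (intro tendsto_intros)
    from Lim_transform_eventually[OF this ev] have "F 0 = 0"
      by (simp add: tendsto_const_iff)
    then show ?thesis unfolding F_def True .
  qed
qed

lemma characteristic_variety_eq:
  "characteristic_variety D (module_M R) = {w \<in> cotangent D. \<forall>k. sym_P k w = 0}"
proof (rule equalityI[OF characteristic_variety_subset], rule subsetI)
  fix w assume "w \<in> {w \<in> cotangent D. \<forall>k. sym_P k w = 0}"
  then have w: "w \<in> cotangent D" "\<forall>k. sym_P k w = 0" by auto
  have wD: "base w \<in> D" using w(1) by (simp add: cotangent_def)
  have "symbol m P w = 0" if ann: "annihilates_gr (module_M R) (base w) m P" for m P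
  proof (cases "m = 0")
    case True
    then show ?thesis
      using annihilator_order_zero[of "base w" P] ann wD by (simp add: symbol_def)
  next
    case False
    then have m: "m \<ge> 1" by simp
    from w(2)[unfolded sym_P_zero_iff] show ?thesis
    proof (elim disjE exE conjE)
      fix z l assume z: "base w = root_curve z 0" "w $ 3 = z * l" "w $ 4 = l"
      show ?thesis
        unfolding symbol_on_conormal[OF z]
        using annihilator_on_conormal[of z m P] ann wD m unfolding z(1) by simp
    qed (rule symbol_on_zero_section[OF _ _ m])
  qed
  then show "w \<in> characteristic_variety D (module_M R)"
    using w(1) by (simp add: characteristic_variety_def)
qed

text \<open>\<open>phi R\<close> is itself a finite presentation over the whole of \<open>D\<close>.
  What remains is to number the six index pairs, since \<open>coherent_quotient\<close> indexes
  relations by naturals.\<close>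

lemma coherent_module: "coherent_quotient D (module_M R)"
  unfolding coherent_quotient_def
proof
  fix x assume x: "x \<in> D"
  define s where "s = card (UNIV :: (3 \<times> 2) set)"
  obtain e where e: "bij_betw e {..<s} (UNIV :: (3 \<times> 2) set)"
    using ex_bij_betw_nat_finite[OF finite, of "UNIV :: (3 \<times> 2) set"]
    by (auto simp: s_def atLeast0LessThan)
  define \<Phi> where "\<Phi> = (\<lambda>i j. R (fst (e i)) (snd (e i)) j)"
  define e' where "e' = inv_into {..<s} e"
  have e'e: "e' (e i) = i" if "i < s" for i
    using e that by (simp add: e'_def bij_betw_inv_into_left)
  have ee': "e (e' i) = i" for i
    using e by (simp add: e'_def bij_betw_inv_into_right)
  have phi_eq: "phi R Q = free_map {..<s} \<Phi> (\<lambda>i. Q (e i))" for Q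
    unfolding fun_eq_iff phi_eq_sum free_map_def \<Phi>_def
    by (subst sum.reindex_bij_betw[OF e, symmetric]) simp
  have free_eq: "free_map {..<s} \<Phi> Q = phi R (\<lambda>i. Q (e' i))" for Q
  proof -
    have "free_map {..<s} \<Phi> Q = free_map {..<s} \<Phi> (\<lambda>i. Q (e' (e i)))"
      unfolding free_map_def by (intro ext sum.cong) (simp_all add: e'e)
    then show ?thesis by (simp add: phi_eq)
  qed
  have e's: "e' i \<in> {..<s}" for i
    unfolding e'_def by (rule bij_betw_apply[OF bij_betw_inv_into[OF e] UNIV_I])
  have "module_M R y = image_stalk {..<s} \<Phi> y" for y
  proof (intro equalityI subsetI)
    fix A assume "A \<in> module_M R y"
    then obtain Q where Q: "\<forall>j. A j \<in> dstalk y" "\<forall>i. Q i \<in> dstalk y" "\<forall>j. germ_eq y (A j) (phi R Q j)"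
      unfolding module_M_def mem_Collect_eq by (elim conjE exE)
    show "A \<in> image_stalk {..<s} \<Phi> y"
      unfolding image_stalk_def mem_Collect_eq
    proof (intro conjI exI[of _ "\<lambda>i. Q (e i)"] ballI allI)
      show "Q (e i) \<in> dstalk y" for i using Q(2) by (rule spec)
      show "germ_eq y (A j) (free_map {..<s} \<Phi> (\<lambda>i. Q (e i)) j)" for j
        unfolding phi_eq[symmetric] using Q(3) by (rule spec)
    qed (use Q(1) in blast)
  next
    fix A assume "A \<in> image_stalk {..<s} \<Phi> y"
    then obtain Q where Q: "\<forall>j. A j \<in> dstalk y" "\<forall>i\<in>{..<s}. Q i \<in> dstalk y" "\<forall>j. germ_eq y (A j) (free_map {..<s} \<Phi> Q j)"
      unfolding image_stalk_def mem_Collect_eq by (elim conjE exE)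
    show "A \<in> module_M R y"
      unfolding module_M_def mem_Collect_eq
    proof (intro conjI exI[of _ "\<lambda>i. Q (e' i)"] allI)
      show "Q (e' i) \<in> dstalk y" for i using Q(2) e's by (rule bspec)
      show "germ_eq y (A j) (phi R (\<lambda>i. Q (e' i)) j)" for j
        unfolding free_eq[symmetric] using Q(3) by (rule spec)
    qed (use Q(1) in blast)
  qed
  moreover have "\<Phi> i j \<in> diffops D" for i j
    unfolding \<Phi>_def by (rule R_diffops)
  ultimately show "\<exists>U s (\<Phi> :: nat \<Rightarrow> 2 \<Rightarrow> dop). open U \<and> x \<in> U \<and> U \<subseteq> D \<and> (\<forall>i<s. \<forall>j. \<Phi> i j \<in> diffops U) \<and>
     (\<forall>y\<in>U. module_M R y = image_stalk {..<s} \<Phi> y)"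
    by (intro exI[of _ D] exI[of _ s] exI[of _ \<Phi>] conjI allI impI ballI open_D x order_refl)
qed

lemma zero_in_module: "0 \<in> module_M R x"
proof -
  have d: "(0 :: dop) \<in> dstalk x"
    by (rule dstalkI[OF open_UNIV UNIV_I diffops_zero])
  have "phi R (\<lambda>i. 0) j = 0" for j
    by (simp add: phi_eq_sum)
  then have g: "germ_eq x ((0 :: 2 \<Rightarrow> dop) j) (phi R (\<lambda>i. 0) j)" for j
    by (simp add: germ_eq_refl zero_fun_def)
  have d': "(0 :: 2 \<Rightarrow> dop) j \<in> dstalk x" for j
    using d by (simp add: zero_fun_def)
  show ?thesis
    unfolding module_M_def mem_Collect_eq
    by (intro conjI allI exI[of _ "\<lambda>i. 0"] g d d')
qed

lemma qcoset_self: "(\<And>j. A j \<in> dstalk x) \<Longrightarrow> A \<in> qcoset (module_M R) x A"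
  using zero_in_module by (simp add: qcoset_def)

end

section \<open>Solutions\<close>

locale cusp_solution = cusp_system +
  fixes U :: "(complex^2) set" and z :: "complex^2 \<Rightarrow> complex"
  assumes open_U: "open U" and U_subset: "U \<subseteq> D" and branch_z: "branch U z"
begin

text \<open>Independence of the representative. It is needed on a neighbourhood and not just at
  \<open>x\<close>, because an operator will be applied to the resulting function.\<close>

lemma pairing_qcoset_local:
  assumes "x \<in> U" "\<And>j. A j \<in> dstalk x" "B \<in> qcoset (module_M R) x A"
  shows "\<exists>V. open V \<and> x \<in> V \<and> V \<subseteq> U \<and> (\<forall>j. A j \<in> diffops V) \<and> (\<forall>j. B j \<in> diffops V) \<and>
    (\<forall>y\<in>V. pairing B z y = pairing A z y)"
proof -
  have B: "\<forall>j. B j \<in> dstalk x" "A - B \<in> module_M R x"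
    using assms(3) by (auto simp: qcoset_def)
  have xD: "x \<in> D" using assms(1) U_subset by blast
  have A: "\<forall>j. A j \<in> dstalk x" using assms(2) by blast
  obtain V1 where V1: "open V1" "x \<in> V1" "\<And>j. A j \<in> diffops V1"
    using dstalk_common[OF A] by blast
  obtain V2 where V2: "open V2" "x \<in> V2" "\<And>j. B j \<in> diffops V2"
    using dstalk_common[OF B(1)] by blast
  obtain V3 where V3: "open V3" "x \<in> V3"
    "\<And>W z y. open W \<Longrightarrow> W \<subseteq> V3 \<Longrightarrow> branch W z \<Longrightarrow> y \<in> W \<Longrightarrow> pairing (A - B) z y = 0"
    using pairing_module[OF B(2) xD] by blast
  define V where "V = U \<inter> V1 \<inter> V2 \<inter> V3"
  have V: "open V" "x \<in> V" "V \<subseteq> U" "V \<subseteq> V1" "V \<subseteq> V2" "V \<subseteq> V3"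
    unfolding V_def using open_U assms(1) V1 V2 V3 by auto
  note AV = diffops_subset[OF V1(3) V(4)] and BV = diffops_subset[OF V2(3) V(5)]
  have "pairing B z y = pairing A z y" if y: "y \<in> V" for y
    using V3(3)[OF V(1,6) branch_subset[OF branch_z V(3)] y] pairing_diff[OF V(1) AV BV y, where z = z] by simp
  then show ?thesis using V(1-3) AV BV by blast
qed

text \<open>Evaluates an arbitrary representative of the stalk value. Since this depends on
  \<open>s\<close> only through \<open>s x\<close>, the same function serves every open set and
  restriction of sections is respected at once.\<close>

definition val :: "(complex^2 \<Rightarrow> (2 \<Rightarrow> dop) set) \<Rightarrow> complex^2 \<Rightarrow> complex" where
  "val s x = pairing (SOME A. A \<in> s x) z x"

lemma val_qcoset:
  assumes "x \<in> U" "\<And>j. A j \<in> dstalk x" "s x = qcoset (module_M R) x A"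
  shows "val s x = pairing A z x"
proof -
  have "A \<in> s x" unfolding assms(3) by (rule qcoset_self[OF assms(2)])
  then have "(SOME A. A \<in> s x) \<in> s x" by (rule someI[where P = "\<lambda>A. A \<in> s x"])
  then have "(SOME A. A \<in> s x) \<in> qcoset (module_M R) x A" using assms(3) by simp
  from pairing_qcoset_local[OF assms(1,2) this] show ?thesis
    unfolding val_def by blast
qed

lemma section_local:
  assumes "s \<in> qsections (module_M R) W" "W \<subseteq> U" "x \<in> W"
  shows "\<exists>V A. open V \<and> x \<in> V \<and> V \<subseteq> W \<and> (\<forall>j. A j \<in> diffops V) \<and>
    (\<forall>y\<in>V. s y = qcoset (module_M R) y A) \<and> (\<forall>y\<in>V. val s y = pairing A z y)"
proof -
  obtain V A where V: "open V" "x \<in> V" "V \<subseteq> W" and A: "\<forall>j. A j \<in> diffops V"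
    and s: "\<forall>y\<in>V. s y = qcoset (module_M R) y A"
    using assms(1,3) unfolding qsections_def by blast
  have "val s y = pairing A z y" if y: "y \<in> V" for y
  proof (rule val_qcoset)
    show "y \<in> U" using y V(3) assms(2) by blast
    show "A j \<in> dstalk y" for j by (rule dstalkI[OF V(1) y]) (use A in blast)
    show "s y = qcoset (module_M R) y A" using s y by blast
  qed
  then show ?thesis using V A s by blast
qed

lemma val_holo:
  assumes "s \<in> qsections (module_M R) W" "W \<subseteq> U"
  shows "holo W (val s)"
proof (rule holo_locally)
  fix x assume x: "x \<in> W"
  obtain V A where V: "open V" "x \<in> V" "V \<subseteq> W" "\<forall>j. A j \<in> diffops V"
    "\<forall>y\<in>V. s y = qcoset (module_M R) y A" "\<forall>y\<in>V. val s y = pairing A z y"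
    using section_local[OF assms x] by (elim exE conjE)
  have "holo V (pairing A z)"
  proof (rule holo_pairing[OF V(1)])
    show "branch V z" by (rule branch_subset[OF branch_z]) (use V(3) assms(2) in blast)
  qed (use V(4) in blast)
  then show "\<exists>V. open V \<and> x \<in> V \<and> (\<exists>g. holo V g \<and> (\<forall>y\<in>V. val s y = g y))"
    using V(1,2,6) by blast
qed

text \<open>\<open>section_local\<close> provides some representative near \<open>x\<close>. Here
  any element of \<open>s x\<close> is shown to compute \<open>val\<close> around \<open>x\<close>,
  as required when a choice returns an unknown one.\<close>

lemma val_in_section:
  assumes "s \<in> qsections (module_M R) W" "W \<subseteq> U" "x \<in> W" "A \<in> s x"
  shows "\<exists>V. open V \<and> x \<in> V \<and> V \<subseteq> W \<and> (\<forall>j. A j \<in> diffops V) \<and> (\<forall>y\<in>V. val s y = pairing A z y)"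
proof -
  obtain V B where V: "open V" "x \<in> V" "V \<subseteq> W" "\<forall>j. B j \<in> diffops V"
    "\<forall>y\<in>V. s y = qcoset (module_M R) y B" "\<forall>y\<in>V. val s y = pairing B z y"
    using section_local[OF assms(1-3)] by (elim exE conjE)
  have Bx: "B j \<in> dstalk x" for j by (rule dstalkI[OF V(1,2)]) (use V(4) in blast)
  have xU: "x \<in> U" using assms(2,3) by blast
  have "A \<in> qcoset (module_M R) x B" using V(2,5) assms(4) by blast
  from pairing_qcoset_local[OF xU Bx this] obtain V' where V': "open V'" "x \<in> V'" "\<forall>j. A j \<in> diffops V'"
    "\<forall>y\<in>V'. pairing A z y = pairing B z y" by blast
  have "A j \<in> diffops (V \<inter> V')" for j
    by (rule diffops_subset[OF V'(3)[rule_format]]) blast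
  then show ?thesis
    using V V' by (intro exI[of _ "V \<inter> V'"]) auto
qed

lemma section_nonempty:
  assumes "s \<in> qsections (module_M R) W" "W \<subseteq> U" "x \<in> W"
  shows "\<exists>A. A \<in> s x"
proof -
  obtain V B where V: "open V" "x \<in> V" "V \<subseteq> W" "\<forall>j. B j \<in> diffops V"
    "\<forall>y\<in>V. s y = qcoset (module_M R) y B" "\<forall>y\<in>V. val s y = pairing B z y"
    using section_local[OF assms] by (elim exE conjE)
  have "B j \<in> dstalk x" for j by (rule dstalkI[OF V(1,2)]) (use V(4) in blast)
  then have "B \<in> qcoset (module_M R) x B" by (rule qcoset_self)
  then show ?thesis using V(2,5) by blast
qed

lemma val_add:
  assumes "s \<in> qsections (module_M R) W" "t \<in> qsections (module_M R) W" "W \<subseteq> U" "x \<in> W"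
  shows "val (qadd s t) x = val s x + val t x"
proof -
  obtain A0 B0 where "A0 \<in> s x" "B0 \<in> t x"
    using section_nonempty assms by meson
  then have "A0 + B0 \<in> qadd s t x" unfolding qadd_def by blast
  then have "(SOME C. C \<in> qadd s t x) \<in> qadd s t x" by (rule someI[where P = "\<lambda>C. C \<in> qadd s t x"])
  \<comment> \<open>The chosen element of the sum is split into representatives of \<open>s\<close>
    and \<open>t\<close>, which need not be the ones chosen by \<open>val s\<close> and
    \<open>val t\<close>.\<close>
  then obtain A B where C: "(SOME C. C \<in> qadd s t x) = A + B" and AB: "A \<in> s x" "B \<in> t x"
    unfolding qadd_def by blast
  obtain V where V: "open V" "x \<in> V" "\<forall>j. A j \<in> diffops V" "\<forall>y\<in>V. val s y = pairing A z y"
    using val_in_section[OF assms(1,3,4) AB(1)] by blast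
  obtain V' where V': "open V'" "x \<in> V'" "\<forall>j. B j \<in> diffops V'" "\<forall>y\<in>V'. val t y = pairing B z y"
    using val_in_section[OF assms(2,3,4) AB(2)] by blast
  have "val (qadd s t) x = pairing (A + B) z x"
    unfolding val_def C by (rule refl)
  also have "\<dots> = pairing A z x + pairing B z x"
  proof (rule pairing_add)
    show "open (V \<inter> V')" "x \<in> V \<inter> V'" using V V' by auto
    show "A j \<in> diffops (V \<inter> V')" for j by (rule diffops_subset[OF V(3)[rule_format]]) blast
    show "B j \<in> diffops (V \<inter> V')" for j by (rule diffops_subset[OF V'(3)[rule_format]]) blast
  qed
  finally show ?thesis using V(2,4) V'(2,4) by simp
qed

text \<open>Any element of \<open>qact\<close> at \<open>x\<close> is congruent to \<open>P\<close>
  applied to some \<open>A\<close> in \<open>s x\<close>; its pairing is \<open>P\<close> applied to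
  the pairing of \<open>A\<close>, and that function equals \<open>val s\<close> near
  \<open>x\<close>.\<close>

lemma val_act:
  assumes "P \<in> diffops W" "s \<in> qsections (module_M R) W" "open W" "W \<subseteq> U" "x \<in> W"
  shows "val (qact (module_M R) P s) x = dapply P (val s) x"
proof -
  have xU: "x \<in> U" using assms(4,5) by blast
  have PA: "\<exists>V. open V \<and> x \<in> V \<and> V \<subseteq> W \<and> (\<forall>j. A j \<in> diffops V) \<and> (\<forall>y\<in>V. val s y = pairing A z y) \<and>
     (\<forall>j. dmul P (A j) \<in> diffops V)" if A: "A \<in> s x" for A
  proof -
    obtain V where V: "open V" "x \<in> V" "V \<subseteq> W" "\<forall>j. A j \<in> diffops V" "\<forall>y\<in>V. val s y = pairing A z y"
      using val_in_section[OF assms(2,4,5) A] by blast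
    have "dmul P (A j) \<in> diffops V" for j
      by (rule diffops_dmul[OF V(1) diffops_subset[OF assms(1) V(3)] V(4)[rule_format]])
    then show ?thesis using V by blast
  qed
  obtain A0 where A0: "A0 \<in> s x"
    using section_nonempty[OF assms(2,4,5)] by blast
  have "(\<lambda>j. dmul P (A0 j)) \<in> qcoset (module_M R) x (\<lambda>j. dmul P (A0 j))"
  proof (rule qcoset_self)
    fix j
    obtain V where "open V" "x \<in> V" "\<forall>j. dmul P (A0 j) \<in> diffops V" using PA[OF A0] by blast
    then show "dmul P (A0 j) \<in> dstalk x" by (intro dstalkI) auto
  qed
  then have "(\<lambda>j. dmul P (A0 j)) \<in> qact (module_M R) P s x"
    unfolding qact_def using A0 by blast
  then have "(SOME C. C \<in> qact (module_M R) P s x) \<in> qact (module_M R) P s x"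
    by (rule someI[where P = "\<lambda>C. C \<in> qact (module_M R) P s x"])
  then obtain A where A: "A \<in> s x"
    and C: "(SOME C. C \<in> qact (module_M R) P s x) \<in> qcoset (module_M R) x (\<lambda>j. dmul P (A j))"
    unfolding qact_def by blast
  obtain V where V: "open V" "x \<in> V" "V \<subseteq> W" "\<forall>j. A j \<in> diffops V" "\<forall>y\<in>V. val s y = pairing A z y"
    "\<forall>j. dmul P (A j) \<in> diffops V"
    using PA[OF A] by blast
  have stalk: "dmul P (A j) \<in> dstalk x" for j
    by (rule dstalkI[OF V(1,2) V(6)[rule_format]])
  have "val (qact (module_M R) P s) x = pairing (\<lambda>j. dmul P (A j)) z x"
    using pairing_qcoset_local[OF xU stalk C] unfolding val_def by blast
  also have "\<dots> = dapply P (pairing A z) x"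
  proof (rule pairing_dmul[OF V(1) diffops_subset[OF assms(1) V(3)] V(4)[rule_format] _ V(2)])
    show "branch V z" by (rule branch_subset[OF branch_z]) (use V(3) assms(4) in blast)
  qed
  also have "\<dots> = dapply P (val s) x"
    by (rule dapply_cong[OF V(1) _ V(2)]) (use V(5) in simp)
  finally show ?thesis .
qed

lemma defines_solution: "defines_solution (module_M R) U (root_pair z)"
  unfolding defines_solution_def
proof (intro exI[of _ "\<lambda>W. val"] conjI allI impI)
  show "solution_morphism (module_M R) U (\<lambda>W. val)"
    unfolding solution_morphism_def
  proof (intro allI impI conjI ballI)
    fix W assume W: "open W \<and> W \<subseteq> U"
    show "holo W (val s)" if "s \<in> qsections (module_M R) W" for s
      using W by (intro val_holo[OF that]) simp
    show "val (qadd s t) x = val s x + val t x"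
      if "s \<in> qsections (module_M R) W" "t \<in> qsections (module_M R) W" "x \<in> W" for s t x
      using W by (intro val_add[OF that(1,2) _ that(3)]) simp
    show "val (qact (module_M R) P s) x = dapply P (val s) x"
      if "P \<in> diffops W" "s \<in> qsections (module_M R) W" "x \<in> W" for P s x
      using W by (intro val_act[OF that(1,2) _ _ that(3)]) simp_all
    show "val (qres V s) x = val s x" if "x \<in> V" for V s x
      using that by (simp add: val_def qres_def)
  qed
  fix W and A :: "2 \<Rightarrow> dop" assume W: "open W \<and> W \<subseteq> U \<and> (\<forall>j. A j \<in> diffops W)"
  show "\<forall>x\<in>W. val (qclass (module_M R) W A) x = (\<Sum>j\<in>UNIV. dapply (A j) (root_pair z j) x)"
  proof
    fix x assume x: "x \<in> W"
    have "val (qclass (module_M R) W A) x = pairing A z x"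
    proof (rule val_qcoset)
      show "x \<in> U" using x W by blast
      show "A j \<in> dstalk x" for j by (rule dstalkI[of W]) (use x W in auto)
      show "qclass (module_M R) W A x = qcoset (module_M R) x A"
        using x by (simp add: qclass_def)
    qed
    then show "val (qclass (module_M R) W A) x = (\<Sum>j\<in>UNIV. dapply (A j) (root_pair z j) x)"
      by (simp only: pairing_def)
  qed
qed

end

section \<open>Tangent spaces at regular points\<close>

lemma norm_vsmult: "norm (c *s x :: complex^'n) = cmod c * norm x"
  by (simp add: norm_vec_def L2_set_def norm_mult power_mult_distrib real_sqrt_mult flip: sum_distrib_left)

text \<open>Biorthogonalization by induction: a vector is stripped of its components along the dual
  vectors found so far, and independence guarantees one on which the new functional does not
  vanish.\<close>

lemma dual_vectors:
  fixes L :: "nat \<Rightarrow> complex^'n \<Rightarrow> complex"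
  assumes "\<And>i. i < k \<Longrightarrow> linear (L i)" "\<And>i c v. i < k \<Longrightarrow> L i (c *s v) = c * L i v"
    and "\<forall>c. (\<forall>v. (\<Sum>i<k. c i * L i v) = 0) \<longrightarrow> (\<forall>i<k. c i = 0)"
  shows "\<exists>g. \<forall>i<k. \<forall>j<k. L i (g j) = (if i = j then 1 else 0)"
  using assms
proof (induction k)
  case (Suc k)
  note lin = Suc.prems(1) and hom = Suc.prems(2)
  have ind: "\<forall>c. (\<forall>v. (\<Sum>i<k. c i * L i v) = 0) \<longrightarrow> (\<forall>i<k. c i = 0)"
  proof (intro allI impI)
    fix c i assume c: "\<forall>v. (\<Sum>i<k. c i * L i v) = 0" and i: "i < k"
    have "(\<Sum>i<Suc k. (c(k := 0)) i * L i v) = 0" for v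
      using c by simp
    then have "\<forall>i<Suc k. (c(k := 0)) i = 0" using Suc.prems(3) by blast
    then have "(c(k := 0)) i = 0" using i less_SucI by blast
    then show "c i = 0" using i by simp
  qed
  obtain g where g': "\<forall>i<k. \<forall>j<k. L i (g j) = (if i = j then 1 else 0)"
    using Suc.IH[OF lin[OF less_SucI] hom[OF less_SucI] ind] by blast
  note g = g'[rule_format]
  \<comment> \<open>Otherwise \<open>L k\<close> would be the combination of the earlier
    \<open>L j\<close> with coefficients \<open>L k (g j)\<close>.\<close>
  have "\<exists>v. L k v - (\<Sum>j<k. L k (g j) * L j v) \<noteq> 0"
  proof (rule ccontr)
    assume "\<not> ?thesis"
    then have z: "L k v - (\<Sum>j<k. L k (g j) * L j v) = 0" for v
      by blast
    define c where "c = (\<lambda>i. if i = k then 1 else - L k (g i))"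
    have "(\<Sum>i<Suc k. c i * L i v) = 0" for v
      using z[of v] by (simp add: c_def sum_negf)
    then have "c k = 0" using Suc.prems(3) by blast
    then show False by (simp add: c_def)
  qed
  then obtain v where v: "L k v - (\<Sum>j<k. L k (g j) * L j v) \<noteq> 0" by (elim exE)
  define \<mu> where "\<mu> = L k v - (\<Sum>j<k. L k (g j) * L j v)"
  define v' where "v' = v - (\<Sum>j<k. L j v *s g j)"
  have L': "L i v' = L i v - (\<Sum>j<k. L j v * L i (g j))" if "i < Suc k" for i
    unfolding v'_def linear_diff[OF lin[OF that]] linear_sum[OF lin[OF that]] hom[OF that] by (rule refl)
  have "L i v' = 0" if "i < k" for i
    using that by (simp add: L' g if_distrib cong: if_cong)
  moreover have "L k v' = \<mu>"
    by (simp add: L' \<mu>_def mult.commute)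
  ultimately have h: "L i ((1 / \<mu>) *s v') = (if i = k then 1 else 0)" if "i < Suc k" for i
    using that v by (auto simp: hom \<mu>_def)
  \<comment> \<open>The earlier dual vectors are corrected along the new one so that
    \<open>L k\<close> vanishes on them.\<close>
  define g' where "g' = (\<lambda>j. if j = k then (1 / \<mu>) *s v' else g j - L k (g j) *s ((1 / \<mu>) *s v'))"
  have "L i (g' j) = (if i = j then 1 else 0)" if ij: "i < Suc k" "j < Suc k" for i j
  proof (cases "j = k")
    case True
    then show ?thesis using h[OF ij(1)] by (simp add: g'_def)
  next
    case False
    then have "L i (g' j) = L i (g j) - L k (g j) * L i ((1 / \<mu>) *s v')"
      unfolding g'_def by (simp add: linear_diff[OF lin[OF ij(1)]] hom[OF ij(1)] del: vector_smult_assoc)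
    then show ?thesis
      using h[OF ij(1)] g[of i j] ij False by (cases "i = k") auto
  qed
  then show ?case by blast
qed simp

text \<open>Trades \<open>frechet_derivative\<close> for named differentials that are known to be
  complex homogeneous.\<close>

lemma regular_at_local:
  assumes "regular_at V w T"
  shows "\<exists>U k f L. open U \<and> w \<in> U \<and> w \<in> V \<and> (\<forall>i<k. holo U (f i)) \<and> V \<inter> U = common_zeros U k f \<and>
    (\<forall>i<k. (f i has_derivative L i) (at w)) \<and> (\<forall>i<k. \<forall>c v. L i (c *s v) = c * L i v) \<and>
    (\<forall>c. (\<forall>v. (\<Sum>i<k. c i * L i v) = 0) \<longrightarrow> (\<forall>i<k. c i = 0)) \<and>
    T = {v. \<forall>i<k. L i v = 0}"
proof -
  obtain U k f where U: "open U" "w \<in> U" "\<forall>i<k. holo U (f i)" "V \<inter> U = common_zeros U k f"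
    "\<forall>c. (\<forall>v. (\<Sum>i<k. c i * frechet_derivative (f i) (at w) v) = 0) \<longrightarrow> (\<forall>i<k. c i = 0)"
    "T = {v. \<forall>i<k. frechet_derivative (f i) (at w) v = 0}" and wV: "w \<in> V"
    using assms unfolding regular_at_def by (elim exE conjE)
  have d: "(f i has_derivative frechet_derivative (f i) (at w)) (at w) \<and>
      (\<forall>c v. frechet_derivative (f i) (at w) (c *s v) = c * frechet_derivative (f i) (at w) v)" if i: "i < k" for i
  proof -
    have "holo U (f i)" using U(3) i by blast
    then obtain L where L: "(f i has_derivative L) (at w)" "\<forall>c v. L (c *s v) = c * L v"
      using U(2) unfolding holo_def by blast
    have "frechet_derivative (f i) (at w) = L"
      using frechet_derivative_at[OF L(1)] by simp
    then show ?thesis using L by simp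
  qed
  show ?thesis
  proof (intro exI conjI)
    show "open U" "w \<in> U" "w \<in> V" "\<forall>i<k. holo U (f i)" "V \<inter> U = common_zeros U k f" by fact+
    show "\<forall>i<k. (f i has_derivative frechet_derivative (f i) (at w)) (at w)"
      "\<forall>i<k. \<forall>c v. frechet_derivative (f i) (at w) (c *s v) = c * frechet_derivative (f i) (at w) v"
      using d by blast+
  qed (fact U)+
qed

lemma regular_at_subspace:
  assumes "regular_at V w T"
  shows "u \<in> T \<Longrightarrow> v \<in> T \<Longrightarrow> u + v \<in> T" "u \<in> T \<Longrightarrow> c *s u \<in> T"
proof -
  obtain k :: nat and f L where d: "\<forall>i<k. (f i has_derivative L i) (at w)"
    and hom: "\<forall>i<k. \<forall>c v. L i (c *s v) = c * L i v" and T: "T = {v. \<forall>i<k. L i v = 0}"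
    using regular_at_local[OF assms] by (elim exE conjE)
  have "L i (u + v) = L i u + L i v" if "i < k" for i u v
    by (rule linear_add[OF has_derivative_linear[OF d[rule_format, OF that]]])
  then show "u \<in> T \<Longrightarrow> v \<in> T \<Longrightarrow> u + v \<in> T"
    by (simp add: T)
  show "u \<in> T \<Longrightarrow> c *s u \<in> T"
    using hom by (simp add: T)
qed

text \<open>The implicit function theorem is replaced by Brouwer's fixed point theorem, applied to
  \<open>u \<mapsto> \<Sum>\<^sub>i (L\<^sub>i u - f\<^sub>i (w + \<epsilon> (v + u)) / \<epsilon>) g\<^sub>i\<close> with \<open>g\<^sub>i\<close> dual to the differentials \<open>L\<^sub>i\<close>. So every vector
  of \<open>T\<close> is a limit of secants, and no continuity of derivatives is needed.\<close>

lemma tangent_approx: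
  fixes w :: "complex^'n"
  assumes reg: "regular_at V w T" and v: "v \<in> T" and \<delta>: "\<delta> > 0" and r: "r > 0"
  shows "\<exists>\<epsilon> u. 0 < \<epsilon> \<and> \<epsilon> < r \<and> norm u \<le> \<delta> \<and> w + \<epsilon> *\<^sub>R (v + u) \<in> V"
proof -
  obtain U k f L where U: "open U" "w \<in> U" and wV: "w \<in> V" and holo': "\<forall>i<k. holo U (f i)"
    and VU: "V \<inter> U = common_zeros U k f"
    and d': "\<forall>i<k. (f i has_derivative L i) (at w)" and hom': "\<forall>i<k. \<forall>c v. L i (c *s v) = c * L i v"
    and ind: "\<forall>c. (\<forall>v. (\<Sum>i<k. c i * L i v) = 0) \<longrightarrow> (\<forall>i<k. c i = 0)"
    and T: "T = {v. \<forall>i<k. L i v = 0}"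
    using regular_at_local[OF reg] by (elim exE conjE)
  note holo = holo'[rule_format] and d = d'[rule_format] and hom = hom'[rule_format]
  have lin: "linear (L i)" if "i < k" for i
    using has_derivative_linear[OF d[OF that]] .
  obtain g where g': "\<forall>i<k. \<forall>j<k. L i (g j) = (if i = j then 1 else 0)"
    using dual_vectors[OF lin hom ind] by blast
  note g = g'[rule_format]
  have fw: "f i w = 0" if "i < k" for i
    using U(2) wV VU that unfolding common_zeros_def by blast
  have Lv: "L i v = 0" if "i < k" for i
    using v that by (simp add: T)
  define G where "G = 1 + (\<Sum>i<k. norm (g i))"
  have G: "G \<ge> 1" by (simp add: G_def sum_nonneg)
  define c where "c = norm v + \<delta>"
  have c: "c > 0" using \<delta> by (simp add: c_def add_nonneg_pos)
  \<comment> \<open>\<open>c\<close> bounds the norm of \<open>v + u\<close> and \<open>G\<close>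
    the total size of the dual vectors; with \<open>\<eta> * c * G = \<delta>\<close> the map
    \<open>\<Phi>\<close> preserves the ball of radius \<delta>.\<close>
  define \<eta> where "\<eta> = \<delta> / (c * G)"
  have \<eta>: "\<eta> > 0" using \<delta> c G by (simp add: \<eta>_def)
  have "\<exists>e>0. \<forall>y. norm (y - w) < e \<longrightarrow> norm (f i y - f i w - L i (y - w)) \<le> \<eta> * norm (y - w)" if "i < k" for i
    using d[OF that] \<eta> unfolding has_derivative_at_alt by blast
  then have "\<forall>i. \<exists>e. i < k \<longrightarrow> e > 0 \<and> (\<forall>y. norm (y - w) < e \<longrightarrow> norm (f i y - f i w - L i (y - w)) \<le> \<eta> * norm (y - w))"
    by blast
  then obtain e where e': "\<forall>i. i < k \<longrightarrow> e i > 0 \<and> (\<forall>y. norm (y - w) < e i \<longrightarrow> norm (f i y - f i w - L i (y - w)) \<le> \<eta> * norm (y - w))"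
    by (rule choice[THEN exE])
  then have e: "\<And>i. i < k \<Longrightarrow> e i > 0"
    "\<And>i y. i < k \<Longrightarrow> norm (y - w) < e i \<Longrightarrow> norm (f i y - f i w - L i (y - w)) \<le> \<eta> * norm (y - w)"
    by blast+
  obtain e0 where e0: "e0 > 0" "ball w e0 \<subseteq> U"
    using U open_contains_ball by blast
  define E where "E = Min (insert e0 (e ` {..<k}))"
  have E: "E > 0" "E \<le> e0" "\<And>i. i < k \<Longrightarrow> E \<le> e i"
    unfolding E_def using e0(1) e(1) by (auto simp: Min_gr_iff)
  \<comment> \<open>Since \<open>\<epsilon> * c < E\<close>, all points \<open>Y u\<close> lie in
    \<open>U\<close> and within the range of each of the \<open>k\<close> linear estimates.\<close>
  define \<epsilon> where "\<epsilon> = min (r / 2) (E / (2 * c))"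
  have \<epsilon>: "0 < \<epsilon>" "\<epsilon> < r" "\<epsilon> * c < E"
  proof -
    show "0 < \<epsilon>" "\<epsilon> < r" using r E(1) c by (auto simp: \<epsilon>_def)
    have "\<epsilon> * c \<le> E / (2 * c) * c" using c by (intro mult_right_mono) (auto simp: \<epsilon>_def)
    also have "\<dots> < E" using c E(1) by simp
    finally show "\<epsilon> * c < E" .
  qed
  define Y where "Y = (\<lambda>u. w + \<epsilon> *\<^sub>R (v + u))"
  have Y: "norm (Y u - w) \<le> \<epsilon> * c" if "norm u \<le> \<delta>" for u
  proof -
    have "norm (Y u - w) = \<epsilon> * norm (v + u)" using \<epsilon>(1) by (simp add: Y_def)
    also have "\<dots> \<le> \<epsilon> * c"
      using that \<epsilon>(1) norm_triangle_ineq[of v u] by (intro mult_left_mono) (auto simp: c_def)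
    finally show ?thesis .
  qed
  have YU: "Y u \<in> U" if "norm u \<le> \<delta>" for u
  proof -
    have "norm (Y u - w) < e0" using Y[OF that] \<epsilon>(3) E(2) by linarith
    then have "Y u \<in> ball w e0" by (simp add: dist_norm norm_minus_commute)
    then show ?thesis using e0(2) by blast
  qed
  define C where "C = (\<lambda>i u. L i u - f i (Y u) / of_real \<epsilon>)"
  define \<Phi> where "\<Phi> = (\<lambda>u. \<Sum>i<k. C i u *s g i)"
  have Cb: "cmod (C i u) \<le> \<eta> * c" if i: "i < k" and u: "norm u \<le> \<delta>" for i u
  proof -
    have "L i (Y u - w) = of_real \<epsilon> * L i u"
    proof -
      have "L i (Y u - w) = L i (\<epsilon> *\<^sub>R (v + u))" by (simp add: Y_def)
      also have "\<dots> = \<epsilon> *\<^sub>R L i (v + u)" by (rule linear_cmul[OF lin[OF i]])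
      also have "L i (v + u) = L i u" using linear_add[OF lin[OF i]] Lv[OF i] by simp
      finally show ?thesis by (simp add: scaleR_conv_of_real)
    qed
    then have "C i u = - (f i (Y u) - f i w - L i (Y u - w)) / of_real \<epsilon>"
      using \<epsilon>(1) fw[OF i] by (simp add: C_def field_simps)
    then have "cmod (C i u) = norm (f i (Y u) - f i w - L i (Y u - w)) / \<epsilon>"
      using \<epsilon>(1) by (simp only: norm_divide norm_minus_cancel norm_of_real abs_of_pos)
    also have "\<dots> \<le> \<eta> * norm (Y u - w) / \<epsilon>"
    proof (intro divide_right_mono e(2)[OF i])
      show "norm (Y u - w) < e i" using Y[OF u] \<epsilon>(3) E(3)[OF i] by linarith
    qed (use \<epsilon>(1) in simp)
    also have "\<dots> \<le> \<eta> * (\<epsilon> * c) / \<epsilon>"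
      using Y[OF u] \<eta> \<epsilon>(1) by (intro divide_right_mono mult_left_mono) auto
    also have "\<dots> = \<eta> * c" using \<epsilon>(1) by simp
    finally show ?thesis .
  qed
  have "norm (\<Phi> u) \<le> \<delta>" if u: "norm u \<le> \<delta>" for u
  proof -
    have "norm (\<Phi> u) \<le> (\<Sum>i<k. \<eta> * c * norm (g i))"
      unfolding \<Phi>_def
      by (rule order_trans[OF norm_sum sum_mono]) (simp add: norm_vsmult mult_right_mono[OF Cb[OF _ u]])
    also have "\<dots> = \<eta> * c * (\<Sum>i<k. norm (g i))" by (simp add: sum_distrib_left)
    also have "\<dots> \<le> \<eta> * c * G"
      using \<eta> c by (intro mult_left_mono) (auto simp: G_def)
    also have "\<dots> = \<delta>" using c G by (simp add: \<eta>_def)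
    finally show ?thesis .
  qed
  then have maps: "\<Phi> \<in> cball 0 \<delta> \<rightarrow> cball 0 \<delta>" by (auto simp: Pi_iff)
  have contY: "continuous_on (cball 0 \<delta>) Y" unfolding Y_def by (intro continuous_intros)
  have contC: "continuous_on (cball 0 \<delta>) (C i)" if i: "i < k" for i
    unfolding C_def
  proof (intro continuous_on_diff continuous_on_divide continuous_on_const)
    show "continuous_on (cball 0 \<delta>) (L i)"
      by (rule linear_continuous_on[OF has_derivative_bounded_linear[OF d[OF i]]])
    show "continuous_on (cball 0 \<delta>) (\<lambda>u. f i (Y u))"
      by (rule continuous_on_compose2[OF holo_imp_continuous_on[OF holo[OF i]] contY]) (use YU in auto)
  qed (use \<epsilon>(1) in simp)
  have "continuous_on (cball 0 \<delta>) \<Phi>"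
    unfolding \<Phi>_def
    by (intro continuous_on_sum bounded_linear.continuous_on[OF bounded_linear_vsmult_left] contC) simp
  then obtain u where u: "u \<in> cball 0 \<delta>" "\<Phi> u = u"
    using brouwer_ball[OF \<delta> _ maps] by blast
  have nu: "norm u \<le> \<delta>" using u(1) by simp
  have "f i (Y u) = 0" if i: "i < k" for i
  proof -
    \<comment> \<open>By duality \<open>L i\<close> picks out the i-th coefficient, so the fixed
      point equation becomes \<open>L i u = L i u - f i (Y u) / \<epsilon>\<close>.\<close>
    have "L i (\<Phi> u) = (\<Sum>j<k. C j u * L i (g j))"
      unfolding \<Phi>_def linear_sum[OF lin[OF i]] hom[OF i] by (rule refl)
    also have "\<dots> = (\<Sum>j<k. if j = i then C j u else 0)"
      by (intro sum.cong refl) (use g[OF i] in auto)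
    also have "\<dots> = C i u" using i by simp
    finally have "L i u = C i u" using u(2) by simp
    then show ?thesis using \<epsilon>(1) by (simp add: C_def)
  qed
  then have "Y u \<in> common_zeros U k f" using YU[OF nu] by (simp add: common_zeros_def)
  then have "w + \<epsilon> *\<^sub>R (v + u) \<in> V" using VU by (auto simp: Y_def)
  then show ?thesis using \<epsilon>(1,2) nu by blast
qed

text \<open>Gives upper bounds for \<open>T\<close>. Nothing relates \<open>h\<close> to the
  defining equations except vanishing on \<open>V\<close>, so the argument evaluates
  \<open>h\<close> at a nearby point of \<open>V\<close> in direction \<open>v + u\<close>. The
  constants make both the error of linearization, divided by \<epsilon>, and |L u| at most |L v| /
  4.\<close>

lemma tangent_kills:
  fixes w :: "complex^'n" and h :: "complex^'n \<Rightarrow> complex"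
  assumes reg: "regular_at V w T" and v: "v \<in> T" and h: "(h has_derivative L) (at w)"
    and O: "open S" "w \<in> S" "\<And>y. y \<in> V \<Longrightarrow> y \<in> S \<Longrightarrow> h y = 0"
  shows "L v = 0"
proof (rule ccontr)
  assume "L v \<noteq> 0"
  then have a: "cmod (L v) > 0" by simp
  obtain K where K: "K > 0" "\<And>x. norm (L x) \<le> norm x * K"
    using bounded_linear.pos_bounded[OF has_derivative_bounded_linear[OF h]] by blast
  define \<delta> where "\<delta> = cmod (L v) / (4 * K)"
  have \<delta>: "\<delta> > 0" using a K(1) by (simp add: \<delta>_def)
  define c where "c = norm v + \<delta>"
  have c: "c > 0" using \<delta> by (simp add: c_def add_nonneg_pos)
  define \<eta> where "\<eta> = cmod (L v) / (4 * c)"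
  have \<eta>: "\<eta> > 0" using a c by (simp add: \<eta>_def)
  obtain d where d: "d > 0" "\<And>y. norm (y - w) < d \<Longrightarrow> norm (h y - h w - L (y - w)) \<le> \<eta> * norm (y - w)"
    using h \<eta> unfolding has_derivative_at_alt by blast
  obtain e where e: "e > 0" "ball w e \<subseteq> S"
    using O(1,2) open_contains_ball by blast
  have "min d e / c > 0" using d(1) e(1) c by simp
  from tangent_approx[OF reg v \<delta> this] obtain \<epsilon> u where
    \<epsilon>: "0 < \<epsilon>" "\<epsilon> < min d e / c" "norm u \<le> \<delta>" "w + \<epsilon> *\<^sub>R (v + u) \<in> V"
    by blast
  define y where "y = w + \<epsilon> *\<^sub>R (v + u)"
  have ny: "norm (y - w) \<le> \<epsilon> * c"
  proof -
    have "norm (y - w) = \<epsilon> * norm (v + u)" using \<epsilon>(1) by (simp add: y_def)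
    also have "\<dots> \<le> \<epsilon> * c"
      using \<epsilon>(1,3) norm_triangle_ineq[of v u] by (intro mult_left_mono) (auto simp: c_def)
    finally show ?thesis .
  qed
  also have "\<epsilon> * c < min d e" using \<epsilon>(2) c by (simp add: pos_less_divide_eq)
  finally have small: "norm (y - w) < d" "norm (y - w) < e" by auto
  have "y \<in> S" using small(2) e(2) by (auto simp: dist_norm norm_minus_commute)
  then have "h y = 0" using O(3) \<epsilon>(4) by (simp add: y_def)
  moreover have "h w = 0"
    using O(2,3) reg unfolding regular_at_def by blast
  moreover have "L (y - w) = \<epsilon> *\<^sub>R (L v + L u)"
    using linear_cmul[OF has_derivative_linear[OF h]] linear_add[OF has_derivative_linear[OF h]]
    by (simp add: y_def)
  ultimately have "\<epsilon> * cmod (L v + L u) \<le> \<eta> * norm (y - w)"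
    using d(2)[OF small(1)] \<epsilon>(1) by simp
  also have "\<dots> \<le> \<eta> * (\<epsilon> * c)" using ny \<eta> by (intro mult_left_mono) auto
  finally have "cmod (L v + L u) \<le> \<eta> * c"
    using \<epsilon>(1) by (simp add: mult.left_commute)
  moreover have "\<eta> * c = cmod (L v) / 4" using c by (simp add: \<eta>_def)
  moreover have "cmod (L u) \<le> cmod (L v) / 4"
  proof -
    have "cmod (L u) \<le> norm u * K" by (rule K(2))
    also have "\<dots> \<le> \<delta> * K" using \<epsilon>(3) K(1) by (intro mult_right_mono) auto
    also have "\<dots> = cmod (L v) / 4" using K(1) by (simp add: \<delta>_def)
    finally show ?thesis .
  qed
  moreover have "cmod (L v) \<le> cmod (L v + L u) + cmod (L u)"
    using norm_triangle_ineq4[of "L v + L u" "L u"] by simp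
  ultimately show False using a by linarith
qed

text \<open>Gives lower bounds for \<open>T\<close>: the defining equations vanish along the curve,
  so their differentials kill its velocity.\<close>

lemma tangent_of_curve:
  fixes \<gamma> :: "real \<Rightarrow> complex^'n"
  assumes reg: "regular_at V w T" and \<gamma>: "(\<gamma> has_derivative (\<lambda>t. t *\<^sub>R v)) (at 0)" "\<gamma> 0 = w"
    and V: "eventually (\<lambda>t. \<gamma> t \<in> V) (nhds 0)"
  shows "v \<in> T"
proof -
  obtain U k f L where U: "open U" "w \<in> U"
    and VU: "V \<inter> U = common_zeros U k f" and d': "\<forall>i<k. (f i has_derivative L i) (at w)"
    and T: "T = {v. \<forall>i<k. L i v = 0}"
    using regular_at_local[OF reg] by (elim exE conjE)
  note d = d'[rule_format]
  have "L i v = 0" if i: "i < k" for i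
  proof -
    have "(\<gamma> \<longlongrightarrow> \<gamma> 0) (nhds 0)"
      using has_derivative_continuous[OF \<gamma>(1)] by (simp add: continuous_within tendsto_nhds_iff)
    then have "eventually (\<lambda>t. \<gamma> t \<in> U) (nhds 0)"
      using U \<gamma>(2) by (intro topological_tendstoD) auto
    with V have ev: "eventually (\<lambda>t. f i (\<gamma> t) = 0) (nhds 0)"
    proof eventually_elim
      case (elim t)
      then have "\<gamma> t \<in> common_zeros U k f" using VU by blast
      then show ?case using i by (simp add: common_zeros_def)
    qed
    have "((\<lambda>t. f i (\<gamma> t)) has_derivative (\<lambda>t. L i (t *\<^sub>R v))) (at 0)"
      by (rule has_derivative_compose[OF \<gamma>(1)]) (simp add: \<gamma>(2) d[OF i])
    moreover have "((\<lambda>t. f i (\<gamma> t)) has_derivative (\<lambda>t. 0)) (at 0)"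
    proof -
      obtain S where S: "open S" "0 \<in> S" "\<And>t. t \<in> S \<Longrightarrow> f i (\<gamma> t) = 0"
        using ev unfolding eventually_nhds by blast
      show ?thesis
        by (rule has_derivative_transform_within_open[OF has_derivative_const S(1,2)]) (simp add: S(3))
    qed
    ultimately have "(\<lambda>t. L i (t *\<^sub>R v)) = (\<lambda>t. 0)" by (rule has_derivative_unique)
    then have "L i (1 *\<^sub>R v) = 0" by (rule fun_cong)
    then show ?thesis by simp
  qed
  then show ?thesis by (simp add: T)
qed

section \<open>The Lagrangian property\<close>

text \<open>Written through basis vectors so that limits and derivatives can be taken term by
  term.\<close>

definition pt4 :: "complex \<Rightarrow> complex \<Rightarrow> complex \<Rightarrow> complex \<Rightarrow> complex^4" where
  "pt4 a b c d = a *s axis 1 1 + b *s axis 2 1 + c *s axis 3 1 + d *s axis 4 1"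

lemma pt4_nth [simp]:
  "pt4 a b c d $ 1 = a" "pt4 a b c d $ 2 = b" "pt4 a b c d $ 3 = c" "pt4 a b c d $ 4 = d"
  by (simp_all add: pt4_def axis_def)

lemma pt4_eqI:
  "v $ 1 = a \<Longrightarrow> v $ 2 = b \<Longrightarrow> v $ 3 = c \<Longrightarrow> v $ 4 = d \<Longrightarrow> v = pt4 a b c d"
  unfolding vec_eq_iff forall_4 by simp

lemma has_derivative_pt4:
  assumes "(f1 has_derivative g1) F" "(f2 has_derivative g2) F" "(f3 has_derivative g3) F" "(f4 has_derivative g4) F"
  shows "((\<lambda>t. pt4 (f1 t) (f2 t) (f3 t) (f4 t)) has_derivative (\<lambda>t. pt4 (g1 t) (g2 t) (g3 t) (g4 t))) F"
  unfolding pt4_def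
  by (intro has_derivative_add bounded_linear.has_derivative[OF bounded_linear_vsmult_left] assms)

lemma tendsto_pt4:
  assumes "(f1 \<longlongrightarrow> a) F" "(f2 \<longlongrightarrow> b) F" "(f3 \<longlongrightarrow> c) F" "(f4 \<longlongrightarrow> d) F"
  shows "((\<lambda>t. pt4 (f1 t) (f2 t) (f3 t) (f4 t)) \<longlongrightarrow> pt4 a b c d) F"
  unfolding pt4_def
  by (intro tendsto_add bounded_linear.tendsto[OF bounded_linear_vsmult_left] assms)

lemma pt4_scaleR: "pt4 (t *\<^sub>R a) (t *\<^sub>R b) (t *\<^sub>R c) (t *\<^sub>R d) = t *\<^sub>R pt4 a b c d"
  by (rule pt4_eqI[symmetric]) simp_all

lemma continuous_on_base: "continuous_on UNIV base"
  unfolding base_def[abs_def] vector_2_axis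
  by (intro continuous_intros bounded_linear.continuous_on[OF bounded_linear_vsmult_left])

lemma open_cotangent: "open D \<Longrightarrow> open (cotangent D)"
  using open_vimage[OF _ continuous_on_base, of D] by (simp add: cotangent_def vimage_def)

lemma root_curve_in_cusp: "root_curve z 0 \<in> cusp"
  by (simp add: cusp_def Discr_root_curve)

lemma cusp_param:
  assumes "x \<in> cusp"
  shows "\<exists>z. x = root_curve z 0"
proof -
  have D: "4 * (x $ 1) ^ 3 = 27 * (x $ 2)\<^sup>2"
    using assms by (simp add: cusp_def Discr_def)
  have "\<exists>z. x $ 1 = 3 * z\<^sup>2 \<and> x $ 2 = - 2 * z ^ 3"
  proof (cases "x $ 1 = 0")
    case True
    then show ?thesis using D by (intro exI[of _ 0]) simp
  next
    case False
    \<comment> \<open>From p = 3 z^2 and q = -2 z^3 the quotient q / p is -2 z / 3, which determines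
      z.\<close>
    define z where "z = - 3 * x $ 2 / (2 * x $ 1)"
    have zx: "2 * x $ 1 * z = - 3 * x $ 2" using False by (simp add: z_def)
    have "4 * (x $ 1)\<^sup>2 * (3 * z\<^sup>2) = 3 * (2 * x $ 1 * z)\<^sup>2"
      by (simp add: power_mult_distrib)
    also have "\<dots> = 4 * (x $ 1) ^ 3"
      unfolding zx D by (simp add: power_mult_distrib)
    also have "\<dots> = 4 * (x $ 1)\<^sup>2 * x $ 1" by (simp add: power2_eq_square power3_eq_cube)
    finally have 1: "x $ 1 = 3 * z\<^sup>2" using False by simp
    have "3 * x $ 2 = - (2 * x $ 1 * z)" unfolding zx by simp
    also have "\<dots> = 3 * (- 2 * z ^ 3)" unfolding 1 by (simp add: power2_eq_square power3_eq_cube)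
    finally have "x $ 2 = - 2 * z ^ 3" by simp
    with 1 show ?thesis by blast
  qed
  then obtain z where "x $ 1 = 3 * z\<^sup>2" "x $ 2 = - 2 * z ^ 3" by blast
  then have "x = root_curve z 0"
    unfolding vec_eq_iff forall_2 by (simp add: root_curve_def)
  then show ?thesis by blast
qed

section \<open>Analyticity and tangent vectors of the common zero set\<close>

definition P_zeros :: "(complex^2) set \<Rightarrow> (complex^4) set" where
  "P_zeros D = {w \<in> cotangent D. \<forall>k. sym_P k w = 0}"

lemma P_zeros_iff: "w \<in> P_zeros D \<longleftrightarrow> base w \<in> D \<and>
    (w $ 3 = 0 \<and> w $ 4 = 0 \<or> (\<exists>z l. base w = root_curve z 0 \<and> w $ 3 = z * l \<and> w $ 4 = l))"
  unfolding P_zeros_def mem_Collect_eq sym_P_zero_iff by (simp add: cotangent_def)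

lemma holo_sym_P: "holo U (sym_P k)"
proof -
  have "holo U (sym_P 1)" "holo U (sym_P 2)" "holo U (sym_P 3)"
  proof -
    have 1: "sym_P 1 = (\<lambda>w. 1 / 3 * w $ 1 * (w $ 4)\<^sup>2 - (w $ 3)\<^sup>2)"
      by (rule ext) (simp add: sym_P_simps)
    have 2: "sym_P 2 = (\<lambda>w. 1 / 2 * w $ 2 * (w $ 4) ^ 3 + (w $ 3) ^ 3)"
      by (rule ext) (simp add: sym_P_simps)
    have 3: "sym_P 3 = (\<lambda>w. (4 * (w $ 1) ^ 3 - 27 * (w $ 2)\<^sup>2) * (w $ 3)\<^sup>2)"
      by (rule ext) (simp add: sym_P_simps)
    show "holo U (sym_P 1)" unfolding 1 by (intro holo_diff holo_mult holo_power holo_const holo_nth)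
    show "holo U (sym_P 2)" unfolding 2 by (intro holo_add holo_mult holo_power holo_const holo_nth)
    show "holo U (sym_P 3)" unfolding 3 by (intro holo_diff holo_mult holo_power holo_const holo_nth)
  qed
  then show ?thesis using exhaust_3[of k] by auto
qed

lemma analytic_P_zeros:
  assumes "open D"
  shows "analytic_subset (cotangent D) (P_zeros D)"
  unfolding analytic_subset_def
proof (intro conjI ballI)
  show "P_zeros D \<subseteq> cotangent D" by (auto simp: P_zeros_def)
  fix w assume w: "w \<in> cotangent D"
  define f where "f = (\<lambda>i::nat. sym_P (if i = 0 then 1 else if i = 1 then 2 else 3))"
  have "(\<forall>k. sym_P k y = 0) \<longleftrightarrow> (\<forall>i<3. f i y = 0)" for y
    unfolding forall_3 by (auto simp: f_def eval_nat_numeral All_less_Suc)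
  then have "P_zeros D \<inter> cotangent D = common_zeros (cotangent D) 3 f"
    by (auto simp: P_zeros_def common_zeros_def)
  then show "\<exists>U k f. open U \<and> w \<in> U \<and> U \<subseteq> cotangent D \<and> (\<forall>i<k. holo U (f i)) \<and>
      P_zeros D \<inter> U = common_zeros U k f"
    using open_cotangent[OF assms] w holo_sym_P
    by (intro exI[of _ "cotangent D"] exI[of _ 3] exI[of _ f]) (simp add: f_def)
qed

lemma tangent_of_curve_in_P_zeros:
  fixes \<gamma> :: "real \<Rightarrow> complex^4"
  assumes D: "open D" and reg: "regular_at (P_zeros D) w T"
    and \<gamma>: "(\<gamma> has_derivative (\<lambda>t. t *\<^sub>R v)) (at 0)" "\<gamma> 0 = w"
    and zero: "\<And>t k. sym_P k (\<gamma> t) = 0"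
  shows "v \<in> T"
proof (rule tangent_of_curve[OF reg \<gamma>])
  have "w \<in> cotangent D"
    using reg unfolding regular_at_def P_zeros_def by blast
  moreover have "(\<gamma> \<longlongrightarrow> \<gamma> 0) (nhds 0)"
    using has_derivative_continuous[OF \<gamma>(1)] by (simp add: continuous_within tendsto_nhds_iff)
  ultimately have "eventually (\<lambda>t. \<gamma> t \<in> cotangent D) (nhds 0)"
    using open_cotangent[OF D] \<gamma>(2) by (intro topological_tendstoD) auto
  then show "eventually (\<lambda>t. \<gamma> t \<in> P_zeros D) (nhds 0)"
    by eventually_elim (simp add: P_zeros_def zero)
qed

lemma tangent_zero_section:
  assumes "open D" "regular_at (P_zeros D) w T" "w $ 3 = 0" "w $ 4 = 0"
  shows "pt4 a b 0 0 \<in> T"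
proof (rule tangent_of_curve_in_P_zeros[OF assms(1,2)])
  show "((\<lambda>t. w + t *\<^sub>R pt4 a b 0 0) has_derivative (\<lambda>t. t *\<^sub>R pt4 a b 0 0)) (at 0)"
    by (auto intro!: derivative_eq_intros)
  fix t k
  have "\<forall>k. sym_P k (w + t *\<^sub>R pt4 a b 0 0) = 0"
    unfolding sym_P_zero_iff using assms(3,4) by simp
  then show "sym_P k (w + t *\<^sub>R pt4 a b 0 0) = 0" ..
qed simp

lemma conormal_curve_zero: "sym_P k (pt4 (3 * z\<^sup>2) (- 2 * z ^ 3) (z * l) l) = 0"
proof -
  have "\<forall>k. sym_P k (pt4 (3 * z\<^sup>2) (- 2 * z ^ 3) (z * l) l) = 0"
    unfolding sym_P_zero_iff base_eq_root_curve_iff by auto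
  then show ?thesis ..
qed

text \<open>These are the partial derivatives of the parametrization (3 z^2, -2 z^3, z l, l) in l
  and in z.\<close>

lemma tangent_conormal:
  assumes "open D" "regular_at (P_zeros D) w T" "base w = root_curve z 0" "w $ 3 = z * l" "w $ 4 = l"
  shows "pt4 0 0 z 1 \<in> T" "pt4 (6 * z) (- 6 * z\<^sup>2) l 0 \<in> T"
proof -
  have w: "w = pt4 (3 * z\<^sup>2) (- 2 * z ^ 3) (z * l) l"
    using assms(3-5) by (intro pt4_eqI) (auto simp: base_eq_root_curve_iff)
  show "pt4 0 0 z 1 \<in> T"
  proof (rule tangent_of_curve_in_P_zeros[OF assms(1,2)])
    have "((\<lambda>t. pt4 (3 * z\<^sup>2) (- 2 * z ^ 3) (z * (l + of_real t)) (l + of_real t)) has_derivative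
        (\<lambda>t. pt4 (t *\<^sub>R 0) (t *\<^sub>R 0) (t *\<^sub>R z) (t *\<^sub>R 1))) (at 0)"
      by (rule has_derivative_pt4) (auto intro!: derivative_eq_intros simp: scaleR_conv_of_real)
    then show "((\<lambda>t. pt4 (3 * z\<^sup>2) (- 2 * z ^ 3) (z * (l + of_real t)) (l + of_real t)) has_derivative
        (\<lambda>t. t *\<^sub>R pt4 0 0 z 1)) (at 0)"
      unfolding pt4_scaleR .
    show "sym_P k (pt4 (3 * z\<^sup>2) (- 2 * z ^ 3) (z * (l + of_real t)) (l + of_real t)) = 0" for t k
      by (rule conormal_curve_zero)
  qed (simp add: w)
  show "pt4 (6 * z) (- 6 * z\<^sup>2) l 0 \<in> T"
  proof (rule tangent_of_curve_in_P_zeros[OF assms(1,2)])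
    have "((\<lambda>t. pt4 (3 * (z + of_real t)\<^sup>2) (- 2 * (z + of_real t) ^ 3) ((z + of_real t) * l) l) has_derivative
        (\<lambda>t. pt4 (t *\<^sub>R (6 * z)) (t *\<^sub>R (- 6 * z\<^sup>2)) (t *\<^sub>R l) (t *\<^sub>R 0))) (at 0)"
      by (rule has_derivative_pt4) (auto intro!: derivative_eq_intros simp: scaleR_conv_of_real)
    then show "((\<lambda>t. pt4 (3 * (z + of_real t)\<^sup>2) (- 2 * (z + of_real t) ^ 3) ((z + of_real t) * l) l) has_derivative
        (\<lambda>t. t *\<^sub>R pt4 (6 * z) (- 6 * z\<^sup>2) l 0)) (at 0)"
      unfolding pt4_scaleR .
    show "sym_P k (pt4 (3 * (z + of_real t)\<^sup>2) (- 2 * (z + of_real t) ^ 3) ((z + of_real t) * l) l) = 0" for t k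
      by (rule conormal_curve_zero)
  qed (simp add: w)
qed

section \<open>Self-orthogonality of the tangent spaces\<close>

lemma lagrangian_tangent_zero_section:
  assumes D: "open D" and reg: "regular_at (P_zeros D) w T" and w: "w $ 3 = 0" "w $ 4 = 0" "base w \<notin> cusp"
  shows "T = {v. \<forall>u\<in>T. symplectic_form u v = 0}"
proof -
  have "open (- cusp)" using closed_cusp by auto
  then have S: "open (cotangent (- cusp))" by (rule open_cotangent)
  have wS: "w \<in> cotangent (- cusp)" using w(3) by (simp add: cotangent_def)
  have off: "y $ 3 = 0 \<and> y $ 4 = 0" if "y \<in> P_zeros D" "y \<in> cotangent (- cusp)" for y
    using that root_curve_in_cusp by (auto simp: P_zeros_iff cotangent_def)
  have sub: "v $ 3 = 0 \<and> v $ 4 = 0" if v: "v \<in> T" for v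
    using tangent_kills[OF reg v bounded_linear.has_derivative[OF bounded_linear_vec_nth has_derivative_ident, of 3] S wS]
      tangent_kills[OF reg v bounded_linear.has_derivative[OF bounded_linear_vec_nth has_derivative_ident, of 4] S wS]
      off by blast
  have T: "v \<in> T \<longleftrightarrow> v $ 3 = 0 \<and> v $ 4 = 0" for v
  proof
    assume "v $ 3 = 0 \<and> v $ 4 = 0"
    then have "v = pt4 (v $ 1) (v $ 2) 0 0" by (intro pt4_eqI) auto
    then show "v \<in> T" using tangent_zero_section[OF D reg w(1,2)] by metis
  qed (rule sub)
  show ?thesis
  proof (intro equalityI subsetI CollectI ballI)
    fix v u assume "v \<in> T" "u \<in> T"
    then show "symplectic_form u v = 0" by (simp add: T symplectic_form_def)
  next
    fix v assume "v \<in> {v. \<forall>u\<in>T. symplectic_form u v = 0}"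
    then have "symplectic_form (pt4 1 0 0 0) v = 0" "symplectic_form (pt4 0 1 0 0) v = 0"
      using tangent_zero_section[OF D reg w(1,2)] by blast+
    then show "v \<in> T" by (simp add: T symplectic_form_def)
  qed
qed

text \<open>The differentials of \<open>P\<^sub>1\<close> and \<open>P\<^sub>2\<close> restrict
  \<open>T\<close> enough to make it isotropic. Conversely, orthogonality to the two tangent vectors
  of the parametrization already puts a vector into their span, which lies in
  \<open>T\<close>.\<close>

lemma lagrangian_tangent_conormal:
  assumes D: "open D" and reg: "regular_at (P_zeros D) w T"
    and w: "base w = root_curve z 0" "w $ 3 = z * l" "w $ 4 = l" and l: "l \<noteq> 0"
  shows "T = {v. \<forall>u\<in>T. symplectic_form u v = 0}"
proof -
  note tan = tangent_conormal[OF D reg w]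
  have w12: "w $ 1 = 3 * z\<^sup>2" "w $ 2 = - 2 * z ^ 3"
    using w(1) by (auto simp: base_eq_root_curve_iff)
  have dP1: "(sym_P 1 has_derivative (\<lambda>v. v $ 1 / 3 * l\<^sup>2 + w $ 1 / 3 * (2 * l * v $ 4) - 2 * (z * l) * v $ 3)) (at w)"
    unfolding sym_P_simps[abs_def]
    by (auto intro!: derivative_eq_intros bounded_linear.has_derivative[OF bounded_linear_vec_nth] simp: w(2,3))
  have dP2: "(sym_P 2 has_derivative (\<lambda>v. v $ 2 / 2 * l ^ 3 + w $ 2 / 2 * (3 * l\<^sup>2 * v $ 4) + 3 * (z * l)\<^sup>2 * v $ 3)) (at w)"
    unfolding sym_P_simps[abs_def]
    by (auto intro!: derivative_eq_intros bounded_linear.has_derivative[OF bounded_linear_vec_nth] simp: w(2,3))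
  have sub: "l * v $ 1 = 6 * z * (v $ 3 - z * v $ 4) \<and> l * v $ 2 = - 6 * z\<^sup>2 * (v $ 3 - z * v $ 4)" if v: "v \<in> T" for v
  proof
    have "v $ 1 / 3 * l\<^sup>2 + w $ 1 / 3 * (2 * l * v $ 4) - 2 * (z * l) * v $ 3 = 0"
      by (rule tangent_kills[OF reg v dP1 open_UNIV UNIV_I]) (simp add: P_zeros_def)
    then have "l * (l * v $ 1 - 6 * z * (v $ 3 - z * v $ 4)) = 0"
      unfolding w12 by (simp add: field_simps power2_eq_square)
    then show "l * v $ 1 = 6 * z * (v $ 3 - z * v $ 4)" using l by simp
    have "v $ 2 / 2 * l ^ 3 + w $ 2 / 2 * (3 * l\<^sup>2 * v $ 4) + 3 * (z * l)\<^sup>2 * v $ 3 = 0"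
      by (rule tangent_kills[OF reg v dP2 open_UNIV UNIV_I]) (simp add: P_zeros_def)
    then have "l\<^sup>2 * (l * v $ 2 - (- 6 * z\<^sup>2 * (v $ 3 - z * v $ 4))) = 0"
      unfolding w12 by (simp add: field_simps power2_eq_square power3_eq_cube)
    then show "l * v $ 2 = - 6 * z\<^sup>2 * (v $ 3 - z * v $ 4)"
      using l by (simp only: mult_eq_0_iff zero_eq_power2 right_minus_eq simp_thms)
  qed
  show ?thesis
  proof (intro equalityI subsetI CollectI ballI)
    fix v u assume uv: "v \<in> T" "u \<in> T"
    have "l * symplectic_form u v = u $ 3 * (l * v $ 1) - (l * u $ 1) * v $ 3 + u $ 4 * (l * v $ 2) - (l * u $ 2) * v $ 4"
      by (simp add: symplectic_form_def algebra_simps)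
    also have "\<dots> = u $ 3 * (6 * z * (v $ 3 - z * v $ 4)) - (6 * z * (u $ 3 - z * u $ 4)) * v $ 3
        + u $ 4 * (- 6 * z\<^sup>2 * (v $ 3 - z * v $ 4)) - (- 6 * z\<^sup>2 * (u $ 3 - z * u $ 4)) * v $ 4"
      using sub[OF uv(1)] sub[OF uv(2)] by (simp only:)
    also have "\<dots> = 0"
      by (simp add: algebra_simps power2_eq_square)
    finally show "symplectic_form u v = 0" using l by simp
  next
    fix v assume "v \<in> {v. \<forall>u\<in>T. symplectic_form u v = 0}"
    then have "symplectic_form (pt4 0 0 z 1) v = 0" "symplectic_form (pt4 (6 * z) (- 6 * z\<^sup>2) l 0) v = 0"
      using tan by blast+
    then have e1: "z * v $ 1 + v $ 2 = 0" and e2: "l * v $ 1 - 6 * z * v $ 3 + 6 * z\<^sup>2 * v $ 4 = 0"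
      by (simp_all add: symplectic_form_def)
    have "l * v $ 1 - 6 * z * (v $ 3 - z * v $ 4) = l * v $ 1 - 6 * z * v $ 3 + 6 * z\<^sup>2 * v $ 4"
      by (simp add: power2_eq_square right_diff_distrib)
    then have e: "z * v $ 1 + v $ 2 = 0" "l * v $ 1 = 6 * z * (v $ 3 - z * v $ 4)"
      using e1 e2 by (simp_all only: right_minus_eq)
    \<comment> \<open>The coordinate along the z-derivative, solved from the third component
      \<open>v $ 3 = a * l + z * v $ 4\<close>.\<close>
    define a where "a = (v $ 3 - z * v $ 4) / l"
    have v1: "v $ 1 = a * (6 * z)" using e(2) l by (simp add: a_def field_simps)
    have "v $ 2 = - (z * v $ 1)" using e(1) by (simp add: add_eq_0_iff)
    then have v2: "v $ 2 = a * (- 6 * z\<^sup>2)" unfolding v1 by (simp add: power2_eq_square)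
    have v3: "v $ 3 = a * l + z * v $ 4" using l by (simp add: a_def)
    have "v = a *s pt4 (6 * z) (- 6 * z\<^sup>2) l 0 + v $ 4 *s pt4 0 0 z 1"
      unfolding vec_eq_iff forall_4 using v1 v2 v3 by (simp add: mult.commute)
    then show "v \<in> T"
      using regular_at_subspace(1)[OF reg regular_at_subspace(2)[OF reg tan(2), of a] regular_at_subspace(2)[OF reg tan(1), of "v $ 4"]]
      by simp
  qed
qed

text \<open>At a point of the zero section over the cusp, a tangent space would contain the zero section
  and the conormal direction, hence also their sum, which is not tangent to either component.\<close>

lemma not_regular_over_cusp:
  assumes D: "open D" and w: "w $ 3 = 0" "w $ 4 = 0" "base w = root_curve z 0"
  shows "\<not> regular_at (P_zeros D) w T"
proof
  assume reg: "regular_at (P_zeros D) w T"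
  have "pt4 0 1 0 0 + pt4 0 0 z 1 \<in> T"
    using tangent_zero_section[OF D reg w(1,2)] tangent_conormal(1)[OF D reg w(3), of 0] w(1,2)
    by (intro regular_at_subspace(1)[OF reg]) auto
  moreover have "pt4 0 1 0 0 + pt4 0 0 z 1 = pt4 0 1 z 1"
    by (rule pt4_eqI) simp_all
  ultimately have v: "pt4 0 1 z 1 \<in> T" by simp
  \<comment> \<open>Starting at 1/2 keeps \<open>1 + u $ 4\<close> non-zero, so that all secant
    points lie off the zero section and hence on the conormal.\<close>
  have "\<forall>n. \<exists>\<epsilon> u. 0 < \<epsilon> \<and> norm u \<le> inverse (real (Suc (Suc n))) \<and> w + \<epsilon> *\<^sub>R (pt4 0 1 z 1 + u) \<in> P_zeros D"
  proof
    fix n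
    have "inverse (real (Suc (Suc n))) > 0" by simp
    from tangent_approx[OF reg v this zero_less_one]
    show "\<exists>\<epsilon> u. 0 < \<epsilon> \<and> norm u \<le> inverse (real (Suc (Suc n))) \<and> w + \<epsilon> *\<^sub>R (pt4 0 1 z 1 + u) \<in> P_zeros D"
      by blast
  qed
  then obtain \<epsilon> where "\<forall>n. \<exists>u. 0 < \<epsilon> n \<and> norm u \<le> inverse (real (Suc (Suc n))) \<and> w + \<epsilon> n *\<^sub>R (pt4 0 1 z 1 + u) \<in> P_zeros D"
    by (rule choice[THEN exE])
  then obtain u where u: "\<forall>n. 0 < \<epsilon> n \<and> norm (u n) \<le> inverse (real (Suc (Suc n))) \<and> w + \<epsilon> n *\<^sub>R (pt4 0 1 z 1 + u n) \<in> P_zeros D"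
    by (rule choice[THEN exE])
  have "u \<longlonglongrightarrow> 0"
  proof (rule Lim_null_comparison)
    show "eventually (\<lambda>n. norm (u n) \<le> inverse (real (Suc (Suc n)))) sequentially"
      using u by simp
    show "(\<lambda>n. inverse (real (Suc (Suc n)))) \<longlonglongrightarrow> 0"
      using LIMSEQ_Suc[OF LIMSEQ_inverse_real_of_nat] by simp
  qed
  then have lim: "(\<lambda>n. u n $ i) \<longlonglongrightarrow> 0" for i
    using tendsto_vec_nth[of u 0 sequentially i] by simp
  have u4: "1 + u n $ 4 \<noteq> 0" for n
  proof
    assume "1 + u n $ 4 = 0"
    then have "u n $ 4 = - 1" by (rule minus_unique[symmetric])
    then have "1 \<le> norm (u n)" using Finite_Cartesian_Product.norm_nth_le[of "u n" 4] by simp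
    also have "\<dots> \<le> inverse (real (Suc (Suc n)))" using u by blast
    also have "\<dots> < 1" by (simp add: field_simps)
    finally show False by simp
  qed
  \<comment> \<open>The ratio of the two covector components at the n-th secant point, which must be
    its parameter on the cusp.\<close>
  define y where "y = (\<lambda>n. (z + u n $ 3) / (1 + u n $ 4))"
  have ylim: "y \<longlonglongrightarrow> z"
  proof -
    have "y \<longlonglongrightarrow> (z + 0) / (1 + 0)"
      unfolding y_def by (intro tendsto_intros lim) simp
    then show ?thesis by simp
  qed
  have eqs: "of_real (\<epsilon> n) * u n $ 1 = 3 * ((y n)\<^sup>2 - z\<^sup>2)"
    "of_real (\<epsilon> n) * (1 + u n $ 2) = - 2 * ((y n) ^ 3 - z ^ 3)" for n
  proof -
    define x where "x = w + \<epsilon> n *\<^sub>R (pt4 0 1 z 1 + u n)"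
    have sc: "(\<epsilon> n *\<^sub>R q) $ i = of_real (\<epsilon> n) * q $ i" for q :: "complex^4" and i
      unfolding vector_scaleR_component by (rule scaleR_conv_of_real)
    have x: "x $ 1 = 3 * z\<^sup>2 + of_real (\<epsilon> n) * u n $ 1" "x $ 2 = - 2 * z ^ 3 + of_real (\<epsilon> n) * (1 + u n $ 2)"
      "x $ 3 = of_real (\<epsilon> n) * (z + u n $ 3)" "x $ 4 = of_real (\<epsilon> n) * (1 + u n $ 4)"
      using w unfolding base_eq_root_curve_iff by (simp_all add: x_def sc del: vector_scaleR_component)
    have "\<epsilon> n > 0" using u by blast
    then have \<epsilon>: "of_real (\<epsilon> n) \<noteq> (0 :: complex)" by simp
    then have "x $ 4 \<noteq> 0" unfolding x using u4 by simp
    moreover have "x \<in> P_zeros D" using u by (simp add: x_def)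
    ultimately obtain z' l where z': "base x = root_curve z' 0" "x $ 3 = z' * l" "x $ 4 = l"
      unfolding P_zeros_iff by blast
    have "of_real (\<epsilon> n) * (z + u n $ 3) = of_real (\<epsilon> n) * (z' * (1 + u n $ 4))"
      using z'(2) unfolding z'(3)[symmetric] x(3,4) by (simp only: mult_ac)
    then have "z + u n $ 3 = z' * (1 + u n $ 4)" by (rule iffD1[OF mult_left_cancel[OF \<epsilon>]])
    then have "z' = y n"
      unfolding y_def nonzero_eq_divide_eq[OF u4] by (rule sym)
    then have "x $ 1 = 3 * (y n)\<^sup>2" "x $ 2 = - 2 * (y n) ^ 3"
      using z'(1) by (simp_all add: base_eq_root_curve_iff)
    then show "of_real (\<epsilon> n) * u n $ 1 = 3 * ((y n)\<^sup>2 - z\<^sup>2)"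
      "of_real (\<epsilon> n) * (1 + u n $ 2) = - 2 * ((y n) ^ 3 - z ^ 3)"
      unfolding x by (simp_all add: algebra_simps)
  qed
  have "\<epsilon> n > 0" for n using u by blast
  then have \<epsilon>: "of_real (\<epsilon> n) \<noteq> (0 :: complex)" for n
    by (simp add: order_less_imp_not_eq2)
  \<comment> \<open>The base points lie on the cusp, yet move in the direction (u 1, 1 + u 2), which
    tends to (0, 1), while the cusp has direction (1, -z). Both cases cancel \<epsilon> between the
    two equations; the relation used for \<open>z \<noteq> 0\<close> would degenerate to 0 = 0 in
    the limit at z = 0, hence a separate one there.\<close>
  show False
  proof (cases "z = 0")
    case True
    have e: "- 2 * y n * u n $ 1 = 3 * (1 + u n $ 2)" for n
    proof -
      have "of_real (\<epsilon> n) * (- 2 * y n * u n $ 1) = - 2 * y n * (of_real (\<epsilon> n) * u n $ 1)" by simp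
      also have "\<dots> = 3 * (- 2 * ((y n) ^ 3 - z ^ 3))"
        unfolding eqs True by (simp add: power2_eq_square power3_eq_cube)
      also have "\<dots> = of_real (\<epsilon> n) * (3 * (1 + u n $ 2))" unfolding eqs(2)[symmetric] by simp
      finally show ?thesis by (rule iffD1[OF mult_left_cancel[OF \<epsilon>]])
    qed
    have 1: "(\<lambda>n. - 2 * y n * u n $ 1) \<longlonglongrightarrow> - 2 * z * 0"
      by (intro tendsto_intros lim ylim)
    have 2: "(\<lambda>n. 3 * (1 + u n $ 2)) \<longlonglongrightarrow> 3 * (1 + 0)"
      by (intro tendsto_intros lim)
    have "- 2 * z * 0 = 3 * (1 + 0 :: complex)"
      by (rule LIMSEQ_unique[OF 1[unfolded e] 2])
    then show False by simp
  next
    case False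
    have e: "- 3 * (1 + u n $ 2) * (y n + z) = 2 * u n $ 1 * ((y n)\<^sup>2 + y n * z + z\<^sup>2)" for n
    proof -
      have "of_real (\<epsilon> n) * (- 3 * (1 + u n $ 2) * (y n + z)) = - 3 * (of_real (\<epsilon> n) * (1 + u n $ 2)) * (y n + z)"
        by (simp only: mult_ac)
      also have "\<dots> = 2 * (3 * ((y n)\<^sup>2 - z\<^sup>2)) * ((y n)\<^sup>2 + y n * z + z\<^sup>2)"
        unfolding eqs by (simp add: power2_eq_square power3_eq_cube algebra_simps)
      also have "\<dots> = of_real (\<epsilon> n) * (2 * u n $ 1 * ((y n)\<^sup>2 + y n * z + z\<^sup>2))"
        unfolding eqs(1)[symmetric] by (simp only: mult_ac)
      finally show ?thesis by (rule iffD1[OF mult_left_cancel[OF \<epsilon>]])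
    qed
    have 1: "(\<lambda>n. - 3 * (1 + u n $ 2) * (y n + z)) \<longlonglongrightarrow> - 3 * (1 + 0) * (z + z)"
      by (intro tendsto_intros lim ylim)
    have 2: "(\<lambda>n. 2 * u n $ 1 * ((y n)\<^sup>2 + y n * z + z\<^sup>2)) \<longlonglongrightarrow> 2 * 0 * (z\<^sup>2 + z * z + z\<^sup>2)"
      by (intro tendsto_intros lim ylim)
    have "- 3 * (1 + 0) * (z + z) = 2 * 0 * (z\<^sup>2 + z * z + z\<^sup>2)"
      by (rule LIMSEQ_unique[OF 1[unfolded e] 2])
    then show False using False by simp
  qed
qed

lemma lagrangian_P_zeros:
  assumes "open D"
  shows "lagrangian D (P_zeros D)"
  unfolding lagrangian_def
proof (intro conjI analytic_P_zeros[OF assms] allI impI)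
  fix w T assume reg: "regular_at (P_zeros D) w T"
  then have "w \<in> P_zeros D" by (simp add: regular_at_def)
  then consider "w $ 3 = 0" "w $ 4 = 0" "base w \<notin> cusp" | "w $ 3 = 0" "w $ 4 = 0" "base w \<in> cusp"
    | z l where "base w = root_curve z 0" "w $ 3 = z * l" "w $ 4 = l" "l \<noteq> 0"
    unfolding P_zeros_iff by force
  then show "T = {v. \<forall>u\<in>T. symplectic_form u v = 0}"
  proof cases
    case 1
    then show ?thesis by (rule lagrangian_tangent_zero_section[OF assms reg])
  next
    case 2
    then show ?thesis using cusp_param not_regular_over_cusp[OF assms 2(1,2)] reg by blast
  next
    case 3
    then show ?thesis by (rule lagrangian_tangent_conormal[OF assms reg])
  qed
qed

section \<open>The conormal of the cusp\<close>

lemma Discr_has_derivative: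
  "(Discr has_derivative (\<lambda>v. 12 * (x $ 1)\<^sup>2 * v $ 1 - 54 * x $ 2 * v $ 2)) (at x)"
  unfolding Discr_def[abs_def]
  by (auto intro!: derivative_eq_intros bounded_linear.has_derivative[OF bounded_linear_vec_nth])

lemma holo_Discr: "holo U Discr"
  unfolding Discr_def[abs_def] by (intro holo_diff holo_mult holo_power holo_const holo_nth)

text \<open>On the cusp the differential of \<open>Discr\<close> is 108 z^3 (z dp + dq), which is
  non-zero away from the origin.\<close>

lemma regular_cusp:
  assumes "z \<noteq> 0"
  shows "regular_at cusp (root_curve z 0) {v. z * v $ 1 + v $ 2 = 0}"
proof -
  define x where "x = root_curve z 0"
  have x: "x $ 1 = 3 * z\<^sup>2" "x $ 2 = - 2 * z ^ 3"
    by (simp_all add: x_def root_curve_def)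
  have fd: "frechet_derivative Discr (at x) = (\<lambda>v. 108 * z ^ 3 * (z * v $ 1 + v $ 2))"
    unfolding frechet_derivative_at[OF Discr_has_derivative, symmetric] x
    by (rule ext) (simp add: algebra_simps power2_eq_square power3_eq_cube)
  show ?thesis
    unfolding regular_at_def x_def[symmetric]
  proof (intro conjI exI[of _ UNIV] exI[of _ "1 :: nat"] exI[of _ "\<lambda>_. Discr"])
    show "x \<in> cusp" unfolding x_def by (rule root_curve_in_cusp)
    show "cusp \<inter> UNIV = common_zeros UNIV 1 (\<lambda>_. Discr)"
      by (auto simp: cusp_def common_zeros_def)
    show "\<forall>c. (\<forall>v. (\<Sum>i<1. c i * frechet_derivative Discr (at x) v) = 0) \<longrightarrow> (\<forall>i<(1::nat). c i = 0)"
    proof (intro allI impI)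
      fix c :: "nat \<Rightarrow> complex" and i :: nat
      assume c: "\<forall>v. (\<Sum>i<1. c i * frechet_derivative Discr (at x) v) = 0" and i: "i < 1"
      have "c 0 * frechet_derivative Discr (at x) (axis 2 1) = 0"
        using c[rule_format, of "axis 2 1"] by simp
      then have "c 0 = 0" unfolding fd using assms by (simp add: axis_def)
      then show "c i = 0" using i by simp
    qed
    show "{v. z * v $ 1 + v $ 2 = 0} = {v. \<forall>i<(1::nat). frechet_derivative Discr (at x) v = 0}"
      unfolding fd using assms by auto
  qed (simp_all add: holo_Discr)
qed

lemma tendsto_csqrt_0: "(csqrt \<longlongrightarrow> 0) (at 0)"
proof (rule tendsto_norm_zero_cancel)
  have "((\<lambda>x::complex. sqrt (cmod x)) \<longlongrightarrow> sqrt (cmod 0)) (at 0)"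
    by (intro tendsto_intros)
  then show "((\<lambda>x. norm (csqrt x)) \<longlongrightarrow> 0) (at 0)"
    by (simp add: norm_csqrt)
qed

text \<open>The cusp is parametrized by \<open>p\<close> here, through a square root, so that the curve has a non-zero
  velocity at the origin.\<close>

lemma cusp_tangent_at_origin:
  assumes "regular_at cusp (root_curve 0 0) T"
  shows "axis 1 1 \<in> T"
proof (rule tangent_of_curve[OF assms])
  \<comment> \<open>Solves 3 c^2 = t, so that the first coordinate of the curve is its
    parameter.\<close>
  define c where "c = (\<lambda>t::real. csqrt (of_real t / 3))"
  define \<gamma> where "\<gamma> = (\<lambda>t. root_curve (c t) 0)"
  have c2: "(c t)\<^sup>2 = of_real t / 3" for t by (simp add: c_def)
  have \<gamma>: "\<gamma> t = vector [of_real t, (of_real t * (- 2 / 3)) * c t]" for t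
  proof -
    have "c t ^ 3 = (c t)\<^sup>2 * c t" by (simp add: power2_eq_square power3_eq_cube)
    then have c3: "c t ^ 3 = of_real t / 3 * c t" unfolding c2 .
    show ?thesis unfolding \<gamma>_def root_curve_def c2 c3 by (simp add: mult_ac)
  qed
  have cc: "continuous (at 0) c"
  proof -
    have "((\<lambda>t::real. of_real t / 3 :: complex) \<longlongrightarrow> of_real 0 / 3) (at 0)"
      by (intro tendsto_intros) simp
    then have "((\<lambda>t::real. of_real t / 3 :: complex) \<longlongrightarrow> 0) (at 0)" by simp
    moreover have "isCont csqrt 0" using tendsto_csqrt_0 by (simp add: isCont_def)
    ultimately have "(c \<longlongrightarrow> csqrt 0) (at 0)"
      unfolding c_def by (rule isCont_tendsto_compose[rotated])
    then show ?thesis by (simp add: continuous_within c_def)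
  qed
  have dN: "((\<lambda>t. of_real t * (- 2 / 3)) has_derivative (\<lambda>t. of_real t * (- 2 / 3) :: complex)) (at (0::real))"
    by (auto intro!: derivative_eq_intros)
  \<comment> \<open>The second coordinate -2 c^3 is a linear function vanishing at 0 times
    \<open>c\<close>, which is merely continuous there; its velocity is a multiple of
    \<open>c 0 = 0\<close>.\<close>
  have "((\<lambda>t. (of_real t * (- 2 / 3)) * c t) has_derivative (\<lambda>t. (of_real t * (- 2 / 3)) * c 0)) (at (0::real))"
    by (rule has_derivative_mult_continuous[OF dN _ cc]) simp
  moreover have "c 0 = 0" by (simp add: c_def)
  ultimately have "(\<gamma> has_derivative (\<lambda>t. vector [of_real t, 0])) (at 0)"
    unfolding \<gamma>[abs_def]
    by (intro has_derivative_vector_2) (auto intro!: derivative_eq_intros)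
  moreover have "vector [of_real t, 0] = t *\<^sub>R (axis 1 1 :: complex^2)" for t
    unfolding vec_eq_iff forall_2 by (simp add: axis_def scaleR_conv_of_real[where 'a = complex])
  ultimately show "(\<gamma> has_derivative (\<lambda>t. t *\<^sub>R axis 1 1)) (at 0)" by simp
  show "\<gamma> 0 = root_curve 0 0" by (simp add: \<gamma>_def c_def)
  show "eventually (\<lambda>t. \<gamma> t \<in> cusp) (nhds 0)"
    by (simp add: \<gamma>_def root_curve_in_cusp)
qed

text \<open>Regularity at the origin is not refuted: any tangent space there would contain (1, 0),
  the limit of the directions (1, -z). The conormal relation
  \<open>\<xi>\<^sub>1 = z \<xi>\<^sub>2\<close> thus follows uniformly in z.\<close>

lemma cusp_tangent:
  assumes "regular_at cusp (root_curve z 0) T"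
  shows "\<exists>a. a \<noteq> 0 \<and> vector [a, - z * a] \<in> T"
proof (cases "z = 0")
  case True
  have "(vector [1, - z * 1] :: complex^2) = axis 1 1"
    unfolding vec_eq_iff forall_2 by (simp add: axis_def True)
  then show ?thesis
    using cusp_tangent_at_origin assms True by (intro exI[of _ 1]) simp
next
  case False
  have "vector [6 * z, - z * (6 * z)] \<in> T"
  proof (rule tangent_of_curve[OF assms])
    have "((\<lambda>t. vector [3 * (z + of_real t)\<^sup>2, - 2 * (z + of_real t) ^ 3] :: complex^2) has_derivative
        (\<lambda>t. vector [of_real t * (6 * z), of_real t * (- z * (6 * z))])) (at (0::real))"
      by (intro has_derivative_vector_2) (auto intro!: derivative_eq_intros simp: power2_eq_square)
    moreover have "vector [of_real t * (6 * z), of_real t * (- z * (6 * z))] = t *\<^sub>R (vector [6 * z, - z * (6 * z)] :: complex^2)" for t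
      unfolding vec_eq_iff forall_2 by (simp add: scaleR_conv_of_real[where 'a = complex])
    moreover have "vector [3 * (z + of_real t)\<^sup>2, - 2 * (z + of_real t) ^ 3] = root_curve (z + of_real t) 0" for t
      by (simp add: root_curve_def)
    ultimately show "((\<lambda>t. root_curve (z + of_real t) 0) has_derivative (\<lambda>t. t *\<^sub>R vector [6 * z, - z * (6 * z)])) (at (0::real))"
      by simp
    show "eventually (\<lambda>t::real. root_curve (z + of_real t) 0 \<in> cusp) (nhds 0)"
      by (simp add: root_curve_in_cusp)
  qed simp
  then show ?thesis using False by (intro exI[of _ "6 * z"]) simp
qed

lemma conormal_cusp_zero_section:
  "{w. \<forall>k. sym_P k w = 0} = conormal cusp \<union> {w. w $ 3 = 0 \<and> w $ 4 = 0}"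
proof -
  define C where "C = {w. \<exists>T. regular_at cusp (base w) T \<and> (\<forall>v\<in>T. w $ 3 * v $ 1 + w $ 4 * v $ 2 = 0)}"
  have con: "conormal cusp = closure C" by (simp add: conormal_def C_def)
  have "C \<subseteq> {w. \<forall>k. sym_P k w = 0}"
  proof
    fix w assume "w \<in> C"
    then obtain T where T: "regular_at cusp (base w) T" "\<forall>v\<in>T. w $ 3 * v $ 1 + w $ 4 * v $ 2 = 0"
      unfolding C_def by blast
    have "base w \<in> cusp" using T(1) by (simp add: regular_at_def)
    then obtain z where z: "base w = root_curve z 0" using cusp_param by blast
    obtain a where a: "a \<noteq> 0" "vector [a, - z * a] \<in> T"
      using cusp_tangent T(1) unfolding z by blast
    have "w $ 3 * (vector [a, - z * a] :: complex^2) $ 1 + w $ 4 * (vector [a, - z * a] :: complex^2) $ 2 = 0"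
      using T(2) a(2) by blast
    then have "a * (w $ 3 - z * w $ 4) = 0" by (simp add: algebra_simps)
    then have "w $ 3 = z * w $ 4" using a(1) by simp
    then show "w \<in> {w. \<forall>k. sym_P k w = 0}"
      unfolding mem_Collect_eq sym_P_zero_iff using z by blast
  qed
  moreover have "closed {w. \<forall>k. sym_P k w = 0}"
  proof -
    have "closed {w. sym_P k w = 0}" for k
      using holo_imp_continuous_on[OF holo_sym_P[of UNIV k]] by (intro closed_Collect_eq continuous_on_const)
    then have "closed (\<Inter>k. {w. sym_P k w = 0})" by blast
    moreover have "(\<Inter>k. {w. sym_P k w = 0}) = {w. \<forall>k. sym_P k w = 0}" by blast
    ultimately show ?thesis by simp
  qed
  ultimately have sub1: "closure C \<subseteq> {w. \<forall>k. sym_P k w = 0}" by (rule closure_minimal)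
  have sub2: "{w. w $ 3 = 0 \<and> w $ 4 = 0} \<subseteq> {w. \<forall>k. sym_P k w = 0}"
    unfolding sym_P_zero_iff by blast
  have reg: "pt4 (3 * z\<^sup>2) (- 2 * z ^ 3) (z * l) l \<in> C" if "z \<noteq> 0" for z l
  proof -
    have b: "base (pt4 (3 * z\<^sup>2) (- 2 * z ^ 3) (z * l) l) = root_curve z 0"
      unfolding base_eq_root_curve_iff by simp
    have "z * l * v $ 1 + l * v $ 2 = 0" if "v \<in> {v. z * v $ 1 + v $ 2 = 0}" for v :: "complex^2"
    proof -
      have "z * l * v $ 1 + l * v $ 2 = l * (z * v $ 1 + v $ 2)" by (simp add: algebra_simps)
      then show ?thesis using that by simp
    qed
    then show ?thesis
      unfolding C_def mem_Collect_eq b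
      by (intro exI[of _ "{v. z * v $ 1 + v $ 2 = 0}"] conjI regular_cusp[OF that] ballI) simp
  qed
  have cl: "pt4 (3 * z\<^sup>2) (- 2 * z ^ 3) (z * l) l \<in> closure C" for z l
  proof (cases "z = 0")
    case False
    then show ?thesis using reg closure_subset by blast
  next
    case True
    \<comment> \<open>The fibre over the origin is obtained as a limit of fibres over points with
      \<open>z \<noteq> 0\<close>, keeping \<open>l\<close> fixed.\<close>
    have "((\<lambda>z. pt4 (3 * z\<^sup>2) (- 2 * z ^ 3) (z * l) l) \<longlongrightarrow> pt4 (3 * 0\<^sup>2) (- 2 * 0 ^ 3) (0 * l) l) (at 0)"
      by (intro tendsto_pt4 tendsto_intros)
    moreover have "eventually (\<lambda>z::complex. z \<noteq> 0) (at 0)"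
      by (simp add: eventually_at_filter)
    then have "eventually (\<lambda>z. pt4 (3 * z\<^sup>2) (- 2 * z ^ 3) (z * l) l \<in> closure C) (at 0)"
      by eventually_elim (use reg closure_subset in blast)
    ultimately show ?thesis
      unfolding True by (intro Lim_in_closed_set[OF closed_closure]) auto
  qed
  have "{w. \<forall>k. sym_P k w = 0} \<subseteq> closure C \<union> {w. w $ 3 = 0 \<and> w $ 4 = 0}"
  proof
    fix w assume "w \<in> {w. \<forall>k. sym_P k w = 0}"
    then consider "w $ 3 = 0 \<and> w $ 4 = 0" | z l where "base w = root_curve z 0" "w $ 3 = z * l" "w $ 4 = l"
      unfolding mem_Collect_eq sym_P_zero_iff by blast
    then show "w \<in> closure C \<union> {w. w $ 3 = 0 \<and> w $ 4 = 0}"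
    proof cases
      case 2
      then have "w = pt4 (3 * z\<^sup>2) (- 2 * z ^ 3) (z * l) l"
        by (intro pt4_eqI) (auto simp: base_eq_root_curve_iff)
      then show ?thesis using cl by simp
    qed simp
  qed
  then show ?thesis unfolding con using sub1 sub2 by blast
qed

lemma open_polydisc: "open (polydisc r1 r2)"
  unfolding polydisc_def by (intro open_Collect_conj open_Collect_less continuous_intros)

theorem theorem6p2:
  fixes r1 r2 :: real and D :: "(complex^2) set" and R :: "3 \<Rightarrow> 2 \<Rightarrow> 2 \<Rightarrow> dop"
  assumes "r1 > 0" and "r2 > 0" and "D = polydisc r1 r2"
    and "\<And>k i j. R k i j \<in> diffops D"
    and "\<And>k i j. i \<noteq> j \<Longrightarrow> order_le D (int (deg_P k) - 1) (R k i j)"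
    and "\<And>k i. has_order D (deg_P k) (R k i i)"
    and "\<And>k i w. w \<in> cotangent D \<Longrightarrow> symbol (deg_P k) (R k i i) w = sym_P k w"
    and "\<And>k i W z x. \<lbrakk>open W; W \<subseteq> D; branch W z; x \<in> W\<rbrakk> \<Longrightarrow>
           dapply (R k i 1) z x + dapply (R k i 2) (\<lambda>y. (z y)^2) x = 0"
  shows "characteristic_variety D (module_M R) \<subseteq> (\<Inter>k. {w\<in>cotangent D. sym_P k w = 0})
    \<and> (\<Inter>k. {w\<in>cotangent D. sym_P k w = 0})
        = (conormal cusp \<union> {w. w$3 = 0 \<and> w$4 = 0}) \<inter> cotangent D
    \<and> holonomic D (module_M R)
    \<and> (\<forall>U. open U \<and> simply_connected U \<and> U \<subseteq> D - cusp \<longrightarrow>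
         (\<exists>z. branch U z) \<and>
         (\<forall>z. branch U z \<longrightarrow>
            defines_solution (module_M R) U (\<lambda>j. if j = 1 then z else (\<lambda>y. (z y)^2))))"
proof -
  have D: "open D" using assms(3) open_polydisc by simp
  interpret cusp_system D R
    by (rule cusp_system.intro[OF D assms(4,5) _ assms(7,8)])
       (use assms(6) in \<open>simp_all add: has_order_def\<close>)
  have inter: "(\<Inter>k. {w\<in>cotangent D. sym_P k w = 0}) = P_zeros D"
    by (auto simp: P_zeros_def)
  have char: "characteristic_variety D (module_M R) = P_zeros D"
    unfolding characteristic_variety_eq P_zeros_def by (rule refl)
  have "P_zeros D = {w. \<forall>k. sym_P k w = 0} \<inter> cotangent D"
    by (auto simp: P_zeros_def)
  then have zeros: "P_zeros D = (conormal cusp \<union> {w. w$3 = 0 \<and> w$4 = 0}) \<inter> cotangent D"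
    unfolding conormal_cusp_zero_section .
  have "holonomic D (module_M R)"
    unfolding holonomic_def char using coherent_module lagrangian_P_zeros[OF D] by blast
  moreover have "(\<exists>z. branch U z) \<and> (\<forall>z. branch U z \<longrightarrow> defines_solution (module_M R) U (root_pair z))"
    if U: "open U \<and> simply_connected U \<and> U \<subseteq> D - cusp" for U
  proof (intro conjI allI impI)
    show "\<exists>z. branch U z" using U by (intro ex_branch) auto
    fix z assume z: "branch U z"
    interpret cusp_solution D R U z
      by unfold_locales (use U z in auto)
    show "defines_solution (module_M R) U (root_pair z)" by (rule defines_solution)
  qed
  ultimately show ?thesis
    unfolding inter char using zeros by blast
qed

end
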